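(* Let $3\leqslant n\leqslant 7$, $M=\mathbb{T}^{n-1}\times[-1,1]$, $\partial_\pm M=\mathbb{T}^{n-1}\times\{\pm1\}$, and let $(M,g,q)$ be an initial data set satisfying the dominant energy condition $\mu\geqslant|J|$. Assume that $\operatorname{tr}_{\partial_+M}Q^+\geqslant 0$ on $\partial_+M$ with respect to the outward unit normal and $\operatorname{tr}_{\partial_-M}Q^+\leqslant 0$ on $\partial_-M$ with respect to the inward unit normal. Let $\{\Sigma_t\}_{t\in[0,l]}$ be the foliation of $M$ described in the context, with unit normal $\nu_t$ pointing to the $t$ direction. Let $\{e_i\}_{i=1}^n$ be an orthonormal frame such that $e_n=\nu_t$, and put $$\hat R_{ijkl}=R_{ijkl}+q_{jk}q_{il}-q_{ik}q_{jl}.$$ Then, for all $i<n$, $j<n$, $k<n$, $l<n$, $$\nabla_iq_{jn}-\nabla_jq_{in}=0,$$ $$\hat R_{njkn}=\nabla_nq_{jk}-\nabla_jq_{nk},$$ $$\hat R_{ijkl}=0,$$ $$\hat R_{ijkn}=-(\nabla_iq_{jk}-\nabla_jq_{ik}).$$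
   Context: An initial data set $(M,g,q)$ is a Riemannian manifold $(M,g)$ with non-empty boundary together with a symmetric 2-tensor $q$. $2\mu=R_g+(\operatorname{tr}_gq)^2-|q|_g^2$ and $J=\operatorname{div}_gq-\mathrm{d}(\operatorname{tr}_gq)$, where $R_g$ is the scalar curvature of $g$. For a two-sided hypersurface $\Sigma$ with unit normal $\nu$, $h=\nabla^g\nu$ is the second fundamental form, $H$ is its trace (the mean curvature), and $Q^+=h+q|_\Sigma$ is the null second fundamental form with respect to $\nu$; its trace over $T\Sigma$ is $\operatorname{tr}_\Sigma Q^+=H+\operatorname{tr}_\Sigma q$. Foliation. By a known theorem of Eichmair, Galloway and Mendes, under the stated hypotheses the following holds: $M$ is diffeomorphic to $\partial_-M\times[0,l]$ for some $l>0$; every level set $\Sigma_t=\partial_-M\times\{t\}$, $t\in[0,l]$, is a flat torus in the metric induced by $g$; the null second fundamental form $Q^+$ of $\Sigma_t$ with respect to the unit normal $\nu_t$ pointing to the $t$ direction vanishes; and $\mu+J(\nu_t)=0$ along every $\Sigma_t$. The foliation $\{\Sigma_t\}$ in the claim is this one. Curvature convention: $R_{ijkl}=\langle\nabla_i\nabla_je_k,e_l\rangle-\langle\nabla_j\nabla_ie_k,e_l\rangle-\langle\nabla_{[e_i,e_j]}e_k,e_l\rangle$, with $\nabla$ the Levi-Civita connection of $g$, $q_{ij}=q(e_i,e_j)$ and $\nabla_iq_{jk}=(\nabla_{e_i}q)(e_j,e_k)$. *)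

theory Defs
  imports "HOL-Analysis.Analysis"
begin

text \<open>
  The torus is \<open>\<real>\<^sup>m / \<int>\<^sup>m\<close>, and \<open>\<T>\<^sup>m \<times> [a,b]\<close> is handled on its universal cover
  \<open>\<real>\<^sup>m \<times> [a,b]\<close>: its tangent bundle is trivial, so tensor fields on it are exactly the
  \<open>\<int>\<^sup>m\<close>-periodic families of multilinear forms on the vector space \<open>\<real>\<^sup>m \<times> \<real>\<close>.  A covariant
  2-tensor field thus has type \<open>'a \<Rightarrow> 'a \<Rightarrow> 'a \<Rightarrow> real\<close> (the first argument is the point) and a
  vector field has type \<open>'a \<Rightarrow> 'a\<close>.

  All derivatives are taken within a set \<open>S\<close>, so that they are one-sided in the normal direction at
  boundary points.  This is meaningful when \<open>S\<close> is relatively open in a convex set with nonempty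
  interior, where the derivative within \<open>S\<close> is unique; no other \<open>S\<close> is used.
\<close>

section \<open>Smooth maps\<close>

abbreviation deriv_within ::
  "'a::euclidean_space set \<Rightarrow> ('a \<Rightarrow> 'b::real_normed_vector) \<Rightarrow> 'a \<Rightarrow> 'a \<Rightarrow> 'b" where
  "deriv_within S f p v \<equiv> frechet_derivative f (at p within S) v"

primrec Ck_on ::
  "nat \<Rightarrow> 'a::euclidean_space set \<Rightarrow> ('a \<Rightarrow> 'b::real_normed_vector) \<Rightarrow> bool" where
  "Ck_on 0 S f \<longleftrightarrow> continuous_on S f"
| "Ck_on (Suc k) S f \<longleftrightarrow> f differentiable_on S \<and> (\<forall>v. Ck_on k S (\<lambda>p. deriv_within S f p v))"

definition smooth_on ::
  "'a::euclidean_space set \<Rightarrow> ('a \<Rightarrow> 'b::real_normed_vector) \<Rightarrow> bool" where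
  "smooth_on S f \<longleftrightarrow> (\<forall>k. Ck_on k S f)"

section \<open>Pointwise linear algebra of an inner product \<open>G\<close>\<close>

definition sharp :: "('a::euclidean_space \<Rightarrow> 'a \<Rightarrow> real) \<Rightarrow> ('a \<Rightarrow> real) \<Rightarrow> 'a" where
  "sharp G \<alpha> = (THE v. \<forall>w. G v w = \<alpha> w)"

text \<open>The vector \<open>G\<^sup>b\<^sup>c \<partial>\<^sub>c\<close>, i.e. the coordinate covector \<open>dx\<^sup>b\<close> with its index raised by \<open>G\<close>.\<close>

definition dual_vec :: "('a::euclidean_space \<Rightarrow> 'a \<Rightarrow> real) \<Rightarrow> 'a \<Rightarrow> 'a" where
  "dual_vec G b = sharp G (\<lambda>w. b \<bullet> w)"

text \<open>\<open>G\<^sup>a\<^sup>b B\<^sub>a\<^sub>b\<close>\<close>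

definition metric_trace ::
  "('a::euclidean_space \<Rightarrow> 'a \<Rightarrow> real) \<Rightarrow> ('a \<Rightarrow> 'a \<Rightarrow> real) \<Rightarrow> real" where
  "metric_trace G B = (\<Sum>b\<in>Basis. B b (dual_vec G b))"

text \<open>\<open>|B|\<^sup>2 = G\<^sup>a\<^sup>c G\<^sup>b\<^sup>d B\<^sub>a\<^sub>b B\<^sub>c\<^sub>d\<close>\<close>

definition norm_sq2 ::
  "('a::euclidean_space \<Rightarrow> 'a \<Rightarrow> real) \<Rightarrow> ('a \<Rightarrow> 'a \<Rightarrow> real) \<Rightarrow> real" where
  "norm_sq2 G B = (\<Sum>a\<in>Basis. \<Sum>b\<in>Basis. B a b * B (dual_vec G a) (dual_vec G b))"

definition norm1 :: "('a::euclidean_space \<Rightarrow> 'a \<Rightarrow> real) \<Rightarrow> ('a \<Rightarrow> real) \<Rightarrow> real" where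
  "norm1 G \<alpha> = sqrt (\<alpha> (sharp G \<alpha>))"

section \<open>Levi-Civita connection and curvature\<close>

text \<open>Christoffel symbols \<open>\<Gamma>(u,v) = u\<^sup>a v\<^sup>b \<Gamma>\<^sup>c\<^sub>a\<^sub>b \<partial>\<^sub>c\<close>.\<close>

definition christoffel ::
  "'a::euclidean_space set \<Rightarrow> ('a \<Rightarrow> 'a \<Rightarrow> 'a \<Rightarrow> real) \<Rightarrow> 'a \<Rightarrow> 'a \<Rightarrow> 'a \<Rightarrow> 'a" where
  "christoffel S g p u v = sharp (g p) (\<lambda>w.
     (deriv_within S (\<lambda>x. g x v w) p u + deriv_within S (\<lambda>x. g x u w) p v
       - deriv_within S (\<lambda>x. g x u v) p w) / 2)"

text \<open>\<open>\<nabla>\<^sub>X Y\<close>\<close>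

definition lc_deriv ::
  "'a::euclidean_space set \<Rightarrow> ('a \<Rightarrow> 'a \<Rightarrow> 'a \<Rightarrow> real) \<Rightarrow> ('a \<Rightarrow> 'a) \<Rightarrow> ('a \<Rightarrow> 'a) \<Rightarrow> 'a \<Rightarrow> 'a" where
  "lc_deriv S g X Y p = deriv_within S Y p (X p) + christoffel S g p (X p) (Y p)"

definition lie_bracket ::
  "'a::euclidean_space set \<Rightarrow> ('a \<Rightarrow> 'a) \<Rightarrow> ('a \<Rightarrow> 'a) \<Rightarrow> 'a \<Rightarrow> 'a" where
  "lie_bracket S X Y p = deriv_within S Y p (X p) - deriv_within S X p (Y p)"

text \<open>\<open>\<langle>\<nabla>\<^sub>X\<nabla>\<^sub>Y Z - \<nabla>\<^sub>Y\<nabla>\<^sub>X Z - \<nabla>\<^bsub>[X,Y]\<^esub> Z, W\<rangle>\<close>; sectional curvatures are the components \<open>R\<^sub>i\<^sub>j\<^sub>j\<^sub>i\<close>.\<close>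

definition riemann ::
  "'a::euclidean_space set \<Rightarrow> ('a \<Rightarrow> 'a \<Rightarrow> 'a \<Rightarrow> real) \<Rightarrow>
    ('a \<Rightarrow> 'a) \<Rightarrow> ('a \<Rightarrow> 'a) \<Rightarrow> ('a \<Rightarrow> 'a) \<Rightarrow> ('a \<Rightarrow> 'a) \<Rightarrow> 'a \<Rightarrow> real" where
  "riemann S g X Y Z W p =
     g p (lc_deriv S g X (lc_deriv S g Y Z) p) (W p)
   - g p (lc_deriv S g Y (lc_deriv S g X Z) p) (W p)
   - g p (lc_deriv S g (lie_bracket S X Y) Z p) (W p)"

text \<open>By tensoriality, values on tangent vectors may be computed with constant extensions.\<close>

definition riemann_at ::
  "'a::euclidean_space set \<Rightarrow> ('a \<Rightarrow> 'a \<Rightarrow> 'a \<Rightarrow> real) \<Rightarrow> 'a \<Rightarrow> 'a \<Rightarrow> 'a \<Rightarrow> 'a \<Rightarrow> 'a \<Rightarrow> real" where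
  "riemann_at S g p x y z w = riemann S g (\<lambda>_. x) (\<lambda>_. y) (\<lambda>_. z) (\<lambda>_. w) p"

definition scalar_curvature ::
  "'a::euclidean_space set \<Rightarrow> ('a \<Rightarrow> 'a \<Rightarrow> 'a \<Rightarrow> real) \<Rightarrow> 'a \<Rightarrow> real" where
  "scalar_curvature S g p =
     (\<Sum>a\<in>Basis. \<Sum>b\<in>Basis. riemann_at S g p a b (dual_vec (g p) b) (dual_vec (g p) a))"

definition flat_metric_on ::
  "'a::euclidean_space set \<Rightarrow> ('a \<Rightarrow> 'a \<Rightarrow> 'a \<Rightarrow> real) \<Rightarrow> bool" where
  "flat_metric_on S g \<longleftrightarrow> (\<forall>p\<in>S. \<forall>x y z w. riemann_at S g p x y z w = 0)"

text \<open>\<open>(\<nabla>\<^sub>X q)(Y,Z)\<close>\<close>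

definition cov_deriv2 ::
  "'a::euclidean_space set \<Rightarrow> ('a \<Rightarrow> 'a \<Rightarrow> 'a \<Rightarrow> real) \<Rightarrow> ('a \<Rightarrow> 'a \<Rightarrow> 'a \<Rightarrow> real) \<Rightarrow>
    ('a \<Rightarrow> 'a) \<Rightarrow> ('a \<Rightarrow> 'a) \<Rightarrow> ('a \<Rightarrow> 'a) \<Rightarrow> 'a \<Rightarrow> real" where
  "cov_deriv2 S g q X Y Z p =
     deriv_within S (\<lambda>x. q x (Y x) (Z x)) p (X p)
   - q p (lc_deriv S g X Y p) (Z p) - q p (Y p) (lc_deriv S g X Z p)"

section \<open>Initial data sets on \<open>\<T>\<^sup>m \<times> [a,b]\<close>\<close>

definition torus_slab :: "real \<Rightarrow> real \<Rightarrow> ((real^'m) \<times> real) set" where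
  "torus_slab a b = UNIV \<times> {a..b}"

text \<open>Equality of the images in \<open>\<T>\<^sup>m \<times> \<real>\<close>.\<close>

definition same_point :: "(real^'m) \<times> real \<Rightarrow> (real^'m) \<times> real \<Rightarrow> bool" where
  "same_point p p' \<longleftrightarrow> (\<forall>i. fst p $ i - fst p' $ i \<in> \<int>) \<and> snd p = snd p'"

definition sym_tensor_field ::
  "((real^'m) \<times> real) set \<Rightarrow>
    ((real^'m) \<times> real \<Rightarrow> (real^'m) \<times> real \<Rightarrow> (real^'m) \<times> real \<Rightarrow> real) \<Rightarrow> bool" where
  "sym_tensor_field M q \<longleftrightarrow>
     (\<forall>u v. smooth_on M (\<lambda>p. q p u v)) \<and>
     (\<forall>p\<in>M. bilinear (q p) \<and> (\<forall>u v. q p u v = q p v u)) \<and>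
     (\<forall>p\<in>M. \<forall>p'\<in>M. same_point p p' \<longrightarrow> q p = q p')"

definition initial_data_set ::
  "((real^'m) \<times> real) set \<Rightarrow>
    ((real^'m) \<times> real \<Rightarrow> (real^'m) \<times> real \<Rightarrow> (real^'m) \<times> real \<Rightarrow> real) \<Rightarrow>
    ((real^'m) \<times> real \<Rightarrow> (real^'m) \<times> real \<Rightarrow> (real^'m) \<times> real \<Rightarrow> real) \<Rightarrow> bool" where
  "initial_data_set M g q \<longleftrightarrow>
     sym_tensor_field M g \<and> (\<forall>p\<in>M. \<forall>v. v \<noteq> 0 \<longrightarrow> g p v v > 0) \<and> sym_tensor_field M q"

definition energy_density ::
  "'a::euclidean_space set \<Rightarrow> ('a \<Rightarrow> 'a \<Rightarrow> 'a \<Rightarrow> real) \<Rightarrow> ('a \<Rightarrow> 'a \<Rightarrow> 'a \<Rightarrow> real) \<Rightarrow> 'a \<Rightarrow> real" where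
  "energy_density M g q p =
     (scalar_curvature M g p + (metric_trace (g p) (q p))\<^sup>2 - norm_sq2 (g p) (q p)) / 2"

definition divergence2 ::
  "'a::euclidean_space set \<Rightarrow> ('a \<Rightarrow> 'a \<Rightarrow> 'a \<Rightarrow> real) \<Rightarrow> ('a \<Rightarrow> 'a \<Rightarrow> 'a \<Rightarrow> real) \<Rightarrow>
    'a \<Rightarrow> 'a \<Rightarrow> real" where
  "divergence2 M g q p v =
     (\<Sum>b\<in>Basis. cov_deriv2 M g q (\<lambda>_. b) (\<lambda>_. dual_vec (g p) b) (\<lambda>_. v) p)"

definition current_density ::
  "'a::euclidean_space set \<Rightarrow> ('a \<Rightarrow> 'a \<Rightarrow> 'a \<Rightarrow> real) \<Rightarrow> ('a \<Rightarrow> 'a \<Rightarrow> 'a \<Rightarrow> real) \<Rightarrow>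
    'a \<Rightarrow> 'a \<Rightarrow> real" where
  "current_density M g q p v =
     divergence2 M g q p v - deriv_within M (\<lambda>x. metric_trace (g x) (q x)) p v"

definition dominant_energy_condition ::
  "'a::euclidean_space set \<Rightarrow> ('a \<Rightarrow> 'a \<Rightarrow> 'a \<Rightarrow> real) \<Rightarrow> ('a \<Rightarrow> 'a \<Rightarrow> 'a \<Rightarrow> real) \<Rightarrow> bool" where
  "dominant_energy_condition M g q \<longleftrightarrow>
     (\<forall>p\<in>M. energy_density M g q p \<ge> norm1 (g p) (current_density M g q p))"

section \<open>Parametrized hypersurfaces\<close>

text \<open>
  A hypersurface is given by an immersion \<open>\<phi>\<close> of \<open>\<real>\<^sup>m\<close>; a unit normal \<open>N\<close> is a vector field
  along \<open>\<phi>\<close>; tensors on the hypersurface are pulled back to \<open>\<real>\<^sup>m\<close>.  For the boundary components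
  \<open>\<lambda>x. (x, 1)\<close> and \<open>\<lambda>x. (x, -1)\<close> of \<open>torus_slab (-1) 1\<close>, the outward normal of the former and the
  inward normal of the latter are both the unit normal \<open>N\<close> with \<open>snd (N x) > 0\<close>.
\<close>

definition induced_metric ::
  "('a \<Rightarrow> 'a \<Rightarrow> 'a \<Rightarrow> real) \<Rightarrow> ('b::euclidean_space \<Rightarrow> 'a::euclidean_space) \<Rightarrow>
    'b \<Rightarrow> 'b \<Rightarrow> 'b \<Rightarrow> real" where
  "induced_metric g \<phi> x u v = g (\<phi> x) (deriv_within UNIV \<phi> x u) (deriv_within UNIV \<phi> x v)"

definition unit_normal_along ::
  "('a \<Rightarrow> 'a \<Rightarrow> 'a \<Rightarrow> real) \<Rightarrow> ('b::euclidean_space \<Rightarrow> 'a::euclidean_space) \<Rightarrow>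
    ('b \<Rightarrow> 'a) \<Rightarrow> bool" where
  "unit_normal_along g \<phi> N \<longleftrightarrow>
     (\<forall>x. g (\<phi> x) (N x) (N x) = 1 \<and> (\<forall>u. g (\<phi> x) (N x) (deriv_within UNIV \<phi> x u) = 0))"

text \<open>\<open>h(u,v) = \<langle>\<nabla>\<^sub>u N, v\<rangle>\<close>, with the covariant derivative of the ambient space \<open>M\<close> along \<open>\<phi>\<close>.\<close>

definition second_fundamental_form ::
  "'a set \<Rightarrow> ('a \<Rightarrow> 'a \<Rightarrow> 'a \<Rightarrow> real) \<Rightarrow> ('b::euclidean_space \<Rightarrow> 'a::euclidean_space) \<Rightarrow>
    ('b \<Rightarrow> 'a) \<Rightarrow> 'b \<Rightarrow> 'b \<Rightarrow> 'b \<Rightarrow> real" where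
  "second_fundamental_form M g \<phi> N x u v =
     g (\<phi> x)
       (deriv_within UNIV N x u + christoffel M g (\<phi> x) (deriv_within UNIV \<phi> x u) (N x))
       (deriv_within UNIV \<phi> x v)"

definition null_second_fundamental_form ::
  "'a set \<Rightarrow> ('a \<Rightarrow> 'a \<Rightarrow> 'a \<Rightarrow> real) \<Rightarrow> ('a \<Rightarrow> 'a \<Rightarrow> 'a \<Rightarrow> real) \<Rightarrow>
    ('b::euclidean_space \<Rightarrow> 'a::euclidean_space) \<Rightarrow> ('b \<Rightarrow> 'a) \<Rightarrow> 'b \<Rightarrow> 'b \<Rightarrow> 'b \<Rightarrow> real" where
  "null_second_fundamental_form M g q \<phi> N x u v =
     second_fundamental_form M g \<phi> N x u v
     + q (\<phi> x) (deriv_within UNIV \<phi> x u) (deriv_within UNIV \<phi> x v)"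

definition null_expansion ::
  "'a set \<Rightarrow> ('a \<Rightarrow> 'a \<Rightarrow> 'a \<Rightarrow> real) \<Rightarrow> ('a \<Rightarrow> 'a \<Rightarrow> 'a \<Rightarrow> real) \<Rightarrow>
    ('b::euclidean_space \<Rightarrow> 'a::euclidean_space) \<Rightarrow> ('b \<Rightarrow> 'a) \<Rightarrow> 'b \<Rightarrow> real" where
  "null_expansion M g q \<phi> N x =
     metric_trace (induced_metric g \<phi> x) (null_second_fundamental_form M g q \<phi> N x)"

section \<open>The foliation\<close>

text \<open>
  Diffeomorphisms of quotients \<open>\<T>\<^sup>m \<times> I \<rightarrow> \<T>\<^sup>m \<times> I'\<close> are described through their lifts to the
  universal covers: diffeomorphisms that respect the lattice equivalence in both directions.
\<close>

definition torus_diffeo ::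
  "((real^'m) \<times> real) set \<Rightarrow> ((real^'m) \<times> real) set \<Rightarrow> ((real^'m) \<times> real \<Rightarrow> (real^'m) \<times> real) \<Rightarrow> bool" where
  "torus_diffeo S T F \<longleftrightarrow>
     bij_betw F S T \<and> smooth_on S F \<and> smooth_on T (inv_into S F) \<and>
     (\<forall>p\<in>S. \<forall>p'\<in>S. same_point (F p) (F p') \<longleftrightarrow> same_point p p')"

text \<open>
  \<open>F\<close> lifts the diffeomorphism \<open>\<partial>\<^sub>-M \<times> [0,l] \<rightarrow> M\<close>, the leaf \<open>\<Sigma>\<^sub>t\<close> is parametrized by
  \<open>\<lambda>x. F (x, t)\<close>, and \<open>\<nu>\<close> is the vector field on \<open>M\<close> that restricts to \<open>\<nu>\<^sub>t\<close> on each \<open>\<Sigma>\<^sub>t\<close>.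
\<close>

definition flat_torus_foliation ::
  "((real^'m) \<times> real) set \<Rightarrow>
    ((real^'m) \<times> real \<Rightarrow> (real^'m) \<times> real \<Rightarrow> (real^'m) \<times> real \<Rightarrow> real) \<Rightarrow>
    ((real^'m) \<times> real \<Rightarrow> (real^'m) \<times> real \<Rightarrow> (real^'m) \<times> real \<Rightarrow> real) \<Rightarrow>
    real \<Rightarrow> ((real^'m) \<times> real \<Rightarrow> (real^'m) \<times> real) \<Rightarrow> ((real^'m) \<times> real \<Rightarrow> (real^'m) \<times> real) \<Rightarrow> bool" where
  "flat_torus_foliation M g q l F \<nu> \<longleftrightarrow>
     l > 0 \<and> torus_diffeo (torus_slab 0 l) M F \<and>
     (\<forall>t\<in>{0..l}.
        flat_metric_on UNIV (induced_metric g (\<lambda>x. F (x, t))) \<and>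
        unit_normal_along g (\<lambda>x. F (x, t)) (\<lambda>x. \<nu> (F (x, t))) \<and>
        (\<forall>x. g (F (x, t)) (\<nu> (F (x, t))) (deriv_within (torus_slab 0 l) F (x, t) (0, 1)) > 0) \<and>
        (\<forall>x u v. null_second_fundamental_form M g q (\<lambda>x. F (x, t)) (\<lambda>x. \<nu> (F (x, t))) x u v = 0) \<and>
        (\<forall>x. energy_density M g q (F (x, t)) + current_density M g q (F (x, t)) (\<nu> (F (x, t))) = 0))"

section \<open>Components in a local orthonormal frame\<close>

definition orthonormal_frame_on ::
  "'a::euclidean_space set \<Rightarrow> ('a \<Rightarrow> 'a \<Rightarrow> 'a \<Rightarrow> real) \<Rightarrow> nat \<Rightarrow> (nat \<Rightarrow> 'a \<Rightarrow> 'a) \<Rightarrow> bool" where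
  "orthonormal_frame_on U g n e \<longleftrightarrow>
     (\<forall>i\<in>{1..n}. smooth_on U (e i)) \<and>
     (\<forall>p\<in>U. \<forall>i\<in>{1..n}. \<forall>j\<in>{1..n}. g p (e i p) (e j p) = (if i = j then 1 else 0))"

definition Rhat ::
  "'a::euclidean_space set \<Rightarrow> ('a \<Rightarrow> 'a \<Rightarrow> 'a \<Rightarrow> real) \<Rightarrow> ('a \<Rightarrow> 'a \<Rightarrow> 'a \<Rightarrow> real) \<Rightarrow>
    (nat \<Rightarrow> 'a \<Rightarrow> 'a) \<Rightarrow> 'a \<Rightarrow> nat \<Rightarrow> nat \<Rightarrow> nat \<Rightarrow> nat \<Rightarrow> real" where
  "Rhat M g q e p i j k l =
     riemann M g (e i) (e j) (e k) (e l) p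
     + q p (e j p) (e k p) * q p (e i p) (e l p) - q p (e i p) (e k p) * q p (e j p) (e l p)"

definition nabla_q ::
  "'a::euclidean_space set \<Rightarrow> ('a \<Rightarrow> 'a \<Rightarrow> 'a \<Rightarrow> real) \<Rightarrow> ('a \<Rightarrow> 'a \<Rightarrow> 'a \<Rightarrow> real) \<Rightarrow>
    (nat \<Rightarrow> 'a \<Rightarrow> 'a) \<Rightarrow> 'a \<Rightarrow> nat \<Rightarrow> nat \<Rightarrow> nat \<Rightarrow> real" where
  "nabla_q M g q e p i j k = cov_deriv2 M g q (e i) (e j) (e k) p"

end

theory Submission
  imports Defs
begin

text \<open>
  Write \<open>N\<close> for the unit normal field of the leaves and \<open>C(x,y,z) = \<nabla>\<^sub>x q(y,z) - \<nabla>\<^sub>y q(x,z)\<close>.  Since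
  \<open>Q\<^sup>+ = 0\<close>, the 1-form \<open>\<eta> = \<langle>\<nabla>\<^sub>N N, \<cdot>\<rangle> + q(N, \<cdot>)\<close> on the leaves is the only part of \<open>\<nabla>N\<close> not
  determined by \<open>q\<close>, and \<open>\<mu> + J(N) = 0\<close> becomes \<open>div \<eta> = |\<eta>|\<^sup>2\<close> on each leaf; integration over the
  torus gives \<open>\<eta> = 0\<close>.  Then \<open>Rhat(x,y,z,N) = C(x,y,z)\<close> for tangential \<open>z\<close>, and the Gauss
  equation of the flat leaves gives \<open>Rhat(x,y,z,w) = 0\<close> for tangential vectors.  With the lapse \<open>f\<close>,
  \<open>q(N, \<cdot>) = d log f\<close> along the leaves, hence \<open>C(x,y,N) = 0\<close>.

  Finally \<open>\<tau> = f C\<close> vanishes along the leaves, so that the sign in the last identity is irrelevant.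
  The connection \<open>B\<^sub>u V = \<nabla>\<^sub>u V - q(u,V) N\<close> on fields tangent to the leaves is flat along them and has
  curvature \<open>-\<tau>\<close> in mixed directions, so the Jacobi identity makes \<open>\<nabla>\<^sub>w \<tau>(x,y,z)\<close> symmetric in \<open>w, z\<close>.
  Equality in the dominant energy condition gives \<open>J = 0\<close> on the leaves, so the trace of \<open>\<tau>\<close> is the
  differential of a function \<open>\<phi>\<close>, which is harmonic, hence constant on the leaves.  So \<open>\<tau>\<close> is
  divergence free; as \<open>\<tau>\<close> is the antisymmetrized derivative of \<open>f q\<close>, the form
  \<open>\<Sum> \<tau>(\<cdot>,e\<^sub>k,e\<^sub>l) f q(e\<^sub>k,e\<^sub>l)\<close> has divergence \<open>|\<tau>|\<^sup>2 / 2\<close>, and a last integration gives \<open>\<tau> = 0\<close>.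
\<close>

text \<open>The Codazzi computation gives \<open>Rhat(x,y,z,N)\<close> as plus
  \<open>C(x,y,z)\<close>, while the fourth claim carries a minus sign. Both hold only if
  \<open>C\<close> vanishes on the leaves, which the pointwise identities do not yield; this forces
  the global second half. All global input is one principle: a leaf 1-form whose divergence is
  nonnegative on a torus is divergence free. It is applied to \<open>eta\<close>, to
  \<open>- phi theta\<close> and to \<open>zeta\<close>, whose divergences are sums of squares. The
  lapse appears because \<open>N\<close> does not commute with the leaf coordinate fields. The time
  field does; its normal part is \<open>f N\<close>, and its tangential part meets only the
  vanishing leaf curvature, so the mixed curvature of \<open>B\<close> is \<open>f C\<close> up to
  sign. The weight in \<open>f q\<close> has the same source: \<open>d f = f q(N, .)\<close> cancels
  the terms by which the derivatives of \<open>B\<close> and \<open>\<nabla>\<close> differ. A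
  single Gram-Schmidt frame, from the leaf coordinate fields followed by the time field, is smooth,
  periodic and triangular. Its last vector is the unit normal, and divergences on the leaves become
  partial derivatives on a cube.\<close>

section \<open>Smooth maps on admissible sets\<close>

text \<open>On such sets derivatives within \<open>S\<close> are unique and second derivatives commute, also at boundary points.\<close>

definition admissible :: "'a::euclidean_space set \<Rightarrow> bool" where
  "admissible S \<longleftrightarrow> (\<forall>p\<in>S. (\<forall>i\<in>Basis. \<forall>e>0. \<exists>d. 0 < \<bar>d\<bar> \<and> \<bar>d\<bar> < e \<and> p + d *\<^sub>R i \<in> S) \<and>
     (\<exists>e>0. convex (S \<inter> ball p e)))"

lemma admissible_UNIV: "admissible (UNIV :: 'a::euclidean_space set)"
  unfolding admissible_def
proof (intro ballI conjI allI impI)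
  fix e :: real assume "e > 0"
  then show "\<exists>d. 0 < \<bar>d\<bar> \<and> \<bar>d\<bar> < e \<and> p + d *\<^sub>R i \<in> UNIV" for p i :: 'a
    by (intro exI[of _ "e/2"]) auto
next
  show "\<exists>e>0. convex (UNIV \<inter> ball p e)" for p :: 'a
    by (intro exI[of _ 1]) auto
qed

text \<open>The first clause of \<open>admissible\<close> is what uniqueness needs: a derivative
  within \<open>S\<close> is pinned down on each basis vector by arbitrarily small steps in that
  direction, of either sign.\<close>

lemma deriv_within_eqI:
  assumes "admissible S" "p \<in> S" "(f has_derivative f') (at p within S)"
  shows "frechet_derivative f (at p within S) = f'"
proof (rule frechet_derivative_unique_within[OF _ assms(3)])
  show "(f has_derivative frechet_derivative f (at p within S)) (at p within S)"
    using assms(3) frechet_derivative_works differentiableI by blast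
  show "\<exists>d. 0 < \<bar>d\<bar> \<and> \<bar>d\<bar> < e \<and> p + d *\<^sub>R i \<in> S" if "i \<in> Basis" "e > 0" for i e
    using assms that unfolding admissible_def by blast
qed

lemma has_deriv_within:
  assumes "f differentiable_on S" "p \<in> S"
  shows "(f has_derivative (\<lambda>v. deriv_within S f p v)) (at p within S)"
  using assms unfolding differentiable_on_def frechet_derivative_works by blast

lemma linear_deriv_within:
  assumes "f differentiable_on S" "p \<in> S"
  shows "linear (\<lambda>v. deriv_within S f p v)"
  using has_deriv_within[OF assms] has_derivative_linear by blast

lemma deriv_within_cong:
  assumes "\<And>x. x \<in> S \<Longrightarrow> f x = h x" "p \<in> S"
  shows "deriv_within S f p v = deriv_within S h p v"
proof -
  have "(f has_derivative D) (at p within S) = (h has_derivative D) (at p within S)" for D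
    using assms has_derivative_transform by metis
  then show ?thesis unfolding frechet_derivative_def by presburger
qed

lemma Ck_on_cong:
  "(\<And>x. x \<in> S \<Longrightarrow> f x = h x) \<Longrightarrow> Ck_on k S f \<longleftrightarrow> Ck_on k S h"
proof (induction k arbitrary: f h)
  case 0
  then show ?case using continuous_on_cong by force
next
  case (Suc k)
  have "f differentiable_on S \<longleftrightarrow> h differentiable_on S"
    unfolding differentiable_on_def differentiable_def using Suc.prems has_derivative_transform by metis
  moreover have "Ck_on k S (\<lambda>p. deriv_within S f p v) \<longleftrightarrow> Ck_on k S (\<lambda>p. deriv_within S h p v)" for v
    by (rule Suc.IH, rule deriv_within_cong) (use Suc.prems in auto)
  ultimately show ?case by simp
qed

lemma Ck_on_pred: "Ck_on (Suc k) S f \<Longrightarrow> Ck_on k S f"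
proof (induction k arbitrary: f)
  case 0
  then show ?case by (simp add: differentiable_imp_continuous_on)
next
  case (Suc k)
  then show ?case by (metis Ck_on.simps(2))
qed

text \<open>By uniqueness any explicit candidate may replace \<open>frechet_derivative\<close>. Each
  closure property below thus becomes a derivative formula plus an induction on
  \<open>k\<close>.\<close>

lemma Ck_on_SucI:
  assumes "admissible S" "\<And>p. p \<in> S \<Longrightarrow> (f has_derivative f' p) (at p within S)"
    "\<And>v. Ck_on k S (\<lambda>p. f' p v)"
  shows "Ck_on (Suc k) S f"
proof -
  have "f differentiable_on S"
    unfolding differentiable_on_def differentiable_def using assms(2) by blast
  moreover have "Ck_on k S (\<lambda>p. deriv_within S f p v)" for v
    using assms(3)[of v] Ck_on_cong[of S "\<lambda>p. deriv_within S f p v" "\<lambda>p. f' p v" k]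
      deriv_within_eqI[OF assms(1) _ assms(2)] by simp
  ultimately show ?thesis by simp
qed

lemma Ck_on_const:
  assumes "admissible S" shows "Ck_on k S (\<lambda>_. c)"
proof (induction k arbitrary: c)
  case 0 show ?case by simp
next
  case (Suc k)
  show ?case by (rule Ck_on_SucI[OF assms, where f' = "\<lambda>_ _. 0"]) (auto intro: Suc.IH)
qed

lemma Ck_on_bounded_linear:
  assumes "admissible S" "bounded_linear L"
  shows "Ck_on k S f \<Longrightarrow> Ck_on k S (\<lambda>p. L (f p))"
proof (induction k arbitrary: f)
  case 0 then show ?case using assms by (simp add: bounded_linear.continuous_on)
next
  case (Suc k)
  show ?case
  proof (rule Ck_on_SucI[OF assms(1), where f' = "\<lambda>p v. L (deriv_within S f p v)"])
    show "((\<lambda>p. L (f p)) has_derivative (\<lambda>v. L (deriv_within S f p v))) (at p within S)"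
      if "p \<in> S" for p
      using bounded_linear.has_derivative[OF assms(2)] has_deriv_within[OF _ that] Suc.prems by force
    show "Ck_on k S (\<lambda>p. L (deriv_within S f p v))" for v
      using Suc by auto
  qed
qed

lemma Ck_on_add:
  assumes "admissible S"
  shows "Ck_on k S f \<Longrightarrow> Ck_on k S h \<Longrightarrow> Ck_on k S (\<lambda>p. f p + h p)"
proof (induction k arbitrary: f h)
  case 0 then show ?case by (simp add: continuous_on_add)
next
  case (Suc k)
  show ?case
  proof (rule Ck_on_SucI[OF assms, where f' = "\<lambda>p v. deriv_within S f p v + deriv_within S h p v"])
    show "((\<lambda>p. f p + h p) has_derivative (\<lambda>v. deriv_within S f p v + deriv_within S h p v)) (at p within S)"
      if "p \<in> S" for p
      using Suc.prems that by (auto intro!: has_derivative_add has_deriv_within)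
    show "Ck_on k S (\<lambda>p. deriv_within S f p v + deriv_within S h p v)" for v
      using Suc by auto
  qed
qed

lemma Ck_on_bilinear:
  assumes "admissible S" "bounded_bilinear B"
  shows "Ck_on k S f \<Longrightarrow> Ck_on k S h \<Longrightarrow> Ck_on k S (\<lambda>p. B (f p) (h p))"
proof (induction k arbitrary: f h)
  case 0 then show ?case using assms by (simp add: bounded_bilinear.continuous_on)
next
  case (Suc k)
  show ?case
  proof (rule Ck_on_SucI[OF assms(1), where f' = "\<lambda>p v. B (f p) (deriv_within S h p v) + B (deriv_within S f p v) (h p)"])
    show "((\<lambda>p. B (f p) (h p)) has_derivative (\<lambda>v. B (f p) (deriv_within S h p v) + B (deriv_within S f p v) (h p))) (at p within S)"
      if "p \<in> S" for p
      using Suc.prems that by (auto intro!: bounded_bilinear.FDERIV[OF assms(2)] has_deriv_within)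
    show "Ck_on k S (\<lambda>p. B (f p) (deriv_within S h p v) + B (deriv_within S f p v) (h p))" for v
      using Suc.prems Ck_on_pred[OF Suc.prems(1)] Ck_on_pred[OF Suc.prems(2)]
      by (auto intro!: Ck_on_add assms(1) Suc.IH)
  qed
qed

lemma Ck_on_sum:
  assumes "admissible S" "finite I"
  shows "(\<And>i. i \<in> I \<Longrightarrow> Ck_on k S (f i)) \<Longrightarrow> Ck_on k S (\<lambda>p. \<Sum>i\<in>I. f i p)"
  using assms(2) by induction (auto intro!: Ck_on_const Ck_on_add assms(1))

lemma Ck_on_inverse:
  fixes f :: "'a::euclidean_space \<Rightarrow> real"
  assumes "admissible S" and nz: "\<And>p. p \<in> S \<Longrightarrow> f p \<noteq> 0"
  shows "Ck_on k S f \<Longrightarrow> Ck_on k S (\<lambda>p. inverse (f p))"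
proof (induction k)
  case 0 then show ?case using nz by (auto intro!: continuous_on_inverse)
next
  case (Suc k)
  have IH: "Ck_on k S (\<lambda>p. inverse (f p))" using Suc Ck_on_pred by blast
  show ?case
  proof (rule Ck_on_SucI[OF assms(1), where f' = "\<lambda>p v. - (inverse (f p) * deriv_within S f p v * inverse (f p))"])
    show "((\<lambda>p. inverse (f p)) has_derivative (\<lambda>v. - (inverse (f p) * deriv_within S f p v * inverse (f p)))) (at p within S)"
      if "p \<in> S" for p
      using Suc.prems that nz by (intro Deriv.has_derivative_inverse has_deriv_within) auto
    show "Ck_on k S (\<lambda>p. - (inverse (f p) * deriv_within S f p v * inverse (f p)))" for v
      using Suc.prems IH
      by (intro Ck_on_bounded_linear[OF assms(1) bounded_linear_minus[OF bounded_linear_ident]]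
          Ck_on_bilinear[OF assms(1) bounded_bilinear_mult]) auto
  qed
qed

lemma Ck_on_sqrt:
  fixes f :: "'a::euclidean_space \<Rightarrow> real"
  assumes "admissible S" and pos: "\<And>p. p \<in> S \<Longrightarrow> f p > 0"
  shows "Ck_on k S f \<Longrightarrow> Ck_on k S (\<lambda>p. sqrt (f p))"
proof (induction k)
  case 0 then show ?case by (auto intro!: continuous_on_real_sqrt)
next
  case (Suc k)
  have IH: "Ck_on k S (\<lambda>p. sqrt (f p))" using Suc Ck_on_pred by blast
  show ?case
  proof (rule Ck_on_SucI[OF assms(1), where f' = "\<lambda>p v. deriv_within S f p v * (1/2) * inverse (sqrt (f p))"])
    show "((\<lambda>p. sqrt (f p)) has_derivative (\<lambda>v. deriv_within S f p v * (1/2) * inverse (sqrt (f p)))) (at p within S)"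
      if "p \<in> S" for p
    proof -
      have "((\<lambda>p. sqrt (f p)) has_derivative (\<lambda>v. deriv_within S f p v * (inverse (sqrt (f p)) / 2))) (at p within S)"
        using DERIV_compose_FDERIV[OF DERIV_real_sqrt[OF pos[OF that]] has_deriv_within[of f S p]] Suc.prems that
        by simp
      then show ?thesis by (simp add: field_simps)
    qed
    show "Ck_on k S (\<lambda>p. deriv_within S f p v * (1/2) * inverse (sqrt (f p)))" for v
      using Suc.prems pos
      by (intro Ck_on_bilinear[OF assms(1) bounded_bilinear_mult] Ck_on_const Ck_on_inverse IH assms(1)) force+
  qed
qed

lemma Ck_on_ln:
  fixes f :: "'a::euclidean_space \<Rightarrow> real"
  assumes "admissible S" and pos: "\<And>p. p \<in> S \<Longrightarrow> f p > 0" and f: "Ck_on k S f"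
  shows "Ck_on k S (\<lambda>p. ln (f p))"
proof (cases k)
  case 0 then show ?thesis using f pos by (force intro!: continuous_on_ln)
next
  case (Suc k')
  show ?thesis unfolding Suc
  proof (rule Ck_on_SucI[OF assms(1), where f' = "\<lambda>p v. deriv_within S f p v * inverse (f p)"])
    show "((\<lambda>p. ln (f p)) has_derivative (\<lambda>v. deriv_within S f p v * inverse (f p))) (at p within S)"
      if "p \<in> S" for p
      using DERIV_compose_FDERIV[OF DERIV_ln[OF pos[OF that]] has_deriv_within[of f S p]] f Suc that
      by simp
    show "Ck_on k' S (\<lambda>p. deriv_within S f p v * inverse (f p))" for v
      using f Suc pos Ck_on_pred[of k' S f]
      by (intro Ck_on_bilinear[OF assms(1) bounded_bilinear_mult] Ck_on_inverse assms(1)) force+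
  qed
qed

lemma deriv_within_expand:
  assumes "f differentiable_on S" "p \<in> S"
  shows "deriv_within S f p v = (\<Sum>b\<in>Basis. (v \<bullet> b) *\<^sub>R deriv_within S f p b)"
proof -
  have "deriv_within S f p (\<Sum>b\<in>Basis. (v \<bullet> b) *\<^sub>R b) = (\<Sum>b\<in>Basis. (v \<bullet> b) *\<^sub>R deriv_within S f p b)"
    using linear_deriv_within[OF assms] by (simp add: linear_sum linear_scale)
  then show ?thesis by (simp add: euclidean_representation)
qed

text \<open>The induction hypothesis speaks of \<open>deriv_within T f\<close> in a fixed direction,
  whereas the chain rule produces a direction that moves with \<open>p\<close>. Expanding this
  direction over \<open>Basis\<close> separates the two.\<close>

lemma Ck_on_compose:
  fixes F :: "'a::euclidean_space \<Rightarrow> 'b::euclidean_space" and f :: "'b \<Rightarrow> 'c::real_normed_vector"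
  assumes "admissible S" "F ` S \<subseteq> T"
  shows "Ck_on k S F \<Longrightarrow> Ck_on k T f \<Longrightarrow> Ck_on k S (\<lambda>p. f (F p))"
proof (induction k arbitrary: f)
  case 0 then show ?case using continuous_on_compose2[of T f S F] assms(2) by simp
next
  case (Suc k)
  have F: "Ck_on k S F" using Suc.prems Ck_on_pred by blast
  show ?case
  proof (rule Ck_on_SucI[OF assms(1), where f' = "\<lambda>p v. \<Sum>b\<in>Basis. (deriv_within S F p v \<bullet> b) *\<^sub>R deriv_within T f (F p) b"])
    fix p assume p: "p \<in> S"
    then have Fp: "F p \<in> T" using assms by blast
    have "((\<lambda>p. f (F p)) has_derivative (\<lambda>v. deriv_within T f (F p) (deriv_within S F p v))) (at p within S)"
      using has_derivative_in_compose[OF has_deriv_within[OF _ p, of F] has_derivative_subset[OF has_deriv_within[OF _ Fp, of f] assms(2)]]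
        Suc.prems by simp
    moreover have "(\<lambda>v. deriv_within T f (F p) (deriv_within S F p v)) = (\<lambda>v. \<Sum>b\<in>Basis. (deriv_within S F p v \<bullet> b) *\<^sub>R deriv_within T f (F p) b)"
      by (rule ext, rule deriv_within_expand) (use Suc.prems Fp in auto)
    ultimately show "((\<lambda>p. f (F p)) has_derivative (\<lambda>v. \<Sum>b\<in>Basis. (deriv_within S F p v \<bullet> b) *\<^sub>R deriv_within T f (F p) b)) (at p within S)"
      by (rule has_derivative_eq_rhs)
  next
    show "Ck_on k S (\<lambda>p. \<Sum>b\<in>Basis. (deriv_within S F p v \<bullet> b) *\<^sub>R deriv_within T f (F p) b)" for v
    proof (intro Ck_on_sum assms(1) finite_Basis Ck_on_bilinear[OF assms(1) bounded_bilinear_scaleR])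
      fix b :: 'b
      show "Ck_on k S (\<lambda>p. deriv_within S F p v \<bullet> b)"
        using Suc.prems by (intro Ck_on_bounded_linear[OF assms(1) bounded_linear_inner_left]) auto
      show "Ck_on k S (\<lambda>p. deriv_within T f (F p) b)"
        using Suc.prems by (intro Suc.IH F) auto
    qed
  qed
qed

named_theorems smooth

lemma smooth_on_const [smooth]: "admissible S \<Longrightarrow> smooth_on S (\<lambda>_. c)"
  by (simp add: smooth_on_def Ck_on_const)

lemma smooth_on_bounded_linear:
  "admissible S \<Longrightarrow> bounded_linear L \<Longrightarrow> smooth_on S f \<Longrightarrow> smooth_on S (\<lambda>p. L (f p))"
  by (simp add: smooth_on_def Ck_on_bounded_linear)

lemma smooth_on_add [smooth]:
  "admissible S \<Longrightarrow> smooth_on S f \<Longrightarrow> smooth_on S h \<Longrightarrow> smooth_on S (\<lambda>p. f p + h p)"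
  by (simp add: smooth_on_def Ck_on_add)

lemma smooth_on_minus [smooth]:
  "admissible S \<Longrightarrow> smooth_on S f \<Longrightarrow> smooth_on S (\<lambda>p. - f p)"
  by (rule smooth_on_bounded_linear[OF _ bounded_linear_minus[OF bounded_linear_ident]])

lemma smooth_on_diff [smooth]:
  "admissible S \<Longrightarrow> smooth_on S f \<Longrightarrow> smooth_on S h \<Longrightarrow> smooth_on S (\<lambda>p. f p - h p)"
  using smooth_on_add[OF _ _ smooth_on_minus, of S f h] by simp

lemma smooth_on_scaleR [smooth]:
  "admissible S \<Longrightarrow> smooth_on S f \<Longrightarrow> smooth_on S h \<Longrightarrow> smooth_on S (\<lambda>p. f p *\<^sub>R h p)"
  by (simp add: smooth_on_def Ck_on_bilinear[OF _ bounded_bilinear_scaleR])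

lemma smooth_on_mult [smooth]:
  fixes f h :: "'a::euclidean_space \<Rightarrow> real"
  shows "admissible S \<Longrightarrow> smooth_on S f \<Longrightarrow> smooth_on S h \<Longrightarrow> smooth_on S (\<lambda>p. f p * h p)"
  by (simp add: smooth_on_def Ck_on_bilinear[OF _ bounded_bilinear_mult])

lemma smooth_on_inner [smooth]:
  fixes f :: "'a::euclidean_space \<Rightarrow> 'b::real_inner"
  shows "admissible S \<Longrightarrow> smooth_on S f \<Longrightarrow> smooth_on S (\<lambda>p. f p \<bullet> c)"
  by (rule smooth_on_bounded_linear[OF _ bounded_linear_inner_left])

lemma smooth_on_sum [smooth]:
  "admissible S \<Longrightarrow> finite I \<Longrightarrow> (\<And>i. i \<in> I \<Longrightarrow> smooth_on S (f i)) \<Longrightarrow> smooth_on S (\<lambda>p. \<Sum>i\<in>I. f i p)"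
  by (simp add: smooth_on_def Ck_on_sum)

lemma smooth_on_prod [smooth]:
  fixes f :: "'i \<Rightarrow> 'a::euclidean_space \<Rightarrow> real"
  assumes "admissible S" "finite I" "\<And>i. i \<in> I \<Longrightarrow> smooth_on S (f i)"
  shows "smooth_on S (\<lambda>p. \<Prod>i\<in>I. f i p)"
  using assms(2,3) by induction (auto intro!: smooth_on_const smooth_on_mult assms(1))

lemma smooth_on_inverse:
  fixes f :: "'a::euclidean_space \<Rightarrow> real"
  shows "admissible S \<Longrightarrow> (\<And>p. p \<in> S \<Longrightarrow> f p \<noteq> 0) \<Longrightarrow> smooth_on S f \<Longrightarrow> smooth_on S (\<lambda>p. inverse (f p))"
  by (simp add: smooth_on_def Ck_on_inverse)

lemma smooth_on_sqrt:
  "admissible S \<Longrightarrow> (\<And>p. p \<in> S \<Longrightarrow> f p > 0) \<Longrightarrow> smooth_on S f \<Longrightarrow> smooth_on S (\<lambda>p. sqrt (f p))"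
  by (simp add: smooth_on_def Ck_on_sqrt)

lemma smooth_on_ln:
  fixes f :: "'a::euclidean_space \<Rightarrow> real"
  shows "admissible S \<Longrightarrow> (\<And>p. p \<in> S \<Longrightarrow> f p > 0) \<Longrightarrow> smooth_on S f \<Longrightarrow> smooth_on S (\<lambda>p. ln (f p))"
  by (simp add: smooth_on_def Ck_on_ln)

lemma smooth_on_compose:
  fixes F :: "'a::euclidean_space \<Rightarrow> 'b::euclidean_space" and f :: "'b \<Rightarrow> 'c::real_normed_vector"
  shows "admissible S \<Longrightarrow> F ` S \<subseteq> T \<Longrightarrow> smooth_on S F \<Longrightarrow> smooth_on T f \<Longrightarrow> smooth_on S (\<lambda>p. f (F p))"
  by (simp add: smooth_on_def Ck_on_compose)

lemma smooth_on_cong: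
  "(\<And>x. x \<in> S \<Longrightarrow> f x = h x) \<Longrightarrow> smooth_on S f \<longleftrightarrow> smooth_on S h"
  unfolding smooth_on_def using Ck_on_cong by blast

lemma smooth_on_ident [smooth]:
  assumes "admissible S" shows "smooth_on S (\<lambda>p. p)"
  unfolding smooth_on_def
proof
  fix k show "Ck_on k S (\<lambda>p. p)"
  proof (cases k)
    case (Suc k')
    show ?thesis unfolding Suc
      by (rule Ck_on_SucI[OF assms, where f' = "\<lambda>_ v. v"]) (auto intro: Ck_on_const assms)
  qed auto
qed

lemma smooth_on_linear:
  fixes L :: "'a::euclidean_space \<Rightarrow> 'b::real_normed_vector"
  assumes "admissible S" "linear L" shows "smooth_on S L"
  using smooth_on_bounded_linear[OF assms(1) _ smooth_on_ident[OF assms(1)], of L] assms(2)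
    linear_conv_bounded_linear by blast

lemma smooth_on_imp_differentiable_on: "smooth_on S f \<Longrightarrow> f differentiable_on S"
  unfolding smooth_on_def by (metis Ck_on.simps(2))

lemma smooth_on_imp_continuous_on: "smooth_on S f \<Longrightarrow> continuous_on S f"
  by (simp add: differentiable_imp_continuous_on smooth_on_imp_differentiable_on)

lemma smooth_on_deriv_within: "smooth_on S f \<Longrightarrow> smooth_on S (\<lambda>p. deriv_within S f p v)"
  unfolding smooth_on_def by (metis Ck_on.simps(2))

lemma smooth_on_deriv_within_field [smooth]:
  assumes "admissible S" "smooth_on S f" "smooth_on S V"
  shows "smooth_on S (\<lambda>p. deriv_within S f p (V p))"
proof -
  have "smooth_on S (\<lambda>p. \<Sum>b\<in>Basis. (V p \<bullet> b) *\<^sub>R deriv_within S f p b)"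
    using assms by (intro smooth smooth_on_deriv_within) auto
  moreover have "deriv_within S f p (V p) = (\<Sum>b\<in>Basis. (V p \<bullet> b) *\<^sub>R deriv_within S f p b)" if "p \<in> S" for p
    by (rule deriv_within_expand[OF smooth_on_imp_differentiable_on[OF assms(2)] that])
  ultimately show ?thesis by (subst smooth_on_cong)
qed

lemma smooth_on_has_derivative:
  "smooth_on S f \<Longrightarrow> p \<in> S \<Longrightarrow> (f has_derivative (\<lambda>v. deriv_within S f p v)) (at p within S)"
  by (simp add: has_deriv_within smooth_on_imp_differentiable_on)

lemma deriv_within_linear:
  assumes "smooth_on S f" "p \<in> S"
  shows "linear (\<lambda>v. deriv_within S f p v)"
  using linear_deriv_within smooth_on_imp_differentiable_on assms by blast

lemma deriv_within_const [simp]: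
  assumes "admissible S" "p \<in> S" shows "deriv_within S (\<lambda>_. c) p v = 0"
  using deriv_within_eqI[OF assms, of "\<lambda>_. c" "\<lambda>_. 0"] by simp

lemma deriv_within_add:
  assumes "admissible S" "p \<in> S" "smooth_on S f" "smooth_on S h"
  shows "deriv_within S (\<lambda>x. f x + h x) p v = deriv_within S f p v + deriv_within S h p v"
  using deriv_within_eqI[OF assms(1,2) has_derivative_add[OF smooth_on_has_derivative smooth_on_has_derivative]] assms
  by metis

lemma deriv_within_bounded_linear:
  assumes "admissible S" "p \<in> S" "smooth_on S f" "bounded_linear L"
  shows "deriv_within S (\<lambda>x. L (f x)) p v = L (deriv_within S f p v)"
  using deriv_within_eqI[OF assms(1,2) bounded_linear.has_derivative[OF assms(4) smooth_on_has_derivative[OF assms(3,2)]]]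
  by metis

lemma deriv_within_minus:
  assumes "admissible S" "p \<in> S" "smooth_on S f"
  shows "deriv_within S (\<lambda>x. - f x) p v = - deriv_within S f p v"
  using deriv_within_bounded_linear[OF assms bounded_linear_minus[OF bounded_linear_ident]] .

lemma deriv_within_diff:
  assumes "admissible S" "p \<in> S" "smooth_on S f" "smooth_on S h"
  shows "deriv_within S (\<lambda>x. f x - h x) p v = deriv_within S f p v - deriv_within S h p v"
  using deriv_within_eqI[OF assms(1,2) has_derivative_diff[OF smooth_on_has_derivative smooth_on_has_derivative]] assms
  by metis

lemma deriv_within_scaleR:
  assumes "admissible S" "p \<in> S" "smooth_on S f" "smooth_on S h"
  shows "deriv_within S (\<lambda>x. f x *\<^sub>R h x) p v = deriv_within S f p v *\<^sub>R h p + f p *\<^sub>R deriv_within S h p v"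
  using deriv_within_eqI[OF assms(1,2) has_derivative_scaleR[OF smooth_on_has_derivative smooth_on_has_derivative]] assms
  by (metis add.commute)

lemma deriv_within_mult:
  fixes f h :: "'a::euclidean_space \<Rightarrow> real"
  assumes "admissible S" "p \<in> S" "smooth_on S f" "smooth_on S h"
  shows "deriv_within S (\<lambda>x. f x * h x) p v = deriv_within S f p v * h p + f p * deriv_within S h p v"
  using deriv_within_scaleR[OF assms] by simp

lemma deriv_within_sum:
  assumes "admissible S" "p \<in> S" "finite I" "\<And>i. i \<in> I \<Longrightarrow> smooth_on S (f i)"
  shows "deriv_within S (\<lambda>x. \<Sum>i\<in>I. f i x) p v = (\<Sum>i\<in>I. deriv_within S (f i) p v)"
proof -
  have "((\<lambda>x. \<Sum>i\<in>I. f i x) has_derivative (\<lambda>v. \<Sum>i\<in>I. deriv_within S (f i) p v)) (at p within S)"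
    using assms by (intro has_derivative_sum smooth_on_has_derivative) auto
  then show ?thesis using deriv_within_eqI[OF assms(1,2)] by metis
qed

lemma deriv_within_compose:
  fixes F :: "'a::euclidean_space \<Rightarrow> 'b::euclidean_space" and f :: "'b \<Rightarrow> 'c::real_normed_vector"
  assumes "admissible S" "p \<in> S" "F ` S \<subseteq> T" "smooth_on S F" "smooth_on T f"
  shows "deriv_within S (\<lambda>x. f (F x)) p v = deriv_within T f (F p) (deriv_within S F p v)"
proof -
  have "F p \<in> T" using assms by blast
  then have "((\<lambda>p. f (F p)) has_derivative (\<lambda>v. deriv_within T f (F p) (deriv_within S F p v))) (at p within S)"
    using has_derivative_in_compose[OF smooth_on_has_derivative[OF assms(4,2)]
        has_derivative_subset[OF smooth_on_has_derivative[OF assms(5)] assms(3)]] by simp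
  then show ?thesis using deriv_within_eqI[OF assms(1,2)] by metis
qed

lemma deriv_within_ln:
  fixes f :: "'a::euclidean_space \<Rightarrow> real"
  assumes "admissible S" "p \<in> S" "smooth_on S f" "f p > 0"
  shows "deriv_within S (\<lambda>x. ln (f x)) p v = deriv_within S f p v / f p"
proof -
  have "((\<lambda>p. ln (f p)) has_derivative (\<lambda>v. deriv_within S f p v * inverse (f p))) (at p within S)"
    using DERIV_compose_FDERIV[OF DERIV_ln[OF assms(4)] smooth_on_has_derivative[OF assms(3,2)]] by simp
  then show ?thesis using deriv_within_eqI[OF assms(1,2)] by (metis divide_inverse)
qed

section \<open>Symmetry of second derivatives, including boundary points\<close>

lemma second_difference:
  fixes f :: "'a::euclidean_space \<Rightarrow> real"
  assumes S: "admissible S" "smooth_on S f" and "s > 0"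
    and box: "\<And>a b. a \<in> {0..s} \<Longrightarrow> b \<in> {0..s} \<Longrightarrow> p + a *\<^sub>R u + b *\<^sub>R v \<in> S"
  shows "\<exists>a\<in>{0..s}. \<exists>b\<in>{0..s}.
    f (p + s *\<^sub>R u + s *\<^sub>R v) - f (p + s *\<^sub>R u) - f (p + s *\<^sub>R v) + f p
    = s\<^sup>2 * deriv_within S (\<lambda>x. deriv_within S f x u) (p + a *\<^sub>R u + b *\<^sub>R v) v"
proof -
  have d: "((\<lambda>a. h (c + a *\<^sub>R w)) has_derivative (\<lambda>t. deriv_within S h (c + a *\<^sub>R w) (t *\<^sub>R w))) (at a within {0..s})"
    if "smooth_on S h" "\<And>a. a \<in> {0..s} \<Longrightarrow> c + a *\<^sub>R w \<in> S" "a \<in> {0..s}" for h :: "'a \<Rightarrow> real" and c w a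
  proof -
    have "((\<lambda>a. c + a *\<^sub>R w) has_derivative (\<lambda>t. t *\<^sub>R w)) (at a within {0..s})"
      by (auto intro!: derivative_eq_intros)
    moreover have "(h has_derivative (\<lambda>v. deriv_within S h (c + a *\<^sub>R w) v)) (at (c + a *\<^sub>R w) within (\<lambda>a. c + a *\<^sub>R w) ` {0..s})"
      using that by (intro has_derivative_subset[OF smooth_on_has_derivative[OF that(1)]]) auto
    ultimately show ?thesis by (rule has_derivative_in_compose)
  qed
  have b0: "p + a *\<^sub>R u \<in> S" "p + a *\<^sub>R v \<in> S" if "a \<in> {0..s}" for a
    using box[of a 0] box[of 0 a] that assms(3) by auto
  \<comment> \<open>The second difference is \<open>?G s - ?G 0\<close>. One mean value step in
    \<open>u\<close> and a second one in \<open>v\<close> bring out the mixed derivative.\<close>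
  let ?G = "\<lambda>a. f (p + s *\<^sub>R v + a *\<^sub>R u) - f (p + a *\<^sub>R u)"
  have bs: "p + s *\<^sub>R v + a *\<^sub>R u \<in> S" if "a \<in> {0..s}" for a
    using box[of a s] that assms(3) by (auto simp: algebra_simps)
  have "\<exists>a\<in>{0<..<s}. ?G s - ?G 0 =
     deriv_within S f (p + s *\<^sub>R v + a *\<^sub>R u) ((s - 0) *\<^sub>R u) - deriv_within S f (p + a *\<^sub>R u) ((s - 0) *\<^sub>R u)"
    using assms(3) b0 bs by (intro mvt_simple has_derivative_diff d S) auto
  then obtain a where a: "a \<in> {0<..<s}" "?G s - ?G 0 =
     deriv_within S f (p + s *\<^sub>R v + a *\<^sub>R u) (s *\<^sub>R u) - deriv_within S f (p + a *\<^sub>R u) (s *\<^sub>R u)"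
    by auto
  have a': "a \<in> {0..s}" using a by auto
  let ?D = "\<lambda>x. deriv_within S f x u"
  have D: "smooth_on S ?D" using S smooth_on_deriv_within by blast
  have "\<exists>b\<in>{0<..<s}. ?D (p + a *\<^sub>R u + s *\<^sub>R v) - ?D (p + a *\<^sub>R u + 0 *\<^sub>R v) =
      deriv_within S ?D (p + a *\<^sub>R u + b *\<^sub>R v) ((s - 0) *\<^sub>R v)"
    using assms(3) a' box by (intro mvt_simple d D) auto
  then obtain b where b: "b \<in> {0<..<s}" "?D (p + a *\<^sub>R u + s *\<^sub>R v) - ?D (p + a *\<^sub>R u) =
      deriv_within S ?D (p + a *\<^sub>R u + b *\<^sub>R v) (s *\<^sub>R v)" by auto
  have b': "b \<in> {0..s}" using b by auto
  have "?G s - ?G 0 = s * (?D (p + a *\<^sub>R u + s *\<^sub>R v) - ?D (p + a *\<^sub>R u))"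
    using a deriv_within_linear[OF S(2) bs[OF a']] deriv_within_linear[OF S(2) b0(1)[OF a']]
    by (simp add: linear_scale algebra_simps)
  also have "\<dots> = s\<^sup>2 * deriv_within S ?D (p + a *\<^sub>R u + b *\<^sub>R v) v"
    using b(2) deriv_within_linear[OF D box[OF a' b']] by (simp add: linear_scale power2_eq_square)
  finally show ?thesis using a' b' by (intro bexI[of _ a] bexI[of _ b]) (auto simp: algebra_simps)
qed

text \<open>The second difference is symmetric in \<open>u\<close> and \<open>v\<close>, so
  arbitrarily close to \<open>p\<close> some value of one mixed derivative equals some value of the
  other; continuity carries the equality to \<open>p\<close>.\<close>

lemma deriv_within_commute_box:
  fixes f :: "'a::euclidean_space \<Rightarrow> real"
  assumes S: "admissible S" "smooth_on S f" and "p \<in> S" 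
    and box: "\<And>a b. a \<in> {0..1} \<Longrightarrow> b \<in> {0..1} \<Longrightarrow> p + a *\<^sub>R u + b *\<^sub>R v \<in> S"
  shows "deriv_within S (\<lambda>x. deriv_within S f x u) p v = deriv_within S (\<lambda>x. deriv_within S f x v) p u"
    (is "?A p = ?B p")
proof (rule ccontr)
  assume ne: "?A p \<noteq> ?B p"
  define e where "e = \<bar>?A p - ?B p\<bar> / 2"
  have e: "e > 0" using ne by (simp add: e_def)
  have "continuous_on S ?A" "continuous_on S ?B"
    using S by (auto intro!: smooth_on_imp_continuous_on smooth_on_deriv_within)
  note c = this[unfolded continuous_on_iff dist_real_def, rule_format, OF \<open>p \<in> S\<close> e]
  obtain d1 where d1: "d1 > 0" "\<And>x. x \<in> S \<Longrightarrow> dist x p < d1 \<Longrightarrow> \<bar>?A x - ?A p\<bar> < e"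
    using c(1) by blast
  obtain d2 where d2: "d2 > 0" "\<And>x. x \<in> S \<Longrightarrow> dist x p < d2 \<Longrightarrow> \<bar>?B x - ?B p\<bar> < e"
    using c(2) by blast
  note d = d1(1) d2(1) d1(2) d2(2)
  \<comment> \<open>Chosen so that the whole box of side \<open>s\<close> spanned by
    \<open>u\<close> and \<open>v\<close> lies within \<open>min d1 d2\<close> of \<open>p\<close>.
    The summand 1 keeps the denominator positive and the factor 2 leaves room for a strict
    bound.\<close>
  define s where "s = min 1 (min d1 d2 / (2 * (norm u + norm v + 1)))"
  have n: "norm u + norm v + 1 > 0" by (simp add: add_nonneg_pos)
  have s: "s > 0" "s \<le> 1" using d n by (auto simp: s_def)
  have "s \<le> min d1 d2 / (2 * (norm u + norm v + 1))" by (simp add: s_def)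
  then have s2: "s * (norm u + norm v + 1) \<le> min d1 d2 / 2"
    using n by (simp add: field_simps)
  have near: "dist (p + a *\<^sub>R u + b *\<^sub>R v) p < min d1 d2" if "a \<in> {0..s}" "b \<in> {0..s}" for a b
  proof -
    have "dist (p + a *\<^sub>R u + b *\<^sub>R v) p = norm (a *\<^sub>R u + b *\<^sub>R v)" by (simp add: dist_norm)
    also have "\<dots> \<le> norm (a *\<^sub>R u) + norm (b *\<^sub>R v)" by (rule norm_triangle_ineq)
    also have "\<dots> \<le> s * norm u + s * norm v"
      using that by (simp add: add_mono mult_right_mono)
    also have "\<dots> \<le> s * (norm u + norm v + 1)" using s by (simp add: algebra_simps)
    finally show ?thesis using s2 d(1,2) by linarith
  qed
  have box': "p + a *\<^sub>R u + b *\<^sub>R v \<in> S" if "a \<in> {0..s}" "b \<in> {0..s}" for a b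
    using box that s by auto
  have box'': "p + a *\<^sub>R v + b *\<^sub>R u \<in> S" if "a \<in> {0..s}" "b \<in> {0..s}" for a b
    using box'[OF that(2,1)] by (simp add: add_ac)
  obtain a b where ab: "a \<in> {0..s}" "b \<in> {0..s}"
    "f (p + s *\<^sub>R u + s *\<^sub>R v) - f (p + s *\<^sub>R u) - f (p + s *\<^sub>R v) + f p = s\<^sup>2 * ?A (p + a *\<^sub>R u + b *\<^sub>R v)"
    by (rule bexE[OF second_difference[OF S s(1)]], rule box', assumption+, elim bexE) assumption
  obtain a' b' where ab': "a' \<in> {0..s}" "b' \<in> {0..s}"
    "f (p + s *\<^sub>R v + s *\<^sub>R u) - f (p + s *\<^sub>R v) - f (p + s *\<^sub>R u) + f p = s\<^sup>2 * ?B (p + a' *\<^sub>R v + b' *\<^sub>R u)"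
    by (rule bexE[OF second_difference[OF S s(1)]], rule box'', assumption+, elim bexE) assumption
  have "s\<^sup>2 * ?A (p + a *\<^sub>R u + b *\<^sub>R v) = s\<^sup>2 * ?B (p + b' *\<^sub>R u + a' *\<^sub>R v)"
    using ab(3) ab'(3) unfolding add.assoc[of p] add.commute[of "_ *\<^sub>R v"] by linarith
  then have "?A (p + a *\<^sub>R u + b *\<^sub>R v) = ?B (p + b' *\<^sub>R u + a' *\<^sub>R v)" using s by simp
  moreover have "\<bar>?A (p + a *\<^sub>R u + b *\<^sub>R v) - ?A p\<bar> < e"
    using d(3)[OF box'[OF ab(1,2)]] near[OF ab(1,2)] by simp
  moreover have "\<bar>?B (p + b' *\<^sub>R u + a' *\<^sub>R v) - ?B p\<bar> < e"
    using d(4)[OF box'[OF ab'(2,1)]] near[OF ab'(2,1)] by simp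
  ultimately have "\<bar>?A p - ?B p\<bar> < 2 * e" by linarith
  then show False by (simp add: e_def)
qed

text \<open>At a boundary point a box in prescribed directions \<open>u\<close>, \<open>v\<close>
  may leave \<open>S\<close>. For basis vectors there are signed steps that stay in
  \<open>S\<close>, and convexity near \<open>p\<close> fills in a box; both sides are bilinear in
  \<open>u\<close>, \<open>v\<close>, so basis vectors suffice.\<close>

lemma deriv_within_commute_real:
  fixes f :: "'a::euclidean_space \<Rightarrow> real"
  assumes S: "admissible S" "smooth_on S f" and p: "p \<in> S"
  shows "deriv_within S (\<lambda>x. deriv_within S f x u) p v = deriv_within S (\<lambda>x. deriv_within S f x v) p u"
proof -
  let ?H = "\<lambda>u v. deriv_within S (\<lambda>x. deriv_within S f x u) p v"
  have lin1: "linear (?H u)" for u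
    using deriv_within_linear[OF smooth_on_deriv_within[OF S(2)] p] .
  have lin2: "?H u v = (\<Sum>b\<in>Basis. (u \<bullet> b) * ?H b v)" for u v
  proof -
    have "?H u v = deriv_within S (\<lambda>x. \<Sum>b\<in>Basis. (u \<bullet> b) * deriv_within S f x b) p v"
      using deriv_within_expand[OF smooth_on_imp_differentiable_on[OF S(2)]] p
      by (intro deriv_within_cong) auto
    also have "\<dots> = (\<Sum>b\<in>Basis. (u \<bullet> b) * ?H b v)"
      by (subst deriv_within_sum)
        (use S p in \<open>auto intro!: smooth_on_mult smooth_on_const smooth_on_deriv_within sum.cong
          simp: deriv_within_mult[OF S(1) p smooth_on_const smooth_on_deriv_within]\<close>)
    finally show ?thesis .
  qed
  have basis: "?H i j = ?H j i" if ij: "i \<in> Basis" "j \<in> Basis" for i j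
  proof -
    obtain e where e: "e > 0" "convex (S \<inter> ball p e)" using S p unfolding admissible_def by blast
    obtain d1 where d1: "0 < \<bar>d1\<bar>" "\<bar>d1\<bar> < e" "p + d1 *\<^sub>R i \<in> S"
      using S p ij e unfolding admissible_def by meson
    obtain d2 where d2: "0 < \<bar>d2\<bar>" "\<bar>d2\<bar> < e" "p + d2 *\<^sub>R j \<in> S"
      using S p ij e unfolding admissible_def by meson
    have mem: "p \<in> S \<inter> ball p e" "p + d1 *\<^sub>R i \<in> S \<inter> ball p e" "p + d2 *\<^sub>R j \<in> S \<inter> ball p e"
      using p e d1 d2 ij by (auto simp: dist_norm)
    \<comment> \<open>A point of the box with half sides is the midpoint of one point on each of the
      two segments starting at \<open>p\<close>, hence lies in the convex set.\<close>
    have box: "p + a *\<^sub>R ((d1/2) *\<^sub>R i) + b *\<^sub>R ((d2/2) *\<^sub>R j) \<in> S" if "a \<in> {0..1}" "b \<in> {0..1}" for a b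
    proof -
      have "(1 - a) *\<^sub>R p + a *\<^sub>R (p + d1 *\<^sub>R i) \<in> S \<inter> ball p e"
        by (rule convexD[OF e(2) mem(1,2)]) (use that in auto)
      moreover have "(1 - b) *\<^sub>R p + b *\<^sub>R (p + d2 *\<^sub>R j) \<in> S \<inter> ball p e"
        by (rule convexD[OF e(2) mem(1,3)]) (use that in auto)
      ultimately have "(1/2) *\<^sub>R ((1 - a) *\<^sub>R p + a *\<^sub>R (p + d1 *\<^sub>R i)) + (1/2) *\<^sub>R ((1 - b) *\<^sub>R p + b *\<^sub>R (p + d2 *\<^sub>R j)) \<in> S \<inter> ball p e"
        by (rule convexD[OF e(2)]) auto
      moreover have "(1/2) *\<^sub>R ((1 - a) *\<^sub>R p + a *\<^sub>R (p + d1 *\<^sub>R i)) + (1/2) *\<^sub>R ((1 - b) *\<^sub>R p + b *\<^sub>R (p + d2 *\<^sub>R j))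
        = p + a *\<^sub>R ((d1/2) *\<^sub>R i) + b *\<^sub>R ((d2/2) *\<^sub>R j)"
        by (simp add: algebra_simps flip: scaleR_add_left)
      ultimately show ?thesis by simp
    qed
    have "?H ((d1/2) *\<^sub>R i) ((d2/2) *\<^sub>R j) = ?H ((d2/2) *\<^sub>R j) ((d1/2) *\<^sub>R i)"
      using deriv_within_commute_box[OF S p box] .
    moreover have sc: "?H (c *\<^sub>R u) (d *\<^sub>R v) = c * d * ?H u v" for c d u v
    proof -
      have "?H (c *\<^sub>R u) (d *\<^sub>R v) = c * ?H u (d *\<^sub>R v)"
        unfolding lin2[of "c *\<^sub>R u"] lin2[of u] by (simp add: sum_distrib_left mult.assoc)
      then show ?thesis using linear_scale[OF lin1] by simp
    qed
    ultimately show ?thesis using d1 d2 by (simp add: sc)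
  qed
  have full: "?H u v = (\<Sum>b\<in>Basis. \<Sum>c\<in>Basis. (u \<bullet> b) * (v \<bullet> c) * ?H b c)" for u v
  proof -
    have e: "?H b v = (\<Sum>c\<in>Basis. (v \<bullet> c) * ?H b c)" for b
      using deriv_within_expand[OF smooth_on_imp_differentiable_on[OF smooth_on_deriv_within[OF S(2)]] p, of b v] by simp
    show ?thesis unfolding lin2[of u v] e by (simp add: sum_distrib_left mult.assoc)
  qed
  have "?H u v = (\<Sum>b\<in>Basis. \<Sum>c\<in>Basis. (u \<bullet> b) * (v \<bullet> c) * ?H c b)"
    unfolding full[of u v] by (intro sum.cong refl arg_cong2[where f = "(*)"] basis)
  also have "\<dots> = ?H v u" unfolding full[of v u] by (subst sum.swap) (simp add: mult.commute)
  finally show ?thesis .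
qed

lemma deriv_within_commute:
  fixes f :: "'a::euclidean_space \<Rightarrow> 'b::euclidean_space"
  assumes S: "admissible S" "smooth_on S f" and p: "p \<in> S"
  shows "deriv_within S (\<lambda>x. deriv_within S f x u) p v = deriv_within S (\<lambda>x. deriv_within S f x v) p u"
proof (rule euclidean_eqI)
  fix b :: 'b
  have D: "deriv_within S (\<lambda>x. deriv_within S f x u) p v \<bullet> b =
      deriv_within S (\<lambda>x. deriv_within S (\<lambda>x. f x \<bullet> b) x u) p v" for u v
  proof -
    have "deriv_within S (\<lambda>x. deriv_within S f x u) p v \<bullet> b = deriv_within S (\<lambda>x. deriv_within S f x u \<bullet> b) p v"
      using S p by (intro deriv_within_bounded_linear[symmetric] smooth_on_deriv_within bounded_linear_inner_left)
    also have "\<dots> = deriv_within S (\<lambda>x. deriv_within S (\<lambda>x. f x \<bullet> b) x u) p v"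
      using S by (intro deriv_within_cong p deriv_within_bounded_linear[symmetric] bounded_linear_inner_left)
    finally show ?thesis .
  qed
  show "deriv_within S (\<lambda>x. deriv_within S f x u) p v \<bullet> b = deriv_within S (\<lambda>x. deriv_within S f x v) p u \<bullet> b"
    unfolding D using S p by (intro deriv_within_commute_real smooth)
qed

section \<open>Inner products and Gram-Schmidt frames\<close>

definition inner_product :: "('a::euclidean_space \<Rightarrow> 'a \<Rightarrow> real) \<Rightarrow> bool" where
  "inner_product G \<longleftrightarrow> bilinear G \<and> (\<forall>u v. G u v = G v u) \<and> (\<forall>v. v \<noteq> 0 \<longrightarrow> G v v > 0)"

lemma bilinear_simps:
  assumes "bilinear B"
  shows "B (x + y) z = B x z + B y z" "B x (y + z) = B x y + B x z"
    "B (x - y) z = B x z - B y z" "B x (y - z) = B x y - B x z"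
    "B (- x) z = - B x z" "B x (- z) = - B x z"
    "B (c *\<^sub>R x) z = c *\<^sub>R B x z" "B x (c *\<^sub>R z) = c *\<^sub>R B x z"
    "B 0 z = 0" "B x 0 = 0"
    "B (\<Sum>i\<in>I. f i) z = (\<Sum>i\<in>I. B (f i) z)" "B x (\<Sum>i\<in>I. f i) = (\<Sum>i\<in>I. B x (f i))"
proof -
  have l: "linear (\<lambda>x. B x z)" "linear (B x)" for x z using assms by (auto simp: bilinear_def)
  show "B (x + y) z = B x z + B y z" "B x (y + z) = B x y + B x z"
    "B (x - y) z = B x z - B y z" "B x (y - z) = B x y - B x z"
    "B (- x) z = - B x z" "B x (- z) = - B x z"
    "B (c *\<^sub>R x) z = c *\<^sub>R B x z" "B x (c *\<^sub>R z) = c *\<^sub>R B x z"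
    "B 0 z = 0" "B x 0 = 0"
    "B (\<Sum>i\<in>I. f i) z = (\<Sum>i\<in>I. B (f i) z)" "B x (\<Sum>i\<in>I. f i) = (\<Sum>i\<in>I. B x (f i))"
    using linear_add[OF l(1)] linear_add[OF l(2)] linear_diff[OF l(1)] linear_diff[OF l(2)]
      linear_neg[OF l(1)] linear_neg[OF l(2)] linear_scale[OF l(1)] linear_scale[OF l(2)]
      linear_0[OF l(1)] linear_0[OF l(2)] linear_sum[OF l(1)] linear_sum[OF l(2)]
    by auto
qed

lemma inner_productD:
  assumes "inner_product G"
  shows "bilinear G" "G u v = G v u" "v \<noteq> 0 \<Longrightarrow> G v v > 0" "G v v \<ge> 0"
proof -
  show b: "bilinear G" and "G u v = G v u" "v \<noteq> 0 \<Longrightarrow> G v v > 0"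
    using assms unfolding inner_product_def by blast+
  then show "G v v \<ge> 0" using bilinear_simps(9)[OF b] by (cases "v = 0") force+
qed

lemma inner_product_ext:
  assumes "inner_product G" "\<And>w. G u w = G v w"
  shows "u = v"
proof -
  have "G (u - v) (u - v) = 0"
    using assms(2) by (simp add: bilinear_simps[OF inner_productD(1)[OF assms(1)]])
  then show ?thesis using inner_productD(3)[OF assms(1), of "u - v"] by force
qed

lemma sharp_eqI:
  assumes "inner_product G" "\<And>w. G v w = \<alpha> w"
  shows "sharp G \<alpha> = v"
  unfolding sharp_def
proof (rule the_equality)
  show "u = v" if "\<forall>w. G u w = \<alpha> w" for u
    using inner_product_ext[OF assms(1)] that assms(2) by simp
qed (use assms in simp)

section \<open>Gram-Schmidt orthonormalization\<close>

function gram_schmidt :: "('a::real_vector \<Rightarrow> 'a \<Rightarrow> real) \<Rightarrow> (nat \<Rightarrow> 'a) \<Rightarrow> nat \<Rightarrow> 'a" where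
  "gram_schmidt G X k = (let v = X k - (\<Sum>j\<in>{..<k}. G (X k) (gram_schmidt G X j) *\<^sub>R gram_schmidt G X j)
     in inverse (sqrt (G v v)) *\<^sub>R v)"
  by pat_completeness auto
termination by (relation "Wellfounded.measure (\<lambda>(G, X, k). k)") auto

declare gram_schmidt.simps [simp del]

lemma span_lessThan_mono: "k \<le> l \<Longrightarrow> span (h ` {..<k}) \<subseteq> span (h ` {..<l})" for k l :: nat
  by (intro span_mono image_mono) auto

definition orthonormal :: "('a \<Rightarrow> 'a \<Rightarrow> real) \<Rightarrow> nat \<Rightarrow> (nat \<Rightarrow> 'a) \<Rightarrow> bool" where
  "orthonormal G n E \<longleftrightarrow> (\<forall>i<n. \<forall>j<n. G (E i) (E j) = (if i = j then 1 else 0))"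

lemma orthonormal_expand_span:
  assumes "bilinear G" "orthonormal G n E" "v \<in> span (E ` {..<n})"
  shows "v = (\<Sum>i<n. G v (E i) *\<^sub>R E i)"
  using assms(3)
proof (induction rule: span_induct_alt)
  case base
  then show ?case by (simp add: bilinear_simps[OF assms(1)])
next
  case (step c x y)
  then obtain k where k: "k < n" "x = E k" by auto
  have "(\<Sum>i<n. G x (E i) *\<^sub>R E i) = (\<Sum>i<n. if i = k then E i else 0)"
    using assms(2) k by (intro sum.cong) (auto simp: orthonormal_def)
  also have "\<dots> = x" using k by simp
  finally have x: "x = (\<Sum>i<n. G x (E i) *\<^sub>R E i)" by simp
  have "(\<Sum>i<n. G (c *\<^sub>R x + y) (E i) *\<^sub>R E i) = c *\<^sub>R (\<Sum>i<n. G x (E i) *\<^sub>R E i) + (\<Sum>i<n. G y (E i) *\<^sub>R E i)"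
    by (simp add: bilinear_simps[OF assms(1)] scaleR_sum_right sum.distrib scaleR_add_left)
  then show ?case using x step by simp
qed

text \<open>The quadratic conjunct records the squared length of the residual before normalization;
  it is carried along so that its positivity can be read off from the positive pairing with
  \<open>X i\<close>.\<close>

lemma gram_schmidt_step:
  assumes G: "inner_product G" and X: "\<And>k. k < n \<Longrightarrow> X k \<notin> span (X ` {..<k})"
  shows "k \<le> n \<Longrightarrow> orthonormal G k (gram_schmidt G X) \<and> span (gram_schmidt G X ` {..<k}) = span (X ` {..<k})
    \<and> (\<forall>i<k. G (X i) (gram_schmidt G X i) > 0 \<and> G (gram_schmidt G X i) (X i) * G (gram_schmidt G X i) (X i) =
       G (X i - (\<Sum>j<i. G (X i) (gram_schmidt G X j) *\<^sub>R gram_schmidt G X j)) (X i - (\<Sum>j<i. G (X i) (gram_schmidt G X j) *\<^sub>R gram_schmidt G X j)))"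
proof (induction k)
  case 0
  then show ?case by (simp add: orthonormal_def)
next
  case (Suc k)
  let ?E = "gram_schmidt G X"
  define v where "v = X k - (\<Sum>j<k. G (X k) (?E j) *\<^sub>R ?E j)"
  note b = bilinear_simps[OF inner_productD(1)[OF G]]
  have IH: "orthonormal G k ?E" "span (?E ` {..<k}) = span (X ` {..<k})" using Suc by auto
  have Ek: "?E k = inverse (sqrt (G v v)) *\<^sub>R v"
    by (subst gram_schmidt.simps) (simp add: v_def Let_def)
  have "(\<Sum>j<k. G (X k) (?E j) *\<^sub>R ?E j) \<in> span (X ` {..<k})"
    unfolding IH(2)[symmetric] by (intro span_sum span_scale span_base) auto
  then have "v \<noteq> 0" using X[of k] Suc.prems by (auto simp: v_def)
  then have v: "G v v > 0" using inner_productD(3)[OF G] by blast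
  have vE: "G v (?E i) = 0" if "i < k" for i
  proof -
    have "(\<Sum>j<k. G (X k) (?E j) * G (?E j) (?E i)) = (\<Sum>j<k. if j = i then G (X k) (?E j) else 0)"
      using IH(1) that by (intro sum.cong) (auto simp: orthonormal_def)
    then show ?thesis using that by (simp add: v_def b)
  qed
  have vX: "G v (X k) = G v v"
  proof -
    have "G v (X k) = G v v + G v (\<Sum>j<k. G (X k) (?E j) *\<^sub>R ?E j)"
      by (simp add: v_def b(4) flip: b(2))
    also have "G v (\<Sum>j<k. G (X k) (?E j) *\<^sub>R ?E j) = 0" by (simp add: b vE)
    finally show ?thesis by simp
  qed
  have 1: "G (?E k) (?E k) = 1" using v by (simp add: Ek b field_simps)
  have 2: "G (?E k) (?E i) = 0" "G (?E i) (?E k) = 0" if "i < k" for i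
    using vE[OF that] inner_productD(2)[OF G] by (auto simp: Ek b)
  have 3: "G (?E k) (X k) = sqrt (G v v)"
    using v vX by (simp add: Ek b field_simps)
  have o: "orthonormal G (Suc k) ?E"
    using IH(1) 1 2 unfolding orthonormal_def by (auto simp: less_Suc_eq)
  have "X k = sqrt (G v v) *\<^sub>R ?E k + (\<Sum>j<k. G (X k) (?E j) *\<^sub>R ?E j)"
    using v by (simp add: Ek v_def)
  moreover have "sqrt (G v v) *\<^sub>R ?E k + (\<Sum>j<k. G (X k) (?E j) *\<^sub>R ?E j) \<in> span (?E ` {..<Suc k})"
    by (intro span_add span_scale span_base span_sum) auto
  ultimately have "X k \<in> span (?E ` {..<Suc k})" by simp
  moreover have "X i \<in> span (?E ` {..<Suc k})" if "i < k" for i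
  proof -
    have "X i \<in> span (?E ` {..<k})" unfolding IH(2) using that by (intro span_base) auto
    then show ?thesis using span_lessThan_mono[of k "Suc k" ?E] by auto
  qed
  ultimately have s1: "span (X ` {..<Suc k}) \<subseteq> span (?E ` {..<Suc k})"
    by (intro span_minimal subspace_span) (auto simp: less_Suc_eq)
  have "v \<in> span (X ` {..<Suc k})"
    unfolding v_def
  proof (rule span_diff)
    show "X k \<in> span (X ` {..<Suc k})" by (intro span_base) auto
    show "(\<Sum>j<k. G (X k) (?E j) *\<^sub>R ?E j) \<in> span (X ` {..<Suc k})"
      using \<open>(\<Sum>j<k. G (X k) (?E j) *\<^sub>R ?E j) \<in> span (X ` {..<k})\<close>
        span_lessThan_mono[of k "Suc k" X] by auto
  qed
  then have "?E k \<in> span (X ` {..<Suc k})" unfolding Ek by (rule span_scale)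
  moreover have "?E i \<in> span (X ` {..<Suc k})" if "i < k" for i
  proof -
    have "?E i \<in> span (X ` {..<k})" unfolding IH(2)[symmetric] using that by (intro span_base) auto
    then show ?thesis using span_lessThan_mono[of k "Suc k" X] by auto
  qed
  ultimately have s2: "span (?E ` {..<Suc k}) \<subseteq> span (X ` {..<Suc k})"
    by (intro span_minimal subspace_span) (auto simp: less_Suc_eq)
  have "G (X k) (?E k) > 0" "G (?E k) (X k) * G (?E k) (X k) = G v v"
    using 3 v inner_productD(2)[OF G, of "X k"] by auto
  then have p: "\<forall>i<Suc k. G (X i) (?E i) > 0 \<and> G (?E i) (X i) * G (?E i) (X i) =
       G (X i - (\<Sum>j<i. G (X i) (?E j) *\<^sub>R ?E j)) (X i - (\<Sum>j<i. G (X i) (?E j) *\<^sub>R ?E j))"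
    using Suc unfolding v_def less_Suc_eq by auto
  show ?case using o s1 s2 p by auto
qed

text \<open>A positive residual keeps the normalization smooth, the positive diagonal will give the
  lapse and the volume density, and triangularity makes the last vector normal to the span of the
  earlier \<open>X i\<close>.\<close>

lemma gram_schmidt:
  assumes G: "inner_product G" and X: "\<And>k. k < n \<Longrightarrow> X k \<notin> span (X ` {..<k})"
  shows "orthonormal G n (gram_schmidt G X)"
    and "k \<le> n \<Longrightarrow> span (gram_schmidt G X ` {..<k}) = span (X ` {..<k})"
    and "i < n \<Longrightarrow> G (X i) (gram_schmidt G X i) > 0"
    and "i < n \<Longrightarrow> v = X i - (\<Sum>j<i. G (X i) (gram_schmidt G X j) *\<^sub>R gram_schmidt G X j) \<Longrightarrow> G v v > 0"
    and "i < j \<Longrightarrow> j < n \<Longrightarrow> G (X i) (gram_schmidt G X j) = 0"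
proof -
  let ?E = "gram_schmidt G X"
  have s: "k \<le> n \<Longrightarrow> orthonormal G k ?E \<and> span (?E ` {..<k}) = span (X ` {..<k})
    \<and> (\<forall>i<k. G (X i) (?E i) > 0 \<and> G (?E i) (X i) * G (?E i) (X i) =
       G (X i - (\<Sum>j<i. G (X i) (?E j) *\<^sub>R ?E j)) (X i - (\<Sum>j<i. G (X i) (?E j) *\<^sub>R ?E j)))" for k
    by (rule gram_schmidt_step[OF G X])
  show o: "orthonormal G n ?E" using s[of n] by blast
  show sp: "k \<le> n \<Longrightarrow> span (?E ` {..<k}) = span (X ` {..<k})" for k using s[of k] by blast
  show pos: "i < n \<Longrightarrow> G (X i) (?E i) > 0" for i
    using s[of n, OF le_refl, THEN conjunct2, THEN conjunct2, rule_format, THEN conjunct1] .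
  show "G v v > 0" if "i < n" and v: "v = X i - (\<Sum>j<i. G (X i) (?E j) *\<^sub>R ?E j)" for i v
  proof -
    have "G (?E i) (X i) > 0" using pos[OF that(1)] inner_productD(2)[OF G, of "X i"] by simp
    moreover have "G (?E i) (X i) * G (?E i) (X i) = G v v"
      using s[of n, OF le_refl, THEN conjunct2, THEN conjunct2, rule_format, OF that(1), THEN conjunct2] unfolding v .
    ultimately show ?thesis using mult_pos_pos[of "G (?E i) (X i)" "G (?E i) (X i)"] by linarith
  qed
  assume ij: "i < j" "j < n"
  have "X i \<in> span (?E ` {..<Suc i})" using sp[of "Suc i"] ij by (auto intro: span_base)
  moreover have "orthonormal G (Suc i) ?E" using o ij by (auto simp: orthonormal_def)
  ultimately have "X i = (\<Sum>k<Suc i. G (X i) (?E k) *\<^sub>R ?E k)"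
    using orthonormal_expand_span[OF inner_productD(1)[OF G]] by blast
  from arg_cong[OF this, of "\<lambda>x. G x (?E j)"]
  have "G (X i) (?E j) = (\<Sum>k<Suc i. G (X i) (?E k) *\<^sub>R G (?E k) (?E j))"
    unfolding bilinear_simps(7,11)[OF inner_productD(1)[OF G]] .
  also have "\<dots> = 0" using o ij by (intro sum.neutral) (auto simp: orthonormal_def)
  finally show "G (X i) (?E j) = 0" .
qed

lemma orthonormal_expand:
  fixes E :: "nat \<Rightarrow> 'a::euclidean_space"
  assumes G: "inner_product G" and E: "orthonormal G (DIM('a)) E"
  shows "v = (\<Sum>i<DIM('a). G v (E i) *\<^sub>R E i)"
proof -
  note b = bilinear_simps[OF inner_productD(1)[OF G]]
  have inj: "inj_on E {..<DIM('a)}"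
    using E unfolding orthonormal_def inj_on_def by (metis lessThan_iff zero_neq_one)
  have "independent (E ` {..<DIM('a)})"
    unfolding independent_explicit_finite_subsets
  proof (intro allI impI ballI)
    fix A u w assume A: "A \<subseteq> E ` {..<DIM('a)}" "finite A" "(\<Sum>v\<in>A. u v *\<^sub>R v) = 0" "w \<in> A"
    have g: "G x w = (if x = w then 1 else 0)" if "x \<in> A" for x
    proof -
      have "x \<in> E ` {..<DIM('a)}" "w \<in> E ` {..<DIM('a)}" using subsetD[OF A(1)] that A(4) by auto
      then obtain i j where ij: "i < DIM('a)" "j < DIM('a)" "x = E i" "w = E j" by (elim imageE) simp
      then have "x = w \<longleftrightarrow> i = j" using inj by (simp add: inj_on_eq_iff)
      then show ?thesis using E[unfolded orthonormal_def, rule_format, OF ij(1,2)] ij(3,4) by simp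
    qed
    have "G (\<Sum>v\<in>A. u v *\<^sub>R v) w = (\<Sum>v\<in>A. if v = w then u v else 0)"
      unfolding b using g by (intro sum.cong) auto
    also have "\<dots> = u w" using A by simp
    finally have "G (\<Sum>v\<in>A. u v *\<^sub>R v) w = u w" .
    then show "u w = 0" using A(3) by (simp add: b)
  qed
  then have "UNIV \<subseteq> span (E ` {..<DIM('a)})"
    by (intro card_ge_dim_independent) (auto simp: card_image[OF inj])
  then show ?thesis using orthonormal_expand_span[OF inner_productD(1)[OF G] E] by auto
qed

text \<open>An enumeration is fixed because Gram-Schmidt works on sequences indexed by natural
  numbers.\<close>

definition basis_enum :: "nat \<Rightarrow> 'a::euclidean_space" where
  "basis_enum = (SOME h. bij_betw h {..<DIM('a)} Basis)"

lemma bij_basis_enum: "bij_betw (basis_enum :: nat \<Rightarrow> 'a) {..<DIM('a::euclidean_space)} Basis"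
proof -
  have "\<exists>h. bij_betw h {..<DIM('a)} (Basis :: 'a set)"
    using ex_bij_betw_nat_finite[of "Basis :: 'a set"] by (simp add: atLeast0LessThan)
  from someI_ex[OF this] show ?thesis unfolding basis_enum_def .
qed

lemma basis_enum_independent:
  assumes "k < DIM('a::euclidean_space)"
  shows "(basis_enum k :: 'a) \<notin> span (basis_enum ` {..<k})"
proof
  note bij = bij_basis_enum[where 'a='a]
  have k: "(basis_enum k :: 'a) \<in> Basis" using bij assms by (auto simp: bij_betw_def)
  assume "(basis_enum k :: 'a) \<in> span (basis_enum ` {..<k})"
  moreover have "basis_enum ` {..<k} \<subseteq> Basis - {basis_enum k :: 'a}"
  proof (intro image_subsetI)
    fix j assume "j \<in> {..<k}"
    then have "j < k" by simp
    then have "(basis_enum j :: 'a) \<in> Basis" "(basis_enum j :: 'a) \<noteq> basis_enum k"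
      using bij assms inj_onD[OF bij_betw_imp_inj_on[OF bij], of j k] by (auto simp: bij_betw_def)
    then show "(basis_enum j :: 'a) \<in> Basis - {basis_enum k}" by blast
  qed
  ultimately have "(basis_enum k :: 'a) \<in> span (Basis - {basis_enum k})"
    using span_mono by blast
  then show False using independent_Basis k unfolding dependent_def by blast
qed

lemma exists_orthonormal:
  assumes "inner_product (G :: 'a::euclidean_space \<Rightarrow> 'a \<Rightarrow> real)"
  shows "orthonormal G (DIM('a)) (gram_schmidt G basis_enum)"
  using gram_schmidt(1)[OF assms] basis_enum_independent by blast

lemma sharp_frame:
  fixes E :: "nat \<Rightarrow> 'a::euclidean_space"
  assumes G: "inner_product G" and E: "orthonormal G (DIM('a)) E" and "linear \<alpha>"
  shows "sharp G \<alpha> = (\<Sum>a<DIM('a). \<alpha> (E a) *\<^sub>R E a)"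
proof (rule sharp_eqI[OF G])
  note b = bilinear_simps[OF inner_productD(1)[OF G]]
  fix w
  have "\<alpha> w = \<alpha> (\<Sum>a<DIM('a). G w (E a) *\<^sub>R E a)"
    by (rule arg_cong[OF orthonormal_expand[OF G E]])
  also have "\<dots> = (\<Sum>a<DIM('a). G w (E a) * \<alpha> (E a))"
    using assms(3) by (simp add: linear_sum linear_scale)
  also have "\<dots> = G (\<Sum>a<DIM('a). \<alpha> (E a) *\<^sub>R E a) w"
    unfolding b inner_productD(2)[OF G, of w] by (simp add: mult.commute)
  finally show "G (\<Sum>a<DIM('a). \<alpha> (E a) *\<^sub>R E a) w = \<alpha> w" by simp
qed

lemma sharp_prop:
  fixes G :: "'a::euclidean_space \<Rightarrow> 'a \<Rightarrow> real"
  assumes G: "inner_product G" and "linear \<alpha>"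
  shows "G (sharp G \<alpha>) w = \<alpha> w"
proof -
  let ?E = "gram_schmidt G basis_enum"
  note b = bilinear_simps[OF inner_productD(1)[OF G]] and E = exists_orthonormal[OF G]
  have "G (sharp G \<alpha>) w = (\<Sum>a<DIM('a). \<alpha> (?E a) * G w (?E a))"
    unfolding sharp_frame[OF G E assms(2)] b inner_productD(2)[OF G, of w] by simp
  also have "\<dots> = \<alpha> (\<Sum>a<DIM('a). G w (?E a) *\<^sub>R ?E a)"
    using assms(2) by (simp add: linear_sum linear_scale mult.commute)
  also have "\<dots> = \<alpha> w" by (rule arg_cong[OF orthonormal_expand[OF G E, symmetric]])
  finally show ?thesis .
qed

lemma dual_vec_frame:
  fixes E :: "nat \<Rightarrow> 'a::euclidean_space"
  assumes G: "inner_product G" and E: "orthonormal G (DIM('a)) E"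
  shows "dual_vec G b = (\<Sum>a<DIM('a). (b \<bullet> E a) *\<^sub>R E a)"
  unfolding dual_vec_def
  by (rule sharp_frame[OF G E]) (auto intro!: linearI simp: inner_add_right)

text \<open>Expanding \<open>dual_vec\<close> in the frame and collecting the sum over
  \<open>Basis\<close> gives \<open>E a\<close> back. Coordinate traces thereby become sums over an
  arbitrary orthonormal frame.\<close>

lemma trace_frame:
  fixes E :: "nat \<Rightarrow> 'a::euclidean_space"
  assumes G: "inner_product G" and E: "orthonormal G (DIM('a)) E" and B: "bilinear (B :: 'a \<Rightarrow> 'a \<Rightarrow> real)"
  shows "(\<Sum>b\<in>Basis. B b (dual_vec G b)) = (\<Sum>a<DIM('a). B (E a) (E a))"
proof -
  note b = bilinear_simps[OF B]
  have "(\<Sum>b\<in>Basis. B b (dual_vec G b)) = (\<Sum>b\<in>Basis. \<Sum>a<DIM('a). (b \<bullet> E a) * B b (E a))"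
    unfolding dual_vec_frame[OF G E] by (simp add: b)
  also have "\<dots> = (\<Sum>a<DIM('a). B (\<Sum>b\<in>Basis. (E a \<bullet> b) *\<^sub>R b) (E a))"
    by (subst sum.swap) (simp add: b inner_commute)
  finally show ?thesis by (simp add: euclidean_representation)
qed

lemma trace_frame2:
  fixes E :: "nat \<Rightarrow> 'a::euclidean_space"
  assumes G: "inner_product G" and E: "orthonormal G (DIM('a)) E"
    and T: "\<And>y w. bilinear (\<lambda>x z. T x y z w :: real)" "\<And>x z. bilinear (\<lambda>y w. T x y z w)"
  shows "(\<Sum>a\<in>Basis. \<Sum>b\<in>Basis. T a b (dual_vec G a) (dual_vec G b))
    = (\<Sum>a<DIM('a). \<Sum>b<DIM('a). T (E a) (E b) (E a) (E b))"
proof -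
  have "(\<Sum>a\<in>Basis. \<Sum>b\<in>Basis. T a b (dual_vec G a) (dual_vec G b)) =
    (\<Sum>a\<in>Basis. \<Sum>b<DIM('a). T a (E b) (dual_vec G a) (E b))"
    by (intro sum.cong refl trace_frame[OF G E T(2)])
  also have "\<dots> = (\<Sum>b<DIM('a). \<Sum>a\<in>Basis. T a (E b) (dual_vec G a) (E b))"
    by (rule sum.swap)
  also have "\<dots> = (\<Sum>b<DIM('a). \<Sum>a<DIM('a). T (E a) (E b) (E a) (E b))"
    by (intro sum.cong refl trace_frame[OF G E T(1)])
  also have "\<dots> = (\<Sum>a<DIM('a). \<Sum>b<DIM('a). T (E a) (E b) (E a) (E b))"
    by (rule sum.swap)
  finally show ?thesis .
qed

section \<open>Levi-Civita connection and curvature\<close>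

text \<open>Tensor fields are given as smooth on constant arguments only. Linearity and the
  expansion of \<open>V p\<close> over \<open>Basis\<close> extend this to variable
  arguments.\<close>

lemma smooth_on_linear_family:
  fixes L :: "'a::euclidean_space \<Rightarrow> 'b::euclidean_space \<Rightarrow> 'c::real_normed_vector"
  assumes S: "admissible S" and L: "\<And>v. smooth_on S (\<lambda>p. L p v)" "\<And>p. p \<in> S \<Longrightarrow> linear (L p)"
    and V: "smooth_on S V"
  shows "smooth_on S (\<lambda>p. L p (V p))"
proof -
  have "L p (V p) = (\<Sum>b\<in>Basis. (V p \<bullet> b) *\<^sub>R L p b)" if "p \<in> S" for p
  proof -
    have "L p (\<Sum>b\<in>Basis. (V p \<bullet> b) *\<^sub>R b) = (\<Sum>b\<in>Basis. (V p \<bullet> b) *\<^sub>R L p b)"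
      using L(2)[OF that] by (simp add: linear_sum linear_scale)
    then show ?thesis by (simp add: euclidean_representation)
  qed
  moreover have "smooth_on S (\<lambda>p. \<Sum>b\<in>Basis. (V p \<bullet> b) *\<^sub>R L p b)"
    by (rule smooth_on_sum[OF S finite_Basis], rule smooth_on_scaleR[OF S smooth_on_inner[OF S V] L(1)])
  ultimately show ?thesis by (rule smooth_on_cong[THEN iffD2])
qed

lemma deriv_within_linear_family:
  fixes L :: "'a::euclidean_space \<Rightarrow> 'b::euclidean_space \<Rightarrow> 'c::real_normed_vector"
  assumes S: "admissible S" and p: "p \<in> S" and L: "\<And>v. smooth_on S (\<lambda>p. L p v)" "\<And>p. p \<in> S \<Longrightarrow> linear (L p)"
    and V: "smooth_on S V"
  shows "deriv_within S (\<lambda>x. L x (V x)) p u = deriv_within S (\<lambda>x. L x (V p)) p u + L p (deriv_within S V p u)"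
proof -
  have ex: "L x v = (\<Sum>b\<in>Basis. (v \<bullet> b) *\<^sub>R L x b)" if "x \<in> S" for x v
  proof -
    have "L x (\<Sum>b\<in>Basis. (v \<bullet> b) *\<^sub>R b) = (\<Sum>b\<in>Basis. (v \<bullet> b) *\<^sub>R L x b)"
      using L(2)[OF that] by (simp add: linear_sum linear_scale)
    then show ?thesis by (simp add: euclidean_representation)
  qed
  have D: "deriv_within S (\<lambda>x. L x (W x)) p u =
    (\<Sum>b\<in>Basis. (deriv_within S W p u \<bullet> b) *\<^sub>R L p b + (W p \<bullet> b) *\<^sub>R deriv_within S (\<lambda>x. L x b) p u)"
    if W: "smooth_on S W" for W
  proof -
    have "deriv_within S (\<lambda>x. L x (W x)) p u = deriv_within S (\<lambda>x. \<Sum>b\<in>Basis. (W x \<bullet> b) *\<^sub>R L x b) p u"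
      by (rule deriv_within_cong[OF _ p], rule ex)
    also have "\<dots> = (\<Sum>b\<in>Basis. deriv_within S (\<lambda>x. (W x \<bullet> b) *\<^sub>R L x b) p u)"
      by (rule deriv_within_sum[OF S p finite_Basis], rule smooth_on_scaleR[OF S smooth_on_inner[OF S W] L(1)])
    also have "\<dots> = (\<Sum>b\<in>Basis. (deriv_within S W p u \<bullet> b) *\<^sub>R L p b + (W p \<bullet> b) *\<^sub>R deriv_within S (\<lambda>x. L x b) p u)"
      unfolding deriv_within_scaleR[OF S p smooth_on_inner[OF S W] L(1)]
        deriv_within_bounded_linear[OF S p W bounded_linear_inner_left] ..
    finally show ?thesis .
  qed
  have "(\<Sum>b\<in>Basis. (deriv_within S V p u \<bullet> b) *\<^sub>R L p b) = L p (deriv_within S V p u)"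
    by (rule ex[OF p, symmetric])
  then show ?thesis
    unfolding D[OF V] D[OF smooth_on_const[OF S, of "V p"]] deriv_within_const[OF S p] sum.distrib by simp
qed

definition form_field :: "'a::euclidean_space set \<Rightarrow> ('a \<Rightarrow> 'a \<Rightarrow> 'a \<Rightarrow> real) \<Rightarrow> bool" where
  "form_field S B \<longleftrightarrow> (\<forall>u v. smooth_on S (\<lambda>p. B p u v)) \<and> (\<forall>p\<in>S. bilinear (B p))"

lemma form_fieldD:
  assumes "form_field S B"
  shows "smooth_on S (\<lambda>p. B p u v)" "p \<in> S \<Longrightarrow> bilinear (B p)" "p \<in> S \<Longrightarrow> linear (B p u)" "p \<in> S \<Longrightarrow> linear (\<lambda>u. B p u v)"
  using assms unfolding form_field_def bilinear_def by auto

lemma smooth_on_form: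
  assumes S: "admissible S" and B: "form_field S B" and V: "smooth_on S V" and W: "smooth_on S W"
  shows "smooth_on S (\<lambda>p. B p (V p) (W p))"
proof (rule smooth_on_linear_family[OF S _ _ W, where L = "\<lambda>p. B p (V p)"])
  show "smooth_on S (\<lambda>p. B p (V p) w)" for w
    by (rule smooth_on_linear_family[where L = "\<lambda>p v. B p v w", OF S form_fieldD(1)[OF B] form_fieldD(4)[OF B] V])
qed (rule form_fieldD(3)[OF B])

lemma deriv_within_form:
  assumes S: "admissible S" and p: "p \<in> S" and B: "form_field S B" and V: "smooth_on S V" and W: "smooth_on S W"
  shows "deriv_within S (\<lambda>x. B x (V x) (W x)) p u = deriv_within S (\<lambda>x. B x (V p) (W p)) p u
    + B p (deriv_within S V p u) (W p) + B p (V p) (deriv_within S W p u)"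
proof -
  have "deriv_within S (\<lambda>x. B x (V x) (W x)) p u = deriv_within S (\<lambda>x. B x (V x) (W p)) p u + B p (V p) (deriv_within S W p u)"
    by (rule deriv_within_linear_family[where L = "\<lambda>p. B p (V p)",
          OF S p smooth_on_form[OF S B V smooth_on_const[OF S]] form_fieldD(3)[OF B] W])
  also have "deriv_within S (\<lambda>x. B x (V x) (W p)) p u = deriv_within S (\<lambda>x. B x (V p) (W p)) p u + B p (deriv_within S V p u) (W p)"
    by (rule deriv_within_linear_family[where L = "\<lambda>x v. B x v (W p)",
          OF S p form_fieldD(1)[OF B] form_fieldD(4)[OF B] V])
  finally show ?thesis by simp
qed

lemma deriv_within_bilinear:
  fixes B :: "'a::euclidean_space \<Rightarrow> 'b::real_vector \<Rightarrow> 'c::real_vector \<Rightarrow> 'd::real_normed_vector"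
  assumes S: "admissible S" and sm: "\<And>v w. smooth_on S (\<lambda>x. B x v w)"
    and B: "\<And>p. p \<in> S \<Longrightarrow> bilinear (B p)" and p: "p \<in> S"
  shows "bilinear (\<lambda>v w. deriv_within S (\<lambda>x. B x v w) p u)"
  unfolding bilinear_def
proof (intro conjI allI linearI)
  have l: "x \<in> S \<Longrightarrow> linear (\<lambda>v. B x v w)" "x \<in> S \<Longrightarrow> linear (B x v)" for x v w
    using B by (auto simp: bilinear_def)
  fix v w a b c
  show "deriv_within S (\<lambda>x. B x v (a + b)) p u = deriv_within S (\<lambda>x. B x v a) p u + deriv_within S (\<lambda>x. B x v b) p u"
    unfolding deriv_within_add[OF S p sm sm, symmetric]
    by (rule deriv_within_cong[OF _ p]) (rule linear_add[OF l(2)])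
  show "deriv_within S (\<lambda>x. B x v (c *\<^sub>R b)) p u = c *\<^sub>R deriv_within S (\<lambda>x. B x v b) p u"
    unfolding deriv_within_bounded_linear[OF S p sm bounded_linear_scaleR_right, symmetric]
    by (rule deriv_within_cong[OF _ p]) (rule linear_scale[OF l(2)])
next
  have l: "x \<in> S \<Longrightarrow> linear (\<lambda>v. B x v w)" for x v w
    using B by (auto simp: bilinear_def)
  fix w a b c
  show "deriv_within S (\<lambda>x. B x (a + b) w) p u = deriv_within S (\<lambda>x. B x a w) p u + deriv_within S (\<lambda>x. B x b w) p u"
    unfolding deriv_within_add[OF S p sm sm, symmetric]
    by (rule deriv_within_cong[OF _ p]) (rule linear_add[OF l])
  show "deriv_within S (\<lambda>x. B x (c *\<^sub>R b) w) p u = c *\<^sub>R deriv_within S (\<lambda>x. B x b w) p u"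
    unfolding deriv_within_bounded_linear[OF S p sm bounded_linear_scaleR_right, symmetric]
    by (rule deriv_within_cong[OF _ p]) (rule linear_scale[OF l])
qed

text \<open>In contrast to \<open>lc_deriv\<close>, only the direction at \<open>p\<close> is an
  argument, so the dependence on it is a matter of linear algebra.\<close>

definition nab :: "'a::euclidean_space set \<Rightarrow> ('a \<Rightarrow> 'a \<Rightarrow> 'a \<Rightarrow> real) \<Rightarrow> 'a \<Rightarrow> 'a \<Rightarrow> ('a \<Rightarrow> 'a) \<Rightarrow> 'a" where
  "nab S g p x W = deriv_within S W p x + christoffel S g p x (W p)"

lemma lc_deriv_nab: "lc_deriv S g X Y = (\<lambda>p. nab S g p (X p) Y)"
  by (simp add: lc_deriv_def nab_def fun_eq_iff)

text \<open>The tensor \<open>\<nabla>q\<close> evaluated on vectors by means of constant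
  extensions; \<open>deriv_tensor\<close> recovers the product rule for arbitrary fields.\<close>

definition nabq :: "'a::euclidean_space set \<Rightarrow> ('a \<Rightarrow> 'a \<Rightarrow> 'a \<Rightarrow> real) \<Rightarrow> ('a \<Rightarrow> 'a \<Rightarrow> 'a \<Rightarrow> real) \<Rightarrow>
    'a \<Rightarrow> 'a \<Rightarrow> 'a \<Rightarrow> 'a \<Rightarrow> real" where
  "nabq S g q p x y z = deriv_within S (\<lambda>r. q r y z) p x - q p (christoffel S g p x y) z - q p y (christoffel S g p x z)"

text \<open>The classical coordinate expression of the curvature operator. It contains no
  derivatives of \<open>x\<close>, \<open>y\<close>, \<open>z\<close>, so tensoriality is visible
  from its form.\<close>

definition curv :: "'a::euclidean_space set \<Rightarrow> ('a \<Rightarrow> 'a \<Rightarrow> 'a \<Rightarrow> real) \<Rightarrow> 'a \<Rightarrow> 'a \<Rightarrow> 'a \<Rightarrow> 'a \<Rightarrow> 'a" where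
  "curv S g p x y z = deriv_within S (\<lambda>r. christoffel S g r y z) p x - deriv_within S (\<lambda>r. christoffel S g r x z) p y
     + christoffel S g p x (christoffel S g p y z) - christoffel S g p y (christoffel S g p x z)"

section \<open>Smooth Riemannian metrics on admissible sets\<close>

locale metric_field =
  fixes S :: "'a::euclidean_space set" and g :: "'a \<Rightarrow> 'a \<Rightarrow> 'a \<Rightarrow> real"
  assumes adm: "admissible S" and g_form: "form_field S g"
    and g_ip: "\<And>p. p \<in> S \<Longrightarrow> inner_product (g p)"
begin

abbreviation Gam where "Gam \<equiv> christoffel S g"
abbreviation D where "D p x W \<equiv> nab S g p x W"
abbreviation Rm where "Rm p x y z w \<equiv> riemann_at S g p x y z w"

lemmas gb = bilinear_simps[OF inner_productD(1)[OF g_ip]]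
lemmas g_sym = inner_productD(2)[OF g_ip]

lemma smooth_g: "smooth_on S V \<Longrightarrow> smooth_on S W \<Longrightarrow> smooth_on S (\<lambda>p. g p (V p) (W p))"
  by (rule smooth_on_form[OF adm g_form])

lemma smooth_gram_schmidt:
  assumes X: "\<And>k. k < n \<Longrightarrow> smooth_on S (X k)"
    and ind: "\<And>p k. p \<in> S \<Longrightarrow> k < n \<Longrightarrow> X k p \<notin> span ((\<lambda>j. X j p) ` {..<k})"
  shows "k < n \<Longrightarrow> smooth_on S (\<lambda>p. gram_schmidt (g p) (\<lambda>j. X j p) k)"
proof (induction k rule: less_induct)
  case (less k)
  let ?E = "\<lambda>p. gram_schmidt (g p) (\<lambda>j. X j p)"
  let ?v = "\<lambda>p. X k p - (\<Sum>j<k. g p (X k p) (?E p j) *\<^sub>R ?E p j)"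
  have E: "smooth_on S (\<lambda>p. ?E p j)" if "j \<in> {..<k}" for j using less that by simp
  have v: "smooth_on S ?v"
    by (intro smooth_on_diff smooth_on_sum smooth_on_scaleR adm smooth_g X less.prems E finite_lessThan)
  have "g p (?v p) (?v p) > 0" if "p \<in> S" for p
    using gram_schmidt(4)[OF g_ip[OF that] ind[OF that] less.prems refl] .
  then have "smooth_on S (\<lambda>p. inverse (sqrt (g p (?v p) (?v p))) *\<^sub>R ?v p)"
    by (intro smooth_on_scaleR smooth_on_inverse smooth_on_sqrt smooth_g v adm) force+
  moreover have "?E p k = inverse (sqrt (g p (?v p) (?v p))) *\<^sub>R ?v p" for p
    by (subst gram_schmidt.simps) (simp add: Let_def)
  ultimately show ?case by simp
qed

text \<open>Christoffel symbols of the first kind, that is, the Koszul formula for constant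
  fields.\<close>

definition kos where
  "kos p u v w = (deriv_within S (\<lambda>x. g x v w) p u + deriv_within S (\<lambda>x. g x u w) p v
       - deriv_within S (\<lambda>x. g x u v) p w) / 2"

lemma linear_dg: "p \<in> S \<Longrightarrow> linear (\<lambda>u. deriv_within S (\<lambda>x. g x v w) p u)"
  by (rule deriv_within_linear[OF form_fieldD(1)[OF g_form]])

lemma bilinear_dg: "p \<in> S \<Longrightarrow> bilinear (\<lambda>v w. deriv_within S (\<lambda>x. g x v w) p u)"
  by (rule deriv_within_bilinear[OF adm form_fieldD(1,2)[OF g_form]])

lemma linear_kos:
  assumes "p \<in> S"
  shows "linear (\<lambda>w. kos p u v w)" "linear (\<lambda>v. kos p u v w)" "linear (\<lambda>u. kos p u v w)"
proof -
  note l = linear_add[OF linear_dg[OF assms]] linear_scale[OF linear_dg[OF assms]]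
    bilinear_simps(1,2,7,8)[OF bilinear_dg[OF assms]]
  show "linear (\<lambda>w. kos p u v w)" "linear (\<lambda>v. kos p u v w)" "linear (\<lambda>u. kos p u v w)"
    by (auto intro!: linearI simp: kos_def l field_simps)
qed

lemma g_Gam: "p \<in> S \<Longrightarrow> g p (Gam p u v) w = kos p u v w"
  unfolding christoffel_def kos_def[symmetric] by (rule sharp_prop[OF g_ip linear_kos(1)])

lemma kos_sym:
  assumes "p \<in> S" shows "kos p u v w = kos p v u w"
proof -
  have "deriv_within S (\<lambda>x. g x u v) p w = deriv_within S (\<lambda>x. g x v u) p w"
    by (rule deriv_within_cong[OF _ assms]) (rule g_sym)
  then show ?thesis by (simp add: kos_def)
qed

lemma kos_metric:
  assumes "p \<in> S" shows "kos p u v w + kos p u w v = deriv_within S (\<lambda>x. g x v w) p u"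
proof -
  have "deriv_within S (\<lambda>x. g x w v) p u = deriv_within S (\<lambda>x. g x v w) p u"
    by (rule deriv_within_cong[OF _ assms]) (rule g_sym)
  then show ?thesis by (simp add: kos_def field_simps)
qed

lemma Gam_sym: "p \<in> S \<Longrightarrow> Gam p u v = Gam p v u"
  by (rule inner_product_ext[OF g_ip], assumption, simp only: g_Gam, rule kos_sym)

lemma bilinear_Gam: 
  assumes p: "p \<in> S" shows "bilinear (Gam p)"
  unfolding bilinear_def
proof (intro conjI allI linearI; rule inner_product_ext[OF g_ip[OF p]])
  note k = linear_add[OF linear_kos(2)[OF p]] linear_add[OF linear_kos(3)[OF p]]
    linear_scale[OF linear_kos(2)[OF p]] linear_scale[OF linear_kos(3)[OF p]]
  fix x y z w :: 'a and c :: real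
  show "g p (Gam p x (y + z)) w = g p (Gam p x y + Gam p x z) w"
    "g p (Gam p (y + z) x) w = g p (Gam p y x + Gam p z x) w"
    "g p (Gam p x (c *\<^sub>R y)) w = g p (c *\<^sub>R Gam p x y) w"
    "g p (Gam p (c *\<^sub>R y) x) w = g p (c *\<^sub>R Gam p y x) w"
    by (simp_all add: gb[OF p] g_Gam[OF p] k)
qed

lemmas Gamb = bilinear_simps[OF bilinear_Gam]

lemma linear_Gam: "p \<in> S \<Longrightarrow> linear (Gam p u)" "p \<in> S \<Longrightarrow> linear (\<lambda>u. Gam p u v)"
  using bilinear_Gam by (auto simp: bilinear_def)

text \<open>An auxiliary global frame. \<open>sharp\<close> is a definite description, from which
  smoothness cannot be read off; in a smooth orthonormal frame it becomes an explicit sum.\<close>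

definition std :: "nat \<Rightarrow> 'a \<Rightarrow> 'a" where
  "std a p = gram_schmidt (g p) basis_enum a"

lemma smooth_std: "a < DIM('a) \<Longrightarrow> smooth_on S (std a)"
  using smooth_gram_schmidt[of "DIM('a)" "\<lambda>k _. basis_enum k" a] smooth_on_const[OF adm]
    basis_enum_independent unfolding std_def[abs_def] by blast

lemma smooth_kos: "smooth_on S (\<lambda>p. kos p u v w)"
proof -
  have "smooth_on S (\<lambda>p. (1/2) * ((deriv_within S (\<lambda>x. g x v w) p u + deriv_within S (\<lambda>x. g x u w) p v)
       - deriv_within S (\<lambda>x. g x u v) p w))"
    by (intro smooth_on_mult smooth_on_const smooth_on_diff smooth_on_add smooth_on_deriv_within form_fieldD(1)[OF g_form] adm)
  then show ?thesis by (simp add: kos_def)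
qed

lemma smooth_Gam_const: "smooth_on S (\<lambda>p. Gam p u v)"
proof -
  have "Gam p u v = (\<Sum>a<DIM('a). kos p u v (std a p) *\<^sub>R std a p)" if "p \<in> S" for p
    unfolding christoffel_def kos_def[symmetric] std_def
    by (rule sharp_frame[OF g_ip[OF that] exists_orthonormal[OF g_ip[OF that]] linear_kos(1)[OF that]])
  moreover have "smooth_on S (\<lambda>p. \<Sum>a<DIM('a). kos p u v (std a p) *\<^sub>R std a p)"
    using smooth_on_linear_family[where L = "\<lambda>p. kos p u v", OF adm smooth_kos linear_kos(1) smooth_std]
    by (intro smooth_on_sum smooth_on_scaleR adm smooth_std finite_lessThan) auto
  ultimately show ?thesis by (rule smooth_on_cong[THEN iffD2])
qed

lemma smooth_Gam:
  assumes "smooth_on S V" "smooth_on S W" shows "smooth_on S (\<lambda>p. Gam p (V p) (W p))"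
proof (rule smooth_on_linear_family[where L = "\<lambda>p. Gam p (V p)", OF adm _ linear_Gam(1) assms(2)])
  show "smooth_on S (\<lambda>p. Gam p (V p) w)" for w
    by (rule smooth_on_linear_family[where L = "\<lambda>p v. Gam p v w", OF adm smooth_Gam_const linear_Gam(2) assms(1)])
qed

lemma deriv_Gam:
  assumes p: "p \<in> S" and V: "smooth_on S V" and W: "smooth_on S W"
  shows "deriv_within S (\<lambda>x. Gam x (V x) (W x)) p u = deriv_within S (\<lambda>x. Gam x (V p) (W p)) p u
    + Gam p (deriv_within S V p u) (W p) + Gam p (V p) (deriv_within S W p u)"
proof -
  have "deriv_within S (\<lambda>x. Gam x (V x) (W x)) p u = deriv_within S (\<lambda>x. Gam x (V x) (W p)) p u + Gam p (V p) (deriv_within S W p u)"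
    by (rule deriv_within_linear_family[where L = "\<lambda>p. Gam p (V p)",
          OF adm p smooth_Gam[OF V smooth_on_const[OF adm]] linear_Gam(1) W])
  also have "deriv_within S (\<lambda>x. Gam x (V x) (W p)) p u = deriv_within S (\<lambda>x. Gam x (V p) (W p)) p u + Gam p (deriv_within S V p u) (W p)"
    by (rule deriv_within_linear_family[where L = "\<lambda>x v. Gam x v (W p)", OF adm p smooth_Gam_const linear_Gam(2) V])
  finally show ?thesis by simp
qed

lemma smooth_D: "smooth_on S X \<Longrightarrow> smooth_on S W \<Longrightarrow> smooth_on S (\<lambda>p. D p (X p) W)"
  unfolding nab_def by (intro smooth_on_add smooth_on_deriv_within_field smooth_Gam adm)

lemma linear_D: 
  assumes "p \<in> S" "smooth_on S W" shows "linear (\<lambda>x. D p x W)"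
proof -
  note l = deriv_within_linear[OF assms(2,1)]
  show ?thesis by (rule linearI) (simp_all add: nab_def Gamb[OF assms(1)] linear_add[OF l] linear_scale[OF l] scaleR_add_right)
qed

lemma D_diff: "p \<in> S \<Longrightarrow> smooth_on S V \<Longrightarrow> smooth_on S W \<Longrightarrow> D p x (\<lambda>p. V p - W p) = D p x V - D p x W"
  by (simp add: nab_def Gamb deriv_within_diff adm)

lemma D_scaleR: "p \<in> S \<Longrightarrow> smooth_on S f \<Longrightarrow> smooth_on S W \<Longrightarrow>
    D p x (\<lambda>p. f p *\<^sub>R W p) = deriv_within S f p x *\<^sub>R W p + f p *\<^sub>R D p x W"
  by (simp add: nab_def Gamb deriv_within_scaleR adm scaleR_add_right)

lemma D_sum: 
  assumes "p \<in> S" "finite I" "\<And>i. i \<in> I \<Longrightarrow> smooth_on S (V i)"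
  shows "D p x (\<lambda>p. \<Sum>i\<in>I. V i p) = (\<Sum>i\<in>I. D p x (V i))"
  by (simp add: nab_def Gamb[OF assms(1)] deriv_within_sum[OF adm assms] sum.distrib)

lemma D_cong: "p \<in> S \<Longrightarrow> (\<And>x. x \<in> S \<Longrightarrow> V x = W x) \<Longrightarrow> D p x V = D p x W"
  using deriv_within_cong[of S V W p x] by (simp add: nab_def)

lemma metric_compat:
  assumes p: "p \<in> S" and V: "smooth_on S V" and W: "smooth_on S W"
  shows "deriv_within S (\<lambda>x. g x (V x) (W x)) p u = g p (D p u V) (W p) + g p (V p) (D p u W)"
proof -
  have "deriv_within S (\<lambda>x. g x (V p) (W p)) p u = g p (Gam p u (V p)) (W p) + g p (V p) (Gam p u (W p))"
    unfolding g_sym[OF p, of "V p"] g_Gam[OF p] kos_metric[OF p] ..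
  then show ?thesis
    by (simp add: deriv_within_form[OF adm p g_form V W] nab_def gb[OF p])
qed

lemma torsion_free:
  "p \<in> S \<Longrightarrow> D p (X p) Y - D p (Y p) X = lie_bracket S X Y p"
  by (simp add: nab_def lie_bracket_def Gam_sym[of p "Y p" "X p"])

section \<open>Curvature and its symmetries\<close>

lemma D_D:
  assumes p: "p \<in> S" and Y: "smooth_on S Y" and Z: "smooth_on S Z"
  shows "D p x (\<lambda>r. D r (Y r) Z) =
     deriv_within S (\<lambda>r. deriv_within S Z r (Y p)) p x + deriv_within S Z p (deriv_within S Y p x)
     + (deriv_within S (\<lambda>r. Gam r (Y p) (Z p)) p x + Gam p (deriv_within S Y p x) (Z p) + Gam p (Y p) (deriv_within S Z p x))
     + Gam p x (deriv_within S Z p (Y p)) + Gam p x (Gam p (Y p) (Z p))"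
proof -
  have "deriv_within S (\<lambda>r. D r (Y r) Z) p x =
      deriv_within S (\<lambda>r. deriv_within S Z r (Y r)) p x + deriv_within S (\<lambda>r. Gam r (Y r) (Z r)) p x"
    unfolding nab_def by (intro deriv_within_add adm p smooth_on_deriv_within_field smooth_Gam Y Z)
  also have "deriv_within S (\<lambda>r. deriv_within S Z r (Y r)) p x =
      deriv_within S (\<lambda>r. deriv_within S Z r (Y p)) p x + deriv_within S Z p (deriv_within S Y p x)"
    by (rule deriv_within_linear_family[where L = "\<lambda>r v. deriv_within S Z r v",
          OF adm p smooth_on_deriv_within[OF Z] deriv_within_linear[OF Z] Y])
  finally show ?thesis
    by (simp add: nab_def[of S g p x "\<lambda>r. D r (Y r) Z"] nab_def[of S g p "Y p" Z] deriv_Gam[OF p Y Z] Gamb[OF p])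
qed

text \<open>Second derivatives of \<open>Z\<close> cancel by symmetry and the first derivatives of
  \<open>X\<close> and \<open>Y\<close> are absorbed by the bracket, which leaves the Christoffel
  expression.\<close>

lemma curvature_identity:
  assumes p: "p \<in> S" and X: "smooth_on S X" and Y: "smooth_on S Y" and Z: "smooth_on S Z"
  shows "D p (X p) (\<lambda>r. D r (Y r) Z) - D p (Y p) (\<lambda>r. D r (X r) Z) - D p (lie_bracket S X Y p) Z = curv S g p (X p) (Y p) (Z p)"
proof -
  have c: "deriv_within S (\<lambda>r. deriv_within S Z r (Y p)) p (X p) = deriv_within S (\<lambda>r. deriv_within S Z r (X p)) p (Y p)"
    by (rule deriv_within_commute[OF adm Z p])
  note l = linear_diff[OF deriv_within_linear[OF Z p]]
  show ?thesis
    unfolding D_D[OF p Y Z] D_D[OF p X Z] c lie_bracket_def curv_def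
    unfolding nab_def l Gamb[OF p]
    by (simp add: algebra_simps)
qed

lemma riemann_eq:
  assumes "p \<in> S" "smooth_on S X" "smooth_on S Y" "smooth_on S Z"
  shows "riemann S g X Y Z W p = g p (curv S g p (X p) (Y p) (Z p)) (W p)"
  unfolding riemann_def lc_deriv_nab curvature_identity[OF assms, symmetric] by (simp add: gb[OF assms(1)])

lemma Rm_curv: "p \<in> S \<Longrightarrow> Rm p x y z w = g p (curv S g p x y z) w"
  unfolding riemann_at_def by (rule riemann_eq[OF _ smooth_on_const smooth_on_const smooth_on_const]) (auto simp: adm)

lemma riemann_tensorial:
  assumes "p \<in> S" "smooth_on S X" "smooth_on S Y" "smooth_on S Z"
  shows "riemann S g X Y Z W p = Rm p (X p) (Y p) (Z p) (W p)"
  unfolding riemann_eq[OF assms] Rm_curv[OF assms(1)] ..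

lemma bilinear_dGam: "p \<in> S \<Longrightarrow> bilinear (\<lambda>v w. deriv_within S (\<lambda>x. Gam x v w) p u)"
  by (rule deriv_within_bilinear[OF adm smooth_Gam_const bilinear_Gam])

lemma linear_Rm:
  assumes p: "p \<in> S"
  shows "linear (\<lambda>x. Rm p x y z w)" "linear (\<lambda>y. Rm p x y z w)" "linear (\<lambda>z. Rm p x y z w)" "linear (\<lambda>w. Rm p x y z w)"
proof -
  note l = bilinear_simps[OF bilinear_dGam[OF p]] Gamb[OF p]
    linear_add[OF deriv_within_linear[OF smooth_Gam_const p]] linear_scale[OF deriv_within_linear[OF smooth_Gam_const p]]
  show "linear (\<lambda>x. Rm p x y z w)" "linear (\<lambda>y. Rm p x y z w)" "linear (\<lambda>z. Rm p x y z w)" "linear (\<lambda>w. Rm p x y z w)"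
    by (rule linearI; simp add: Rm_curv[OF p] curv_def l gb[OF p] algebra_simps)+
qed

text \<open>Metric compatibility trades the outer covariant derivatives for derivatives of scalar
  functions. In this form the curvatures of the ambient space and of a leaf can be compared term by
  term.\<close>

lemma Rm_via_metric:
  assumes p: "p \<in> S" and sm: "smooth_on S X" "smooth_on S Y" "smooth_on S Z" "smooth_on S W"
  shows "Rm p (X p) (Y p) (Z p) (W p) =
      deriv_within S (\<lambda>r. g r (D r (Y r) Z) (W r)) p (X p) - g p (D p (Y p) Z) (D p (X p) W)
    - deriv_within S (\<lambda>r. g r (D r (X r) Z) (W r)) p (Y p) + g p (D p (X p) Z) (D p (Y p) W)
    - g p (D p (lie_bracket S X Y p) Z) (W p)"
  unfolding Rm_curv[OF p] curvature_identity[OF p sm(1-3), symmetric]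
    metric_compat[OF p smooth_D[OF sm(2,3)] sm(4)] metric_compat[OF p smooth_D[OF sm(1,3)] sm(4)]
  by (simp add: gb[OF p])

lemma Rm_const:
  assumes p: "p \<in> S"
  shows "Rm p x y z w =
      deriv_within S (\<lambda>r. g r (Gam r y z) w) p x - g p (Gam p y z) (Gam p x w)
    - deriv_within S (\<lambda>r. g r (Gam r x z) w) p y + g p (Gam p x z) (Gam p y w)"
proof -
  have "D r v (\<lambda>_. u) = Gam r v u" if "r \<in> S" for r v u using that by (simp add: nab_def adm)
  then have e: "deriv_within S (\<lambda>r. g r (D r v (\<lambda>_. u)) w) p u' = deriv_within S (\<lambda>r. g r (Gam r v u) w) p u'" for v u w u'
    by (intro deriv_within_cong[OF _ p]) simp
  show ?thesis
    using Rm_via_metric[OF p smooth_on_const[OF adm, of x] smooth_on_const[OF adm, of y] smooth_on_const[OF adm, of z] smooth_on_const[OF adm, of w]]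
    unfolding e by (simp add: p nab_def adm lie_bracket_def Gamb[OF p] gb[OF p])
qed

lemma Rm_antisym1: "p \<in> S \<Longrightarrow> Rm p x y z w = - Rm p y x z w"
  by (simp add: Rm_const)

text \<open>When both sides are added, the products of Christoffel symbols cancel and a second
  derivative of \<open>g r z w\<close>, antisymmetrized in \<open>x\<close> and \<open>y\<close>,
  remains; it vanishes.\<close>

lemma Rm_antisym2:
  assumes p: "p \<in> S" shows "Rm p x y z w = - Rm p x y w z"
proof -
  have "deriv_within S (\<lambda>r. g r (Gam r y z) w) p x + deriv_within S (\<lambda>r. g r (Gam r y w) z) p x
      = deriv_within S (\<lambda>r. deriv_within S (\<lambda>x. g x z w) r y) p x" for x y
  proof -
    have "deriv_within S (\<lambda>r. g r (Gam r y z) w) p x + deriv_within S (\<lambda>r. g r (Gam r y w) z) p x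
      = deriv_within S (\<lambda>r. g r (Gam r y z) w + g r (Gam r y w) z) p x"
      by (intro deriv_within_add[symmetric] adm p smooth_g smooth_Gam_const smooth_on_const)
    also have "\<dots> = deriv_within S (\<lambda>r. deriv_within S (\<lambda>x. g x z w) r y) p x"
      by (rule deriv_within_cong[OF _ p]) (simp add: g_Gam kos_metric)
    finally show ?thesis .
  qed
  from this[of y x] this[of x y] deriv_within_commute_real[OF adm form_fieldD(1)[OF g_form] p, of z w y x]
  show ?thesis
    unfolding Rm_const[OF p] g_sym[OF p, of "Gam p y w" "Gam p x z"] g_sym[OF p, of "Gam p x w" "Gam p y z"] by simp
qed

lemma Rm_bianchi:
  assumes p: "p \<in> S" shows "Rm p x y z w + Rm p y z x w + Rm p z x y w = 0"
proof -
  have s: "deriv_within S (\<lambda>r. Gam r u v) p x = deriv_within S (\<lambda>r. Gam r v u) p x" for u v x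
    by (rule deriv_within_cong[OF _ p]) (rule Gam_sym)
  have "curv S g p x y z + curv S g p y z x + curv S g p z x y = 0"
    unfolding curv_def s[of y x] s[of z x] s[of z y] Gam_sym[OF p, of y x] Gam_sym[OF p, of z x] Gam_sym[OF p, of z y]
    by simp
  then show ?thesis by (simp add: Rm_curv[OF p] gb[OF p] flip: gb(1)[OF p])
qed

text \<open>The octahedron argument: four Bianchi identities combined with the two
  antisymmetries.\<close>

lemma Rm_pair:
  assumes p: "p \<in> S" shows "Rm p x y z w = Rm p z w x y"
proof -
  note b = Rm_bianchi[OF p] and a1 = Rm_antisym1[OF p] and a2 = Rm_antisym2[OF p]
  have "Rm p x y z w + Rm p y z x w + Rm p z x y w = 0" by (rule b)
  moreover have "Rm p y z w x + Rm p z w y x + Rm p w y z x = 0" by (rule b)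
  moreover have "Rm p z w x y + Rm p w x z y + Rm p x z w y = 0" by (rule b)
  moreover have "Rm p w x y z + Rm p x y w z + Rm p y w x z = 0" by (rule b)
  moreover have "Rm p y z w x = - Rm p y z x w" "Rm p z w y x = - Rm p z w x y" "Rm p x y w z = - Rm p x y z w"
    "Rm p w x z y = - Rm p w x y z" by (rule a2)+
  moreover have "Rm p x z w y = Rm p z x y w" "Rm p y w x z = Rm p w y z x"
    using a1[of x z w y] a2[of z x w y] a1[of y w x z] a2[of w y x z] by auto
  ultimately show ?thesis by linarith
qed

lemma deriv_tensor:
  assumes p: "p \<in> S" and q: "form_field S q" and V: "smooth_on S V" and W: "smooth_on S W"
  shows "deriv_within S (\<lambda>x. q x (V x) (W x)) p u =
     nabq S g q p u (V p) (W p) + q p (D p u V) (W p) + q p (V p) (D p u W)"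
  by (simp add: deriv_within_form[OF adm p q V W] nabq_def nab_def bilinear_simps[OF form_fieldD(2)[OF q p]])

lemma cov_deriv2_eq:
  assumes "p \<in> S" "form_field S q" "smooth_on S Y" "smooth_on S Z"
  shows "cov_deriv2 S g q X Y Z p = nabq S g q p (X p) (Y p) (Z p)"
  by (simp add: cov_deriv2_def lc_deriv_nab deriv_tensor[OF assms])

lemma linear_nabq:
  assumes p: "p \<in> S" and q: "form_field S q"
  shows "linear (\<lambda>x. nabq S g q p x y z)" "linear (\<lambda>y. nabq S g q p x y z)" "linear (\<lambda>z. nabq S g q p x y z)"
proof -
  note l = bilinear_simps[OF deriv_within_bilinear[OF adm form_fieldD(1,2)[OF q] p]] Gamb[OF p]
    linear_add[OF deriv_within_linear[OF form_fieldD(1)[OF q] p]] linear_scale[OF deriv_within_linear[OF form_fieldD(1)[OF q] p]]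
    bilinear_simps[OF form_fieldD(2)[OF q p]]
  show "linear (\<lambda>x. nabq S g q p x y z)" "linear (\<lambda>y. nabq S g q p x y z)" "linear (\<lambda>z. nabq S g q p x y z)"
    by (rule linearI; simp add: nabq_def l algebra_simps)+
qed

lemma nabq_sym:
  assumes p: "p \<in> S" and q: "\<And>p u v. p \<in> S \<Longrightarrow> q p u v = q p v u"
  shows "nabq S g q p x y z = nabq S g q p x z y"
proof -
  have "deriv_within S (\<lambda>r. q r y z) p x = deriv_within S (\<lambda>r. q r z y) p x"
    by (rule deriv_within_cong[OF _ p]) (rule q)
  then show ?thesis using q[OF p, of "Gam p x y" z] q[OF p, of "Gam p x z" y] by (simp add: nabq_def)
qed

end

section \<open>The divergence theorem on the torus\<close>

text \<open>Periodicity moves the slice of the shifted cube that sticks out beyond the face at 1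
  back to the face at 0.\<close>

lemma integral_cube_shift:
  fixes h :: "'a::euclidean_space \<Rightarrow> real"
  assumes h: "continuous_on UNIV h" and per: "\<And>x. h (x + b) = h x" and b: "b \<in> Basis" and s: "s \<in> {0..1}"
  shows "integral (cbox 0 One) (\<lambda>x. h (x + s *\<^sub>R b)) = integral (cbox 0 One) h"
proof -
  \<comment> \<open>The unit cube with its side in direction \<open>b\<close> replaced by the
    interval from \<open>c\<close> to \<open>d\<close>.\<close>
  define B where "B = (\<lambda>c d. cbox (c *\<^sub>R b) (One + (d - 1) *\<^sub>R b))"
  have int: "h integrable_on cbox u v" for u v
    using h by (intro integrable_continuous) (auto intro: continuous_on_subset)
  have split: "integral (B c d) h = integral (B c e) h + integral (B e d) h" if "c \<le> e" "e \<le> d" for c d e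
  proof -
    have comp: "(c *\<^sub>R b) \<bullet> i = (if i = b then c else 0)" "(One + (d - 1) *\<^sub>R b) \<bullet> i = (if i = b then d else 1)"
      if "i \<in> Basis" for i c d
      using that b by (auto simp: inner_add_left inner_Basis)
    have mem: "x \<in> B c d \<longleftrightarrow> (c \<le> x \<bullet> b \<and> x \<bullet> b \<le> d) \<and> (\<forall>i\<in>Basis - {b}. 0 \<le> x \<bullet> i \<and> x \<bullet> i \<le> 1)" for x c d
    proof -
      have "x \<in> B c d \<longleftrightarrow> (\<forall>i\<in>Basis. (if i = b then c else 0) \<le> x \<bullet> i \<and> x \<bullet> i \<le> (if i = b then d else 1))"
        unfolding B_def mem_box by (intro ball_cong refl) (simp only: comp)
      also have "\<dots> \<longleftrightarrow> (c \<le> x \<bullet> b \<and> x \<bullet> b \<le> d) \<and> (\<forall>i\<in>Basis - {b}. 0 \<le> x \<bullet> i \<and> x \<bullet> i \<le> 1)"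
        using b by (auto split: if_splits)
      finally show ?thesis .
    qed
    have "B c d \<inter> {x. x \<bullet> b \<le> e} = B c e" "B c d \<inter> {x. x \<bullet> b \<ge> e} = B e d"
      using that by (auto simp: mem)
    then show ?thesis
      using integral_split[OF int b, of "c *\<^sub>R b" "One + (d - 1) *\<^sub>R b" e] unfolding B_def by simp
  qed
  have "integral (B 1 (1 + s)) h = integral (B 0 s) (h \<circ> (+) b)"
    unfolding integral_shift_cbox_plus B_def by (simp add: algebra_simps)
  also have "h \<circ> (+) b = h" using per by (auto simp: add.commute)
  finally have "integral (B s (1 + s)) h = integral (B 0 1) h"
    using split[of 0 1 "1 + s"] split[of 0 s "1 + s"] s by simp
  moreover have "integral (B s (1 + s)) h = integral (B 0 1) (h \<circ> (+) (s *\<^sub>R b))"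
    unfolding integral_shift_cbox_plus B_def by (simp add: algebra_simps)
  ultimately show ?thesis by (simp add: B_def o_def add.commute)
qed

text \<open>Averaging over all shifts along \<open>b\<close> leaves the integral unchanged.
  Interchanging the two integrations then allows the fundamental theorem of calculus on each unit
  segment, where periodicity gives 0, without splitting off a coordinate of the cube.\<close>

lemma integral_cube_deriv:
  fixes f :: "'a::euclidean_space \<Rightarrow> real"
  assumes f: "smooth_on UNIV f" and per: "\<And>x. f (x + b) = f x" and b: "b \<in> Basis"
  shows "integral (cbox 0 One) (\<lambda>x. deriv_within UNIV f x b) = 0"
proof -
  let ?d = "\<lambda>x. deriv_within UNIV f x b"
  have d: "continuous_on UNIV ?d" by (rule smooth_on_imp_continuous_on[OF smooth_on_deriv_within[OF f]])
  have dper: "?d (x + b) = ?d x" for x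
  proof -
    have "deriv_within UNIV (\<lambda>x. f (x + b)) x b = deriv_within UNIV f (x + b) (deriv_within UNIV (\<lambda>x. x + b) x b)"
      by (rule deriv_within_compose[where T = UNIV]) (auto intro!: smooth_on_add smooth_on_const smooth_on_ident admissible_UNIV f)
    moreover have "((\<lambda>x. x + b) has_derivative (\<lambda>v. v)) (at x within UNIV)" by (auto intro!: derivative_eq_intros)
    then have "deriv_within UNIV (\<lambda>x. x + b) x b = b"
      by (simp add: deriv_within_eqI[OF admissible_UNIV UNIV_I])
    ultimately show ?thesis by (simp add: per)
  qed
  have line: "integral {0..1} (\<lambda>s. ?d (x + s *\<^sub>R b)) = 0" for x
  proof -
    have "((\<lambda>s. ?d (x + s *\<^sub>R b)) has_integral f (x + 1 *\<^sub>R b) - f (x + 0 *\<^sub>R b)) {0..1}"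
    proof (rule fundamental_theorem_of_calculus)
      fix s :: real
      have "((\<lambda>s. x + s *\<^sub>R b) has_derivative (\<lambda>t. t *\<^sub>R b)) (at s within {0..1})"
        by (auto intro!: derivative_eq_intros)
      moreover have "(f has_derivative (\<lambda>v. deriv_within UNIV f (x + s *\<^sub>R b) v)) (at (x + s *\<^sub>R b) within (\<lambda>s. x + s *\<^sub>R b) ` {0..1})"
        by (rule has_derivative_subset[OF smooth_on_has_derivative[OF f]]) auto
      ultimately have "((\<lambda>s. f (x + s *\<^sub>R b)) has_derivative (\<lambda>t. deriv_within UNIV f (x + s *\<^sub>R b) (t *\<^sub>R b))) (at s within {0..1})"
        by (rule has_derivative_in_compose)
      then show "((\<lambda>s. f (x + s *\<^sub>R b)) has_vector_derivative ?d (x + s *\<^sub>R b)) (at s within {0..1})"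
        unfolding has_vector_derivative_def by (simp add: linear_scale[OF deriv_within_linear[OF f UNIV_I]])
    qed simp
    then show ?thesis by (simp add: per integral_unique)
  qed
  have "integral {0..1::real} (\<lambda>s. integral (cbox 0 One) (\<lambda>x. ?d (x + s *\<^sub>R b))) =
      integral {0..1::real} (\<lambda>s. integral (cbox 0 One) ?d)"
    by (rule integral_cong) (rule integral_cube_shift[OF d dper b])
  moreover have "integral (cbox 0 1 :: real set) (\<lambda>s. integral (cbox 0 One) (\<lambda>x. ?d (x + s *\<^sub>R b))) =
      integral (cbox 0 One) (\<lambda>x. integral (cbox 0 1 :: real set) (\<lambda>s. ?d (x + s *\<^sub>R b)))"
    by (rule integral_swap_continuous) (auto simp: case_prod_unfold intro!: continuous_on_compose2[OF d] continuous_intros)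
  ultimately show ?thesis by (simp add: line)
qed

text \<open>The divergence of a periodic field integrates to 0 over the unit cube, and a nonnegative
  continuous function with zero integral vanishes.\<close>

theorem torus_divergence:
  fixes W :: "'a::euclidean_space \<Rightarrow> 'a"
  assumes W: "smooth_on UNIV W" and per: "\<And>x b. b \<in> Basis \<Longrightarrow> W (x + b) = W x"
    and nonneg: "\<And>x. (\<Sum>b\<in>Basis. deriv_within UNIV (\<lambda>x. W x \<bullet> b) x b) \<ge> 0"
  shows "(\<Sum>b\<in>Basis. deriv_within UNIV (\<lambda>x. W x \<bullet> b) x b) = 0"
proof -
  \<comment> \<open>Translation by \<open>x\<close> reduces the claim to the origin, which lies in
    the cube.\<close>
  let ?T = "\<lambda>y. y + x"
  let ?V = "\<lambda>y. W (?T y)"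
  let ?div = "\<lambda>y. \<Sum>b\<in>Basis. deriv_within UNIV (\<lambda>y. ?V y \<bullet> b) y b"
  have T: "smooth_on UNIV ?T" by (intro smooth_on_add smooth_on_ident smooth_on_const admissible_UNIV)
  have V: "smooth_on UNIV (\<lambda>y. ?V y \<bullet> b)" for b
    by (intro smooth_on_inner admissible_UNIV, rule smooth_on_compose[OF admissible_UNIV _ T W]) auto
  have chain: "deriv_within UNIV (\<lambda>y. ?V y \<bullet> b) y b = deriv_within UNIV (\<lambda>x. W x \<bullet> b) (y + x) b" for y b
  proof -
    have "deriv_within UNIV (\<lambda>y. ?V y \<bullet> b) y b = deriv_within UNIV (\<lambda>x. W x \<bullet> b) (?T y) (deriv_within UNIV ?T y b)"
      by (rule deriv_within_compose[where F = ?T and T = UNIV and f = "\<lambda>x. W x \<bullet> b"]) 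
        (simp_all add: T smooth_on_inner[OF admissible_UNIV W] admissible_UNIV)
    moreover have "(?T has_derivative (\<lambda>v. v)) (at y within UNIV)" by (auto intro!: derivative_eq_intros)
    then have "deriv_within UNIV ?T y b = b"
      by (simp add: deriv_within_eqI[OF admissible_UNIV UNIV_I])
    ultimately show ?thesis by simp
  qed
  have c: "continuous_on A (\<lambda>y. deriv_within UNIV (\<lambda>y. ?V y \<bullet> b) y b)" for A b
    by (rule continuous_on_subset[OF smooth_on_imp_continuous_on[OF smooth_on_deriv_within[OF V]]]) auto
  have int: "(\<lambda>y. deriv_within UNIV (\<lambda>y. ?V y \<bullet> b) y b) integrable_on cbox u v" for u v b
    by (rule integrable_continuous[OF c])
  have "integral (cbox 0 One) ?div = (\<Sum>b\<in>Basis. integral (cbox 0 One) (\<lambda>y. deriv_within UNIV (\<lambda>y. ?V y \<bullet> b) y b))"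
    by (rule integral_sum[OF finite_Basis int])
  also have "\<dots> = 0"
  proof (rule sum.neutral, rule ballI)
    fix b :: 'a assume b: "b \<in> Basis"
    have "?V (y + b) \<bullet> b = ?V y \<bullet> b" for y using per[OF b, of "y + x"] by (simp add: add_ac)
    then show "integral (cbox 0 One) (\<lambda>y. deriv_within UNIV (\<lambda>y. ?V y \<bullet> b) y b) = 0"
      by (rule integral_cube_deriv[OF V _ b])
  qed
  finally have "integral (cbox 0 One) ?div = 0" .
  with integrable_integral[OF integrable_sum[OF finite_Basis int], of "\<lambda>b. b" 0 One]
  have "(?div has_integral 0) (cbox 0 One)" by simp
  then have "?div 0 = 0"
  proof (rule has_integral_0_cbox_imp_0[rotated 2])
    show "continuous_on (cbox 0 One) ?div" by (intro continuous_on_sum c)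
    show "?div y \<ge> 0" for y unfolding chain by (rule nonneg)
  qed (auto simp: box_ne_empty mem_box)
  then show ?thesis unfolding chain by simp
qed

section \<open>Foliated metrics\<close>

lemma linear_combo: "linear f \<Longrightarrow> f (\<Sum>i\<in>I. c i *\<^sub>R v i) = (\<Sum>i\<in>I. c i *\<^sub>R f (v i))"
  by (simp add: linear_sum linear_scale)

text \<open>Derivatives of an orthonormal frame have antisymmetric coefficients, while
  \<open>b (e s) (e k) + b (e k) (e s)\<close> is symmetric. This is why traces commute with
  covariant differentiation.\<close>

lemma contraction_antisym:
  fixes b :: "'a::real_vector \<Rightarrow> 'a \<Rightarrow> real"
  assumes b: "bilinear b" and anti: "\<And>k s. k < n \<Longrightarrow> s < n \<Longrightarrow> a k s = - a s k"
    and d: "\<And>k. k < n \<Longrightarrow> d k = (\<Sum>s<n. a k s *\<^sub>R e s)"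
  shows "(\<Sum>k<(n::nat). b (d k) (e k) + b (e k) (d k)) = 0"
proof -
  define c where "c = (\<lambda>k s. b (e s) (e k) + b (e k) (e s))"
  have "(\<Sum>k<n. b (d k) (e k) + b (e k) (d k)) = (\<Sum>k<n. \<Sum>s<n. a k s * c k s)" (is "?S = _")
    by (intro sum.cong refl) (simp add: d bilinear_simps[OF b] c_def sum.distrib algebra_simps)
  also have "\<dots> = (\<Sum>k<n. \<Sum>s<n. - (a s k * c s k))"
  proof (intro sum.cong refl)
    fix k s assume "k \<in> {..<n}" "s \<in> {..<n}"
    then have "a k s = - a s k" by (intro anti) auto
    then show "a k s * c k s = - (a s k * c s k)" by (simp only: c_def add.commute minus_mult_left)
  qed
  also have "\<dots> = - (\<Sum>s<n. \<Sum>k<n. a s k * c s k)"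
    by (subst sum.swap) (simp add: sum_negf)
  finally show ?thesis
    using \<open>?S = (\<Sum>k<n. \<Sum>s<n. a k s * c k s)\<close> by simp
qed

text \<open>A lift \<open>F\<close> may turn a lattice translation into a different one, so
  \<open>per_F\<close> and \<open>per_Fi\<close> ask only for some lattice vector, whereas the
  derivative of \<open>F\<close> is periodic. The slab conditions say that whole horizontal copies
  of \<open>'b\<close> lie in \<open>T\<close> and in \<open>M\<close>.\<close>

locale foliation = metric_field M g
  for M :: "('b::euclidean_space \<times> real) set" and g +
  fixes T :: "('b \<times> real) set" and F Fi :: "'b \<times> real \<Rightarrow> 'b \<times> real" and \<Lambda> :: "'b set" and m :: nat
  assumes m_dim: "m = DIM('b)" and admT: "admissible T"
    and F_sm: "smooth_on T F" and Fi_sm: "smooth_on M Fi"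
    and F_in: "\<And>y. y \<in> T \<Longrightarrow> F y \<in> M" and Fi_in: "\<And>p. p \<in> M \<Longrightarrow> Fi p \<in> T"
    and F_Fi: "\<And>p. p \<in> M \<Longrightarrow> F (Fi p) = p" and Fi_F: "\<And>y. y \<in> T \<Longrightarrow> Fi (F y) = y"
    and T_slab: "\<And>x x' t. (x, t) \<in> T \<Longrightarrow> (x', t) \<in> T"
    and M_slab: "\<And>x x' t. (x, t) \<in> M \<Longrightarrow> (x', t) \<in> M"
    and Basis_lattice: "Basis \<subseteq> \<Lambda>"
    and per_g: "\<And>p k. p \<in> M \<Longrightarrow> k \<in> \<Lambda> \<Longrightarrow> g (p + (k, 0)) = g p"
    and per_F: "\<And>y k. y \<in> T \<Longrightarrow> k \<in> \<Lambda> \<Longrightarrow> \<exists>k'\<in>\<Lambda>. F (y + (k, 0)) = F y + (k', 0)"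
    and per_Fi: "\<And>p k. p \<in> M \<Longrightarrow> k \<in> \<Lambda> \<Longrightarrow> \<exists>k'\<in>\<Lambda>. Fi (p + (k, 0)) = Fi p + (k', 0)"
    and per_dF: "\<And>y k u. y \<in> T \<Longrightarrow> k \<in> \<Lambda> \<Longrightarrow> deriv_within T F (y + (k, 0)) u = deriv_within T F y u"
begin

section \<open>Leaf coordinates and the adapted orthonormal frame\<close>

lemma bij_be: "bij_betw (basis_enum :: nat \<Rightarrow> 'b) {..<m} Basis"
  using bij_basis_enum[where 'a='b] by (simp add: m_dim)

text \<open>The push-forward under \<open>F\<close> of the constant field \<open>u\<close>: tangent
  to the leaves for \<open>snd u = 0\<close>, the time field for \<open>u = (0, 1)\<close>.\<close>

definition X :: "'b \<times> real \<Rightarrow> 'b \<times> real \<Rightarrow> 'b \<times> real" where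
  "X u p = deriv_within T F (Fi p) u"

text \<open>The components of \<open>v\<close> in the leaf coordinates, inverse to
  \<open>u \<mapsto> X u p\<close>.\<close>

definition cof :: "'b \<times> real \<Rightarrow> 'b \<times> real \<Rightarrow> 'b \<times> real" where
  "cof p v = deriv_within M Fi p v"

text \<open>The time direction has the last index \<open>m\<close>, so Gram-Schmidt exhausts the
  leaf directions before it and \<open>E m\<close> is the unit normal.\<close>

definition be :: "nat \<Rightarrow> 'b \<times> real" where
  "be k = (if k < m then (basis_enum k, 0) else (0, 1))"

definition E :: "nat \<Rightarrow> 'b \<times> real \<Rightarrow> 'b \<times> real" where
  "E k p = gram_schmidt (g p) (\<lambda>j. X (be j) p) k"

abbreviation "N \<equiv> E m"

definition lapse :: "'b \<times> real \<Rightarrow> real" where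
  "lapse p = g p (X (0, 1) p) (N p)"

lemma F_img: "F ` T \<subseteq> M" and Fi_img: "Fi ` M \<subseteq> T"
  using F_in Fi_in by auto

lemma linear_X: "p \<in> M \<Longrightarrow> linear (\<lambda>u. X u p)"
  unfolding X_def by (rule deriv_within_linear[OF F_sm Fi_in])

lemma linear_cof: "p \<in> M \<Longrightarrow> linear (cof p)"
  unfolding cof_def[abs_def] by (rule deriv_within_linear[OF Fi_sm])

lemma smooth_X: "smooth_on M (X u)"
  unfolding X_def[abs_def] by (rule smooth_on_compose[OF adm Fi_img Fi_sm smooth_on_deriv_within[OF F_sm]])

lemma smooth_cof: "smooth_on M V \<Longrightarrow> smooth_on M (\<lambda>p. cof p (V p))"
  unfolding cof_def[abs_def] by (rule smooth_on_deriv_within_field[OF adm Fi_sm])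

lemma deriv_ident: "admissible S \<Longrightarrow> p \<in> S \<Longrightarrow> (\<And>x. x \<in> S \<Longrightarrow> h x = x) \<Longrightarrow> deriv_within S h p v = v"
  using deriv_within_cong[of S h "\<lambda>x. x" p v] deriv_within_eqI[of S p "\<lambda>x. x" "\<lambda>v. v"] by simp

lemma cof_X: assumes p: "p \<in> M" shows "cof p (X u p) = u"
proof -
  have "deriv_within T (\<lambda>y. Fi (F y)) (Fi p) u = deriv_within M Fi (F (Fi p)) (deriv_within T F (Fi p) u)"
    by (rule deriv_within_compose[OF admT Fi_in[OF p] F_img F_sm Fi_sm])
  moreover have "deriv_within T (\<lambda>y. Fi (F y)) (Fi p) u = u"
    by (rule deriv_ident[OF admT Fi_in[OF p] Fi_F])
  ultimately show ?thesis by (simp add: cof_def X_def F_Fi[OF p])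
qed

lemma X_cof: assumes p: "p \<in> M" shows "X (cof p v) p = v"
proof -
  have "deriv_within M (\<lambda>y. F (Fi y)) p v = deriv_within T F (Fi p) (deriv_within M Fi p v)"
    by (rule deriv_within_compose[OF adm p Fi_img Fi_sm F_sm])
  moreover have "deriv_within M (\<lambda>y. F (Fi y)) p v = v"
    by (rule deriv_ident[OF adm p F_Fi])
  ultimately show ?thesis by (simp add: cof_def X_def)
qed

lemma deriv_pull:
  fixes \<psi> :: "'b \<times> real \<Rightarrow> 'c::real_normed_vector"
  assumes y: "y \<in> T" and psi: "smooth_on M \<psi>"
  shows "deriv_within T (\<lambda>y. \<psi> (F y)) y u = deriv_within M \<psi> (F y) (X u (F y))"
  unfolding X_def Fi_F[OF y] by (rule deriv_within_compose[OF admT y F_img F_sm psi])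

lemma smooth_pull: "smooth_on M \<psi> \<Longrightarrow> smooth_on T (\<lambda>y. \<psi> (F y))"
  by (rule smooth_on_compose[OF admT F_img F_sm])

text \<open>In the coordinates of \<open>T\<close> the fields \<open>X u\<close> are constant, so
  this is the symmetry of second derivatives of the pull-back.\<close>

lemma X_commute:
  fixes \<psi> :: "'b \<times> real \<Rightarrow> real"
  assumes p: "p \<in> M" and psi: "smooth_on M \<psi>"
  shows "deriv_within M (\<lambda>r. deriv_within M \<psi> r (X u r)) p (X v p) = deriv_within M (\<lambda>r. deriv_within M \<psi> r (X v r)) p (X u p)"
proof -
  have e: "deriv_within M (\<lambda>r. deriv_within M \<psi> r (X u r)) p (X v p) =
      deriv_within T (\<lambda>y. deriv_within T (\<lambda>y. \<psi> (F y)) y u) (Fi p) v" for u v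
  proof -
    have "deriv_within T (\<lambda>y. deriv_within T (\<lambda>y. \<psi> (F y)) y u) (Fi p) v =
        deriv_within T (\<lambda>y. deriv_within M \<psi> (F y) (X u (F y))) (Fi p) v"
      by (rule deriv_within_cong[OF deriv_pull[OF _ psi] Fi_in[OF p]])
    also have "\<dots> = deriv_within M (\<lambda>r. deriv_within M \<psi> r (X u r)) (F (Fi p)) (X v (F (Fi p)))"
      by (rule deriv_pull[where \<psi> = "\<lambda>r. deriv_within M \<psi> r (X u r)", OF Fi_in[OF p] smooth_on_deriv_within_field[OF adm psi smooth_X]])
    finally show ?thesis by (simp add: F_Fi[OF p])
  qed
  show ?thesis unfolding e by (rule deriv_within_commute_real[OF admT smooth_pull[OF psi] Fi_in[OF p]])
qed

lemma X_bracket: assumes p: "p \<in> M" shows "lie_bracket M (X u) (X v) p = 0"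
proof -
  have e: "deriv_within M (X v) p (X u p) = deriv_within T (\<lambda>y. deriv_within T F y v) (Fi p) u" for u v
  proof -
    have "deriv_within T (\<lambda>y. deriv_within T F y v) (Fi p) u = deriv_within T (\<lambda>y. X v (F y)) (Fi p) u"
      by (rule deriv_within_cong[OF _ Fi_in[OF p]]) (simp add: X_def Fi_F)
    also have "\<dots> = deriv_within M (X v) (F (Fi p)) (X u (F (Fi p)))"
      by (rule deriv_pull[OF Fi_in[OF p] smooth_X])
    finally show ?thesis by (simp add: F_Fi[OF p])
  qed
  show ?thesis unfolding lie_bracket_def e using deriv_within_commute[OF admT F_sm Fi_in[OF p], of v u] by simp
qed

lemma D_X_commute: "p \<in> M \<Longrightarrow> D p (X u p) (X v) = D p (X v p) (X u)"
  using torsion_free[of p "X u" "X v"] X_bracket by simp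

lemma be_inner: "i \<le> m \<Longrightarrow> j \<le> m \<Longrightarrow> be i \<bullet> be j = (if i = j then 1 else 0)"
proof -
  have "(basis_enum i :: 'b) \<bullet> basis_enum j = (if i = j then 1 else 0)" if "i < m" "j < m" for i j
  proof -
    have "(basis_enum i :: 'b) \<in> Basis" "(basis_enum j :: 'b) \<in> Basis" "(basis_enum i :: 'b) = basis_enum j \<longleftrightarrow> i = j"
      using bij_betwE[OF bij_be] inj_on_eq_iff[OF bij_betw_imp_inj_on[OF bij_be]] that by auto
    then show ?thesis by (simp add: inner_Basis)
  qed
  then show "i \<le> m \<Longrightarrow> j \<le> m \<Longrightarrow> be i \<bullet> be j = (if i = j then 1 else 0)" by (simp add: be_def)
qed

lemma be_expand: "u = (\<Sum>k\<le>m. (u \<bullet> be k) *\<^sub>R be k)"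
proof -
  have "(\<Sum>k<m. (u \<bullet> be k) *\<^sub>R be k) = (\<Sum>k<m. (\<lambda>b. (u \<bullet> (b, 0)) *\<^sub>R (b, 0)) (basis_enum k))"
    by (intro sum.cong) (auto simp: be_def)
  also have "\<dots> = (\<Sum>b\<in>Basis. (u \<bullet> (b, 0)) *\<^sub>R (b, 0))"
    by (rule sum.reindex_bij_betw[OF bij_be])
  also have "\<dots> = (fst u, 0)"
    by (simp add: prod_eq_iff inner_prod_def fst_sum snd_sum euclidean_representation)
  finally show ?thesis by (simp add: be_def prod_eq_iff inner_prod_def flip: lessThan_Suc_atMost)
qed

lemma be_span: "j < k \<Longrightarrow> k \<le> m \<Longrightarrow> v \<in> span (be ` {..j}) \<Longrightarrow> v \<bullet> be k = 0"
proof -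
  assume "j < k" "k \<le> m" "v \<in> span (be ` {..j})"
  then have "v \<in> span (be ` {..j})" "\<And>x. x \<in> be ` {..j} \<Longrightarrow> orthogonal (be k) x"
    by (auto simp: orthogonal_def be_inner)
  then have "orthogonal (be k) v" using orthogonal_to_span by blast
  then show ?thesis by (simp add: orthogonal_def inner_commute)
qed

lemma X_independent:
  assumes p: "p \<in> M" and k: "k < Suc m"
  shows "X (be k) p \<notin> span ((\<lambda>j. X (be j) p) ` {..<k})"
proof
  assume "X (be k) p \<in> span ((\<lambda>j. X (be j) p) ` {..<k})"
  then have "cof p (X (be k) p) \<in> span (cof p ` (\<lambda>j. X (be j) p) ` {..<k})"
    using linear_span_image[OF linear_cof[OF p]] by blast
  then have b: "be k \<in> span (be ` {..<k})" by (simp add: image_image cof_X[OF p])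
  show False
  proof (cases k)
    case 0 then show ?thesis using b be_inner[of 0 0] by simp
  next
    case (Suc j) then show ?thesis using b be_span[of j k "be k"] be_inner[of k k] k by (simp add: lessThan_Suc_atMost)
  qed
qed


lemma smooth_E: "k \<le> m \<Longrightarrow> smooth_on M (E k)"
  unfolding E_def[abs_def] by (rule smooth_gram_schmidt[where n = "Suc m" and X = "\<lambda>k. X (be k)", OF smooth_X X_independent]) simp_all

lemma orthonormal_E: "p \<in> M \<Longrightarrow> orthonormal (g p) (DIM('b \<times> real)) (\<lambda>a. E a p)"
proof -
  assume p: "p \<in> M"
  have "orthonormal (g p) (Suc m) (\<lambda>a. E a p)"
    unfolding E_def by (rule gram_schmidt(1)[OF g_ip[OF p] X_independent[OF p]])
  then show ?thesis by (simp add: m_dim)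
qed

lemma g_E: "p \<in> M \<Longrightarrow> i \<le> m \<Longrightarrow> j \<le> m \<Longrightarrow> g p (E i p) (E j p) = (if i = j then 1 else 0)"
  using orthonormal_E[of p] by (auto simp: orthonormal_def m_dim)

lemma E_expand: "p \<in> M \<Longrightarrow> v = (\<Sum>a<m. g p v (E a p) *\<^sub>R E a p) + g p v (N p) *\<^sub>R N p"
  using orthonormal_expand[OF g_ip orthonormal_E, of p v] by (simp add: m_dim[symmetric])

lemma E_expand_tan: "p \<in> M \<Longrightarrow> g p v (N p) = 0 \<Longrightarrow> v = (\<Sum>a<m. g p v (E a p) *\<^sub>R E a p)"
  using E_expand[of p v] by simp

lemma L_diag_pos: "p \<in> M \<Longrightarrow> i \<le> m \<Longrightarrow> g p (X (be i) p) (E i p) > 0"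
  unfolding E_def by (rule gram_schmidt(3)[OF g_ip X_independent, where n = "Suc m"]) auto

lemma L_triangular: "p \<in> M \<Longrightarrow> i < j \<Longrightarrow> j \<le> m \<Longrightarrow> g p (X (be i) p) (E j p) = 0"
  unfolding E_def by (rule gram_schmidt(5)[OF g_ip X_independent, where n = "Suc m"]) auto

lemma lapse_pos: "p \<in> M \<Longrightarrow> lapse p > 0"
  using L_diag_pos[of p m] by (simp add: lapse_def be_def)

lemma g_X_N: assumes p: "p \<in> M" shows "g p (X u p) (N p) = lapse p * snd u"
proof -
  have "X u p = X (\<Sum>k\<le>m. (u \<bullet> be k) *\<^sub>R be k) p" by (rule arg_cong[OF be_expand])
  also have "\<dots> = (\<Sum>k\<le>m. (u \<bullet> be k) *\<^sub>R X (be k) p)"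
    by (rule linear_combo[OF linear_X[OF p]])
  finally have "g p (X u p) (N p) = (\<Sum>k\<le>m. (u \<bullet> be k) * g p (X (be k) p) (N p))"
    by (simp only: gb[OF p] real_scaleR_def)
  also have "\<dots> = (u \<bullet> be m) * g p (X (be m) p) (N p)"
    using L_triangular[OF p, of _ m] by (simp flip: lessThan_Suc_atMost)
  finally show ?thesis by (simp add: be_def lapse_def inner_prod_def)
qed

lemma g_N: assumes p: "p \<in> M" shows "g p v (N p) = lapse p * snd (cof p v)"
  using g_X_N[OF p, of "cof p v"] X_cof[OF p] by simp

lemma tangent_iff: "p \<in> M \<Longrightarrow> g p v (N p) = 0 \<longleftrightarrow> snd (cof p v) = 0"
  using g_N[of p v] lapse_pos[of p] by auto

lemma smooth_lapse: "smooth_on M lapse"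
  unfolding lapse_def[abs_def] by (intro smooth_g smooth_X smooth_E order_refl)

text \<open>The coordinate fields are triangular in the Gram-Schmidt frame, so \<open>rho\<close> is the volume density of the leaves.\<close>

definition rho :: "'b \<times> real \<Rightarrow> real" where
  "rho p = (\<Prod>i<m. g p (X (be i) p) (E i p))"

lemma rho_pos: "p \<in> M \<Longrightarrow> rho p > 0"
  unfolding rho_def by (intro prod_pos) (auto intro: L_diag_pos)

lemma smooth_L: "j \<le> m \<Longrightarrow> smooth_on M (\<lambda>p. g p (X u p) (E j p))"
  by (intro smooth_g smooth_X smooth_E)

lemma smooth_rho: "smooth_on M rho"
  unfolding rho_def[abs_def] by (intro smooth_on_prod adm smooth_L finite_lessThan) simp

lemma deriv_prod:
  fixes L :: "nat \<Rightarrow> 'b \<times> real \<Rightarrow> real"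
  assumes p: "p \<in> M" and L: "\<And>i. i < n \<Longrightarrow> smooth_on M (L i)" "\<And>i. i < n \<Longrightarrow> L i p \<noteq> 0"
  shows "deriv_within M (\<lambda>p. \<Prod>i<n. L i p) p v = (\<Prod>i<n. L i p) * (\<Sum>i<n. deriv_within M (L i) p v / L i p)"
  using L
proof (induction n)
  case 0 then show ?case by (simp add: adm p)
next
  case (Suc n)
  have "smooth_on M (\<lambda>p. \<Prod>i<n. L i p)" using Suc.prems by (intro smooth_on_prod adm finite_lessThan) auto
  then show ?case using Suc by (simp add: deriv_within_mult[OF adm p] field_simps)
qed

text \<open>Gram-Schmidt preserves the spans of initial segments, so the matrix expressing
  \<open>E\<close> through the coordinate fields is triangular, too.\<close>

lemma cof_E_zero: assumes p: "p \<in> M" and "i < l" "l \<le> m" shows "cof p (E i p) \<bullet> be l = 0"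
proof -
  have "E i p \<in> span ((\<lambda>j. E j p) ` {..<Suc i})" by (intro span_base) auto
  also have "\<dots> = span ((\<lambda>j. X (be j) p) ` {..<Suc i})"
    unfolding E_def using assms by (intro gram_schmidt(2)[OF g_ip X_independent, where n = "Suc m"]) auto
  finally have "cof p (E i p) \<in> span (cof p ` (\<lambda>j. X (be j) p) ` {..<Suc i})"
    using linear_span_image[OF linear_cof[OF p]] by blast
  then have "cof p (E i p) \<in> span (be ` {..i})" by (simp add: image_image cof_X[OF p] lessThan_Suc_atMost)
  then show ?thesis by (rule be_span[OF assms(2,3)])
qed

lemma X_cof_sum: assumes p: "p \<in> M" and "g p v (N p) = 0" shows "v = (\<Sum>l<m. (cof p v \<bullet> be l) *\<^sub>R X (be l) p)"
proof -
  have "v = X (\<Sum>k\<le>m. (cof p v \<bullet> be k) *\<^sub>R be k) p"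
    using X_cof[OF p, of v] arg_cong[OF be_expand[of "cof p v"], of "\<lambda>u. X u p"] by simp
  also have "\<dots> = (\<Sum>k\<le>m. (cof p v \<bullet> be k) *\<^sub>R X (be k) p)"
    by (rule linear_combo[OF linear_X[OF p]])
  also have "\<dots> = (\<Sum>k<m. (cof p v \<bullet> be k) *\<^sub>R X (be k) p)"
    using assms(2) tangent_iff[OF p] by (simp add: be_def inner_prod_def flip: lessThan_Suc_atMost)
  finally show ?thesis .
qed

text \<open>Logarithmic derivative of a determinant. As \<open>X u\<close> commutes with the leaf
  fields, its divergence along the leaf is the trace of the inverse coordinate matrix against the
  derivative of the coordinate matrix; both are triangular, so only diagonal entries
  contribute.\<close>

lemma deriv_rho:
  assumes p: "p \<in> M"
  shows "deriv_within M rho p (X u p) = rho p * (\<Sum>i<m. g p (D p (E i p) (X u)) (E i p))"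
proof -
  have "g p (D p (E i p) (X u)) (E i p) = deriv_within M (\<lambda>p. g p (X (be i) p) (E i p)) p (X u p) / g p (X (be i) p) (E i p)"
    if i: "i < m" for i
  proof -
    define P where "P = (\<lambda>l. cof p (E i p) \<bullet> be l)"
    have Ei: "E i p = (\<Sum>l<m. P l *\<^sub>R X (be l) p)"
      unfolding P_def by (rule X_cof_sum[OF p]) (use g_E[OF p] i in simp)
    \<comment> \<open>Entries of \<open>P\<close> beyond \<open>i\<close> vanish by triangularity,
      and those before \<open>i\<close> meet a zero of \<open>h\<close>.\<close>
    have only: "(\<Sum>l<m. P l * h l) = P i * h i" if "\<And>l. l < i \<Longrightarrow> h l = 0" for h
    proof -
      have "(\<Sum>l<m. P l * h l) = (\<Sum>l<m. if l = i then P i * h i else 0)"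
        by (intro sum.cong refl) (use that cof_E_zero[OF p, of i] in \<open>auto simp: P_def not_less_iff_gr_or_eq less_imp_le neq_iff\<close>)
      then show ?thesis using i by simp
    qed
    have sE: "smooth_on M (E i)" using i by (intro smooth_E) simp
    have "D p (E i p) (X u) = (\<Sum>l<m. P l *\<^sub>R D p (X (be l) p) (X u))"
      unfolding Ei by (rule linear_combo[OF linear_D[OF p smooth_X]])
    also have "\<dots> = (\<Sum>l<m. P l *\<^sub>R D p (X u p) (X (be l)))"
      by (simp only: D_X_commute[OF p, of u])
    finally have "g p (D p (E i p) (X u)) (E i p) = (\<Sum>l<m. P l * g p (D p (X u p) (X (be l))) (E i p))"
      by (simp only: gb[OF p] real_scaleR_def)
    also have "\<dots> = (\<Sum>l<m. P l * deriv_within M (\<lambda>r. g r (X (be l) r) (E i r)) p (X u p))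
        - (\<Sum>l<m. P l * g p (X (be l) p) (D p (X u p) (E i)))"
      by (simp add: metric_compat[OF p smooth_X sE] algebra_simps sum.distrib)
    also have "(\<Sum>l<m. P l * g p (X (be l) p) (D p (X u p) (E i))) = g p (E i p) (D p (X u p) (E i))"
      using arg_cong[OF Ei, of "\<lambda>v. g p v (D p (X u p) (E i))"] by (simp only: gb[OF p] real_scaleR_def)
    also have "\<dots> = 0"
    proof -
      have "deriv_within M (\<lambda>r. g r (E i r) (E i r)) p (X u p) = deriv_within M (\<lambda>_. 1) p (X u p)"
        by (rule deriv_within_cong[OF _ p]) (use g_E i in simp)
      then show ?thesis
        using metric_compat[OF p sE sE] g_sym[OF p, of "E i p"] by (simp add: adm p)
    qed
    also have "(\<Sum>l<m. P l * deriv_within M (\<lambda>r. g r (X (be l) r) (E i r)) p (X u p)) = P i * deriv_within M (\<lambda>r. g r (X (be i) r) (E i r)) p (X u p)"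
    proof (rule only)
      fix l assume "l < i"
      then have "deriv_within M (\<lambda>r. g r (X (be l) r) (E i r)) p (X u p) = deriv_within M (\<lambda>_. 0) p (X u p)"
        using i by (intro deriv_within_cong[OF _ p] L_triangular) auto
      then show "deriv_within M (\<lambda>r. g r (X (be l) r) (E i r)) p (X u p) = 0" by (simp add: adm p)
    qed
    finally have a: "g p (D p (E i p) (X u)) (E i p) = P i * deriv_within M (\<lambda>r. g r (X (be i) r) (E i r)) p (X u p)"
      by simp
    \<comment> \<open>Pairing \<open>E i\<close> with itself identifies \<open>P i\<close> as the
      reciprocal of the diagonal entry.\<close>
    have "1 = g p (\<Sum>l<m. P l *\<^sub>R X (be l) p) (E i p)" using g_E[OF p, of i i] i Ei by simp
    also have "\<dots> = (\<Sum>l<m. P l * g p (X (be l) p) (E i p))" by (simp only: gb[OF p] real_scaleR_def)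
    also have "\<dots> = P i * g p (X (be i) p) (E i p)"
      by (rule only) (use i in \<open>intro L_triangular[OF p], auto\<close>)
    finally show ?thesis unfolding a using L_diag_pos[OF p, of i] i by (simp add: field_simps)
  qed
  then show ?thesis
    unfolding rho_def[abs_def]
    by (subst deriv_prod[OF p smooth_L]) (use L_diag_pos[OF p] in \<open>auto simp: less_imp_le less_imp_neq[symmetric] intro!: sum.cong\<close>)
qed

text \<open>Divergence along the leaves. The ambient connection may be used because only forms that
  vanish on \<open>N\<close> are integrated, and for them the normal part of \<open>D\<close> drops
  out.\<close>

definition div1 :: "('b \<times> real \<Rightarrow> 'b \<times> real \<Rightarrow> real) \<Rightarrow> 'b \<times> real \<Rightarrow> real" where
  "div1 \<eta> p = (\<Sum>i<m. deriv_within M (\<lambda>r. \<eta> r (E i r)) p (E i p) - \<eta> p (D p (E i p) (E i)))"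

text \<open>The classical coordinate formula for the divergence of the dual field \<open>V\<close>
  with volume density \<open>rho\<close>. It is the form to which the divergence theorem on the cube
  applies.\<close>

lemma div1_eq:
  assumes p: "p \<in> M" and sm: "\<And>w. smooth_on M (\<lambda>p. \<eta> p w)" and lin: "\<And>p. p \<in> M \<Longrightarrow> linear (\<eta> p)"
    and eN: "\<And>p. p \<in> M \<Longrightarrow> \<eta> p (N p) = 0"
  defines "V \<equiv> \<lambda>p. \<Sum>j<m. \<eta> p (E j p) *\<^sub>R E j p"
  shows "smooth_on M V" "rho p * div1 \<eta> p = (\<Sum>k<m. deriv_within M (\<lambda>p. rho p * (cof p (V p) \<bullet> be k)) p (X (be k) p))"
proof -
  have sE: "i < m \<Longrightarrow> smooth_on M (E i)" for i by (intro smooth_E) simp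
  have sEta: "i < m \<Longrightarrow> smooth_on M (\<lambda>p. \<eta> p (E i p))" for i
    by (rule smooth_on_linear_family[where L = \<eta>, OF adm sm lin sE])
  show V: "smooth_on M V" unfolding V_def by (intro smooth_on_sum smooth_on_scaleR adm finite_lessThan sEta sE) auto
  have gV: "g r (V r) w = \<eta> r w" if r: "r \<in> M" for r w
  proof -
    have "\<eta> r w = \<eta> r ((\<Sum>a<m. g r w (E a r) *\<^sub>R E a r) + g r w (N r) *\<^sub>R N r)"
      by (rule arg_cong[OF E_expand[OF r]])
    also have "\<dots> = (\<Sum>a<m. g r w (E a r) * \<eta> r (E a r))"
      using lin[OF r] eN[OF r] by (simp add: linear_add linear_sum linear_scale)
    finally show ?thesis
      unfolding V_def by (simp add: gb[OF r] g_sym[OF r, of w] mult.commute)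
  qed
  have VN: "g r (V r) (N r) = 0" if r: "r \<in> M" for r using gV[OF r] eN[OF r] by simp
  define c where "c = (\<lambda>k p. cof p (V p) \<bullet> be k)"
  have sc: "smooth_on M (c k)" for k unfolding c_def by (intro smooth_on_inner adm smooth_cof V)
  have Vc: "V r = (\<Sum>k<m. c k r *\<^sub>R X (be k) r)" if r: "r \<in> M" for r
    unfolding c_def by (rule X_cof_sum[OF r VN[OF r]])
  have "div1 \<eta> p = (\<Sum>i<m. g p (D p (E i p) V) (E i p))"
    unfolding div1_def
  proof (rule sum.cong[OF refl])
    fix i assume "i \<in> {..<m}"
    then have i: "i < m" by simp
    have "deriv_within M (\<lambda>r. \<eta> r (E i r)) p (E i p) = deriv_within M (\<lambda>r. g r (V r) (E i r)) p (E i p)"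
      by (rule deriv_within_cong[OF _ p]) (simp add: gV)
    also have "\<dots> = g p (D p (E i p) V) (E i p) + \<eta> p (D p (E i p) (E i))"
      unfolding metric_compat[OF p V sE[OF i]] gV[OF p] ..
    finally show "deriv_within M (\<lambda>r. \<eta> r (E i r)) p (E i p) - \<eta> p (D p (E i p) (E i)) = g p (D p (E i p) V) (E i p)" by simp
  qed
  also have "\<dots> = (\<Sum>i<m. \<Sum>k<m. deriv_within M (c k) p (E i p) * g p (X (be k) p) (E i p) + c k p * g p (D p (E i p) (X (be k))) (E i p))"
  proof (rule sum.cong[OF refl])
    fix i assume "i \<in> {..<m}"
    have "D p (E i p) V = D p (E i p) (\<lambda>r. \<Sum>k<m. c k r *\<^sub>R X (be k) r)"
      by (rule D_cong[OF p Vc])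
    also have "\<dots> = (\<Sum>k<m. deriv_within M (c k) p (E i p) *\<^sub>R X (be k) p + c k p *\<^sub>R D p (E i p) (X (be k)))"
      by (subst D_sum[OF p finite_lessThan smooth_on_scaleR[OF adm sc smooth_X]]) (simp add: D_scaleR[OF p sc smooth_X])
    finally show "g p (D p (E i p) V) (E i p) = (\<Sum>k<m. deriv_within M (c k) p (E i p) * g p (X (be k) p) (E i p) + c k p * g p (D p (E i p) (X (be k))) (E i p))"
      by (simp only: gb[OF p] real_scaleR_def)
  qed
  also have "\<dots> = (\<Sum>k<m. \<Sum>i<m. deriv_within M (c k) p (E i p) * g p (X (be k) p) (E i p) + c k p * g p (D p (E i p) (X (be k))) (E i p))"
    by (rule sum.swap)
  also have "\<dots> = (\<Sum>k<m. deriv_within M (c k) p (X (be k) p) + c k p * (\<Sum>i<m. g p (D p (E i p) (X (be k))) (E i p)))"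
  proof (rule sum.cong[OF refl])
    fix k assume "k \<in> {..<m}"
    then have "X (be k) p = (\<Sum>a<m. g p (X (be k) p) (E a p) *\<^sub>R E a p)"
      by (intro E_expand_tan[OF p] L_triangular[OF p]) auto
    from arg_cong[OF this, of "deriv_within M (c k) p"]
    have "deriv_within M (c k) p (X (be k) p) = (\<Sum>i<m. deriv_within M (c k) p (E i p) * g p (X (be k) p) (E i p))"
      using deriv_within_linear[OF sc p, of k] by (simp add: linear_sum linear_scale mult.commute)
    then show "(\<Sum>i<m. deriv_within M (c k) p (E i p) * g p (X (be k) p) (E i p) + c k p * g p (D p (E i p) (X (be k))) (E i p))
       = deriv_within M (c k) p (X (be k) p) + c k p * (\<Sum>i<m. g p (D p (E i p) (X (be k))) (E i p))"
      by (simp only: sum.distrib sum_distrib_left)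
  qed
  finally have "rho p * div1 \<eta> p = (\<Sum>k<m. rho p * (deriv_within M (c k) p (X (be k) p) + c k p * (\<Sum>i<m. g p (D p (E i p) (X (be k))) (E i p))))"
    by (simp only: sum_distrib_left)
  also have "\<dots> = (\<Sum>k<m. deriv_within M (\<lambda>p. rho p * c k p) p (X (be k) p))"
    unfolding deriv_within_mult[OF adm p smooth_rho sc] deriv_rho[OF p] by (simp add: algebra_simps)
  finally show "rho p * div1 \<eta> p = (\<Sum>k<m. deriv_within M (\<lambda>p. rho p * (cof p (V p) \<bullet> be k)) p (X (be k) p))"
    unfolding c_def .
qed

section \<open>Periodicity under lattice translations\<close>

definition per :: "('b \<times> real \<Rightarrow> 'c) \<Rightarrow> bool" where
  "per \<psi> \<longleftrightarrow> (\<forall>p\<in>M. \<forall>k\<in>\<Lambda>. \<psi> (p + (k, 0)) = \<psi> p)"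

lemma perD: "per \<psi> \<Longrightarrow> p \<in> M \<Longrightarrow> k \<in> \<Lambda> \<Longrightarrow> \<psi> (p + (k, 0)) = \<psi> p"
  by (simp add: per_def)

lemma M_shift: "p \<in> M \<Longrightarrow> p + (k, 0) \<in> M"
proof -
  assume "p \<in> M"
  then have "(fst p + k, snd p) \<in> M" by (intro M_slab[where x = "fst p" and x' = "fst p + k" and t = "snd p"]) simp
  then show ?thesis by (simp add: plus_prod_def)
qed

lemma per_deriv:
  fixes \<psi> :: "'b \<times> real \<Rightarrow> 'c::real_normed_vector"
  assumes "smooth_on M \<psi>" "per \<psi>"
  shows "per (\<lambda>p v. deriv_within M \<psi> p v)"
  unfolding per_def
proof (intro ballI ext)
  fix p k v assume p: "p \<in> M" and k: "k \<in> \<Lambda>"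
  let ?t = "\<lambda>x. x + (k, 0::real)"
  have t: "smooth_on M ?t" by (intro smooth_on_add smooth_on_ident smooth_on_const adm)
  have "(?t has_derivative (\<lambda>v. v)) (at p within M)" by (auto intro!: derivative_eq_intros)
  then have d: "deriv_within M ?t p v = v" by (simp add: deriv_within_eqI[OF adm p])
  have "deriv_within M \<psi> p v = deriv_within M (\<lambda>x. \<psi> (?t x)) p v"
    by (rule deriv_within_cong[OF _ p]) (simp add: perD[OF assms(2) _ k])
  also have "\<dots> = deriv_within M \<psi> (?t p) (deriv_within M ?t p v)"
    by (rule deriv_within_compose[where F = ?t, OF adm p _ t assms(1)]) (rule image_subsetI, rule M_shift)
  finally show "deriv_within M \<psi> (p + (k, 0)) v = deriv_within M \<psi> p v" by (simp add: d)
qed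

lemma per_g': "per g" by (simp add: per_def per_g)

lemma per_Gam: "per Gam"
proof -
  have g: "per (\<lambda>x. g x v w)" for v w using per_g by (simp add: per_def)
  note d = perD[OF per_deriv[OF form_fieldD(1)[OF g_form] g]]
  show ?thesis
    unfolding per_def christoffel_def
    by (intro ballI ext) (simp add: d[THEN fun_cong] per_g)
qed

lemma per_nab:
  assumes "smooth_on M W" "per W" shows "per (\<lambda>p x. D p x W)"
  unfolding per_def nab_def
  by (intro ballI ext) (simp add: perD[OF per_deriv[OF assms], THEN fun_cong] perD[OF per_Gam] perD[OF assms(2)])

lemma per_X: "per (X u)"
  unfolding per_def X_def
proof (intro ballI)
  fix p k assume p: "p \<in> M" and k: "k \<in> \<Lambda>"
  obtain k' where "k' \<in> \<Lambda>" "Fi (p + (k, 0)) = Fi p + (k', 0)" using per_Fi[OF p k] by auto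
  then show "deriv_within T F (Fi (p + (k, 0))) u = deriv_within T F (Fi p) u"
    using per_dF[OF Fi_in[OF p]] by simp
qed

lemma per_E: "per (E i)"
proof -
  have "(\<lambda>j. X (be j) (p + (k, 0))) = (\<lambda>j. X (be j) p)" if "p \<in> M" "k \<in> \<Lambda>" for p k
    using perD[OF per_X that] by simp
  then show ?thesis unfolding per_def E_def using per_g by simp
qed

lemma per_form:
  assumes B: "per B" and V: "per V" and W: "per W"
  shows "per (\<lambda>p. B p (V p) (W p))"
  unfolding per_def
proof (intro ballI)
  fix p k assume pk: "p \<in> M" "k \<in> \<Lambda>"
  show "B (p + (k, 0)) (V (p + (k, 0))) (W (p + (k, 0))) = B p (V p) (W p)"
    unfolding perD[OF B pk] perD[OF V pk] perD[OF W pk] ..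
qed

text \<open>\<open>cof p\<close> inverts \<open>u \<mapsto> X u p\<close>, so periodicity passes to
  it from \<open>X\<close>.\<close>

lemma per_cof: "per V \<Longrightarrow> per (\<lambda>p. cof p (V p))"
proof -
  assume V: "per V"
  show ?thesis unfolding per_def
  proof (intro ballI)
    fix p k assume p: "p \<in> M" and k: "k \<in> \<Lambda>"
    let ?u = "cof (p + (k, 0)) (V p)"
    have "X ?u p = X ?u (p + (k, 0))" by (rule perD[OF per_X p k, symmetric])
    also have "\<dots> = V p" by (rule X_cof[OF M_shift[OF p]])
    finally have "cof p (V p) = ?u" using cof_X[OF p, of ?u] by (simp only:)
    then show "cof (p + (k, 0)) (V (p + (k, 0))) = cof p (V p)" unfolding perD[OF V p k] by (rule sym)
  qed
qed

lemma per_rho: "per rho"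
proof -
  have "per (\<lambda>p. g p (X (be i) p) (E i p))" for i by (rule per_form[where B = g, OF per_g' per_X per_E])
  then show ?thesis
    unfolding per_def rho_def by (intro ballI prod.cong refl) blast
qed

section \<open>Restriction to a single leaf and integration over it\<close>

lemma leaf_map:
  assumes "(x0, t) \<in> T"
  shows "(x, t) \<in> T" "smooth_on UNIV (\<lambda>x :: 'b. (x, t))" "range (\<lambda>x :: 'b. (x, t)) \<subseteq> T"
    "deriv_within UNIV (\<lambda>x :: 'b. (x, t)) x v = (v, 0)"
proof -
  have T: "(x, t) \<in> T" for x using T_slab assms by blast
  then show "(x, t) \<in> T" .
  have "linear (\<lambda>x :: 'b. (x, 0 :: real))" by (auto intro!: linearI)
  then have "smooth_on UNIV (\<lambda>x :: 'b. (x, 0 :: real) + (0, t))"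
    by (intro smooth_on_add[OF admissible_UNIV smooth_on_linear[OF admissible_UNIV] smooth_on_const[OF admissible_UNIV]])
  then show "smooth_on UNIV (\<lambda>x :: 'b. (x, t))" by simp
  have "((\<lambda>x :: 'b. (x, t)) has_derivative (\<lambda>v. (v, 0))) (at x within UNIV)"
    by (auto intro!: derivative_eq_intros)
  from fun_cong[OF deriv_within_eqI[OF admissible_UNIV UNIV_I this]]
  show "deriv_within UNIV (\<lambda>x :: 'b. (x, t)) x v = (v, 0)" .
  show "range (\<lambda>x :: 'b. (x, t)) \<subseteq> T" using T by auto
qed

lemma smooth_leaf:
  fixes \<psi> :: "'b \<times> real \<Rightarrow> 'c::real_normed_vector"
  assumes "(x0, t) \<in> T" "smooth_on M \<psi>"
  shows "smooth_on UNIV (\<lambda>x. \<psi> (F (x, t)))"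
  by (rule smooth_on_compose[where F = "\<lambda>x. (x, t)", OF admissible_UNIV leaf_map(3,2)[OF assms(1)] smooth_pull[OF assms(2)]])

lemma deriv_leaf:
  fixes \<psi> :: "'b \<times> real \<Rightarrow> 'c::real_normed_vector"
  assumes t: "(x0, t) \<in> T" and psi: "smooth_on M \<psi>"
  shows "deriv_within UNIV (\<lambda>x. \<psi> (F (x, t))) x u = deriv_within M \<psi> (F (x, t)) (X (u, 0) (F (x, t)))"
proof -
  have "deriv_within UNIV (\<lambda>x. \<psi> (F (x, t))) x u =
      deriv_within T (\<lambda>y. \<psi> (F y)) (x, t) (deriv_within UNIV (\<lambda>x. (x, t)) x u)"
    by (rule deriv_within_compose[where F = "\<lambda>x. (x, t)" and f = "\<lambda>y. \<psi> (F y)",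
          OF admissible_UNIV UNIV_I leaf_map(3,2)[OF t] smooth_pull[OF psi]])
  then show ?thesis unfolding leaf_map(4)[OF t] deriv_pull[OF leaf_map(1)[OF t] psi] .
qed

text \<open>In the coordinates of the leaf through \<open>p\<close>, \<open>rho\<close> times the
  components of the dual field is a periodic field on \<open>'b\<close> with Euclidean divergence
  \<open>rho * div1 \<eta>\<close>. Nonnegativity along the leaf then forces 0.\<close>

theorem div1_zero:
  assumes sm: "\<And>w. smooth_on M (\<lambda>p. \<eta> p w)" and lin: "\<And>p. p \<in> M \<Longrightarrow> linear (\<eta> p)"
    and eN: "\<And>p. p \<in> M \<Longrightarrow> \<eta> p (N p) = 0" and per: "per \<eta>"
    and nonneg: "\<And>p. p \<in> M \<Longrightarrow> div1 \<eta> p \<ge> 0" and p: "p \<in> M"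
  shows "div1 \<eta> p = 0"
proof -
  define V where "V = (\<lambda>p. \<Sum>j<m. \<eta> p (E j p) *\<^sub>R E j p)"
  define w where "w = (\<lambda>p. rho p *\<^sub>R fst (cof p (V p)))"
  obtain x t where xt: "Fi p = (x, t)" by fastforce
  have T0: "(x, t) \<in> T" using Fi_in[OF p] xt by simp
  define i where "i = (\<lambda>x :: 'b. (x, t))"
  have iT: "i x \<in> T" for x unfolding i_def by (rule leaf_map(1)[OF T0])
  note V = div1_eq(1)[OF p sm lin eN, folded V_def] and dv = div1_eq(2)[OF _ sm lin eN]
  have "smooth_on M (\<lambda>p. fst (cof p (V p)))"
    by (rule smooth_on_bounded_linear[OF adm bounded_linear_fst smooth_cof[OF V]])
  then have w: "smooth_on M w" unfolding w_def by (intro smooth_on_scaleR adm smooth_rho)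
  have Fi_i: "F (i x) \<in> M" for x by (rule F_in[OF iT])
  let ?W = "\<lambda>x. w (F (i x))"
  have W: "smooth_on UNIV ?W"
    unfolding i_def by (rule smooth_leaf[OF T0 w])
  have perW: "?W (x + b) = ?W x" if b: "b \<in> Basis" for x b
  proof -
    have "per V"
      unfolding V_def per_def by (simp add: perD[OF per] perD[OF per_E])
    from per_cof[OF this] have "per w" unfolding w_def per_def by (simp add: perD[OF per_rho])
    \<comment> \<open>\<open>F\<close> turns the translation by \<open>b\<close> into one by a
      possibly different lattice vector, under which \<open>w\<close> is invariant as well.\<close>
    moreover obtain k' where "k' \<in> \<Lambda>" "F (i x + (b, 0)) = F (i x) + (k', 0)"
      using per_F[OF iT, of b x] b Basis_lattice by blast
    moreover have "i (x + b) = i x + (b, 0)" by (simp add: i_def)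
    ultimately show ?thesis using perD[OF _ Fi_i] by metis
  qed
  have div: "(\<Sum>b\<in>Basis. deriv_within UNIV (\<lambda>x. ?W x \<bullet> b) x b) = rho (F (i x)) * div1 \<eta> (F (i x))" for x
  proof -
    have "(\<Sum>b\<in>Basis. deriv_within UNIV (\<lambda>x. ?W x \<bullet> b) x b) =
        (\<Sum>k<m. deriv_within UNIV (\<lambda>x. ?W x \<bullet> basis_enum k) x (basis_enum k))"
      by (rule sum.reindex_bij_betw[OF bij_be, symmetric])
    also have "\<dots> = (\<Sum>k<m. deriv_within M (\<lambda>p. rho p * (cof p (V p) \<bullet> be k)) (F (i x)) (X (be k) (F (i x))))"
    proof (rule sum.cong[OF refl])
      fix k assume "k \<in> {..<m}"
      then have k: "be k = (basis_enum k, 0)" by (simp add: be_def)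
      have wk: "smooth_on M (\<lambda>p. w p \<bullet> basis_enum k)" by (rule smooth_on_inner[OF adm w])
      have "deriv_within UNIV (\<lambda>x. ?W x \<bullet> basis_enum k) x (basis_enum k) =
          deriv_within M (\<lambda>p. w p \<bullet> basis_enum k) (F (i x)) (X (be k) (F (i x)))"
        unfolding i_def k by (rule deriv_leaf[OF T0 wk])
      also have "\<dots> = deriv_within M (\<lambda>p. rho p * (cof p (V p) \<bullet> be k)) (F (i x)) (X (be k) (F (i x)))"
        by (simp add: w_def k inner_prod_def)
      finally show "deriv_within UNIV (\<lambda>x. ?W x \<bullet> basis_enum k) x (basis_enum k) =
        deriv_within M (\<lambda>p. rho p * (cof p (V p) \<bullet> be k)) (F (i x)) (X (be k) (F (i x)))" .
    qed
    also have "\<dots> = rho (F (i x)) * div1 \<eta> (F (i x))" unfolding V_def by (rule dv[OF Fi_i, symmetric])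
    finally show ?thesis .
  qed
  have "(\<Sum>b\<in>Basis. deriv_within UNIV (\<lambda>x. ?W x \<bullet> b) x b) = 0"
  proof (rule torus_divergence[OF W perW])
    show "0 \<le> (\<Sum>b\<in>Basis. deriv_within UNIV (\<lambda>x. ?W x \<bullet> b) x b)" for x
      unfolding div using nonneg[OF Fi_i] rho_pos[OF Fi_i] by (simp add: less_imp_le)
  qed
  moreover have "F (i x) = p" using F_Fi[OF p] by (simp add: i_def xt)
  ultimately show ?thesis using div[of x] rho_pos[OF p] by simp
qed

end

section \<open>Covariant derivatives of tensors\<close>

context metric_field
begin

text \<open>The covariant derivative of a 1-form, with constant extension of \<open>w\<close>;
  \<open>cd3\<close> is the analogue for three slots.\<close>

definition cd1 :: "('a \<Rightarrow> 'a \<Rightarrow> real) \<Rightarrow> 'a \<Rightarrow> 'a \<Rightarrow> 'a \<Rightarrow> real" where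
  "cd1 \<alpha> p x w = deriv_within S (\<lambda>r. \<alpha> r w) p x - \<alpha> p (Gam p x w)"

lemma deriv_form1:
  assumes p: "p \<in> S" and sm: "\<And>w. smooth_on S (\<lambda>p. \<alpha> p w)" and lin: "\<And>p. p \<in> S \<Longrightarrow> linear (\<alpha> p)" and W: "smooth_on S W"
  shows "deriv_within S (\<lambda>r. \<alpha> r (W r)) p x = cd1 \<alpha> p x (W p) + \<alpha> p (D p x W)"
proof -
  have "deriv_within S (\<lambda>r. \<alpha> r (W r)) p x = deriv_within S (\<lambda>r. \<alpha> r (W p)) p x + \<alpha> p (deriv_within S W p x)"
    by (rule deriv_within_linear_family[where L = \<alpha>, OF adm p sm lin W])
  then show ?thesis by (simp add: cd1_def nab_def linear_add[OF lin[OF p]])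
qed

definition form3 :: "('a \<Rightarrow> 'a \<Rightarrow> 'a \<Rightarrow> 'a \<Rightarrow> real) \<Rightarrow> bool" where
  "form3 \<tau> \<longleftrightarrow> (\<forall>x y z. smooth_on S (\<lambda>p. \<tau> p x y z)) \<and>
    (\<forall>p\<in>S. (\<forall>y z. linear (\<lambda>x. \<tau> p x y z)) \<and> (\<forall>x z. linear (\<lambda>y. \<tau> p x y z)) \<and> (\<forall>x y. linear (\<lambda>z. \<tau> p x y z)))"

lemma form3D:
  assumes "form3 \<tau>"
  shows "smooth_on S (\<lambda>p. \<tau> p x y z)" "p \<in> S \<Longrightarrow> linear (\<lambda>x. \<tau> p x y z)"
    "p \<in> S \<Longrightarrow> linear (\<lambda>y. \<tau> p x y z)" "p \<in> S \<Longrightarrow> linear (\<tau> p x y)"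
  using assms unfolding form3_def by blast+

lemma smooth_form3:
  assumes t: "form3 \<tau>" and U: "smooth_on S U" and V: "smooth_on S V" and W: "smooth_on S W"
  shows "smooth_on S (\<lambda>p. \<tau> p (U p) (V p) (W p))"
proof (rule smooth_on_linear_family[where L = "\<lambda>p. \<tau> p (U p) (V p)", OF adm _ form3D(4)[OF t] W])
  fix z
  show "smooth_on S (\<lambda>p. \<tau> p (U p) (V p) z)"
  proof (rule smooth_on_linear_family[where L = "\<lambda>p y. \<tau> p (U p) y z", OF adm _ form3D(3)[OF t] V])
    fix y
    show "smooth_on S (\<lambda>p. \<tau> p (U p) y z)"
      by (rule smooth_on_linear_family[where L = "\<lambda>p x. \<tau> p x y z", OF adm form3D(1)[OF t] form3D(2)[OF t] U])
  qed
qed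

definition cd3 :: "('a \<Rightarrow> 'a \<Rightarrow> 'a \<Rightarrow> 'a \<Rightarrow> real) \<Rightarrow> 'a \<Rightarrow> 'a \<Rightarrow> 'a \<Rightarrow> 'a \<Rightarrow> 'a \<Rightarrow> real" where
  "cd3 \<tau> p w x y z = deriv_within S (\<lambda>r. \<tau> r x y z) p w - \<tau> p (Gam p w x) y z - \<tau> p x (Gam p w y) z - \<tau> p x y (Gam p w z)"

lemma deriv_form3:
  assumes p: "p \<in> S" and t: "form3 \<tau>" and U: "smooth_on S U" and V: "smooth_on S V" and W: "smooth_on S W"
  shows "deriv_within S (\<lambda>r. \<tau> r (U r) (V r) (W r)) p w = cd3 \<tau> p w (U p) (V p) (W p)
    + \<tau> p (D p w U) (V p) (W p) + \<tau> p (U p) (D p w V) (W p) + \<tau> p (U p) (V p) (D p w W)"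
proof -
  note c = smooth_on_const[OF adm]
  have "deriv_within S (\<lambda>r. \<tau> r (U r) (V r) (W r)) p w =
      deriv_within S (\<lambda>r. \<tau> r (U r) (V r) (W p)) p w + \<tau> p (U p) (V p) (deriv_within S W p w)"
    by (rule deriv_within_linear_family[where L = "\<lambda>p. \<tau> p (U p) (V p)", OF adm p smooth_form3[OF t U V c] form3D(4)[OF t] W])
  also have "deriv_within S (\<lambda>r. \<tau> r (U r) (V r) (W p)) p w =
      deriv_within S (\<lambda>r. \<tau> r (U r) (V p) (W p)) p w + \<tau> p (U p) (deriv_within S V p w) (W p)"
    by (rule deriv_within_linear_family[where L = "\<lambda>r y. \<tau> r (U r) y (W p)", OF adm p smooth_form3[OF t U c c] form3D(3)[OF t] V])
  also have "deriv_within S (\<lambda>r. \<tau> r (U r) (V p) (W p)) p w =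
      deriv_within S (\<lambda>r. \<tau> r (U p) (V p) (W p)) p w + \<tau> p (deriv_within S U p w) (V p) (W p)"
    by (rule deriv_within_linear_family[where L = "\<lambda>r x. \<tau> r x (V p) (W p)", OF adm p form3D(1)[OF t] form3D(2)[OF t] U])
  finally show ?thesis
    by (simp add: cd3_def nab_def linear_add[OF form3D(2)[OF t p]] linear_add[OF form3D(3)[OF t p]] linear_add[OF form3D(4)[OF t p]])
qed

lemma smooth_nabq:
  assumes q: "form_field S q" shows "smooth_on S (\<lambda>p. nabq S g q p x y z)"
  unfolding nabq_def
  by (intro smooth_on_diff smooth_on_deriv_within adm form_fieldD(1)[OF q] smooth_on_form[OF adm q] smooth_Gam_const smooth_on_const)

end

section \<open>The rigidity argument\<close>

text \<open>The geometric input in the form used by the argument: \<open>leaf\<close> is the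
  vanishing of the null second fundamental form, \<open>gauss\<close> is flatness of the leaves seen
  from \<open>M\<close>, \<open>mu_J\<close> is \<open>\<mu> + J(N) = 0\<close> after the purely
  tangential terms have cancelled by \<open>gauss\<close>, and \<open>J_tan\<close> is the equality
  case of the dominant energy condition.\<close>

locale rigid_foliation = foliation M g T F Fi \<Lambda> m
  for M :: "('b::euclidean_space \<times> real) set" and g T F Fi \<Lambda> m +
  fixes q :: "'b \<times> real \<Rightarrow> 'b \<times> real \<Rightarrow> 'b \<times> real \<Rightarrow> real"
  assumes q_form: "form_field M q" and q_sym: "\<And>p u v. p \<in> M \<Longrightarrow> q p u v = q p v u"
    and per_q: "\<And>p k. p \<in> M \<Longrightarrow> k \<in> \<Lambda> \<Longrightarrow> q (p + (k, 0)) = q p"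
    and leaf: "\<And>p u v. p \<in> M \<Longrightarrow> snd u = 0 \<Longrightarrow> snd v = 0 \<Longrightarrow> g p (D p (X u p) N) (X v p) = - q p (X u p) (X v p)"
    and gauss: "\<And>p u v w z. p \<in> M \<Longrightarrow> snd u = 0 \<Longrightarrow> snd v = 0 \<Longrightarrow> snd w = 0 \<Longrightarrow> snd z = 0 \<Longrightarrow>
      Rm p (X u p) (X v p) (X w p) (X z p) + q p (X v p) (X w p) * q p (X u p) (X z p) - q p (X u p) (X w p) * q p (X v p) (X z p) = 0"
    and mu_J: "\<And>p. p \<in> M \<Longrightarrow> (\<Sum>i<m. Rm p (N p) (E i p) (E i p) (N p) + q p (E i p) (E i p) * q p (N p) (N p)
        - q p (N p) (E i p) * q p (E i p) (N p)
        - (nabq M g q p (N p) (E i p) (E i p) - nabq M g q p (E i p) (N p) (E i p))) = 0"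
    and J_tan: "\<And>p w. p \<in> M \<Longrightarrow> g p w (N p) = 0 \<Longrightarrow>
        (\<Sum>j<m. nabq M g q p (E j p) w (E j p) - nabq M g q p w (E j p) (E j p))
        + (nabq M g q p (N p) w (N p) - nabq M g q p w (N p) (N p)) = 0"
begin

abbreviation nq where "nq p x y z \<equiv> nabq M g q p x y z"

definition C where "C p x y z = nq p x y z - nq p y x z"

definition hR where "hR p x y z w = Rm p x y z w + q p y z * q p x w - q p x z * q p y w"

abbreviation tang where "tang p v \<equiv> g p v (N p) = 0"

lemmas qb = bilinear_simps[OF form_fieldD(2)[OF q_form]]
lemmas sN = smooth_E[OF order_refl]

lemma g_N_N: "p \<in> M \<Longrightarrow> g p (N p) (N p) = 1"
  by (simp add: g_E)

lemma tang_E: "p \<in> M \<Longrightarrow> i < m \<Longrightarrow> tang p (E i p)"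
  by (simp add: g_E)

lemma g_N_E: "p \<in> M \<Longrightarrow> i < m \<Longrightarrow> g p (N p) (E i p) = 0"
  by (simp add: g_E)

lemma tang_X: "p \<in> M \<Longrightarrow> snd u = 0 \<Longrightarrow> tang p (X u p)"
  by (simp add: g_X_N)

lemma tang_cases:
  assumes "p \<in> M" "tang p v"
  obtains u where "snd u = 0" "v = X u p"
  using assms X_cof[of p v] tangent_iff[of p v] by metis

lemma leaf': "p \<in> M \<Longrightarrow> tang p u \<Longrightarrow> tang p v \<Longrightarrow> g p (D p u N) v = - q p u v"
  by (metis leaf tang_cases)

lemma gauss': 
  assumes p: "p \<in> M" and t: "tang p x" "tang p y" "tang p z" "tang p w" shows "hR p x y z w = 0"
proof -
  obtain a b c d where "snd a = 0" "x = X a p" "snd b = 0" "y = X b p" "snd c = 0" "z = X c p" "snd d = 0" "w = X d p"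
    using t tang_cases[OF p] by metis
  then show ?thesis using gauss[OF p, of a b c d] by (simp add: hR_def)
qed

lemma g_D_N_N: assumes p: "p \<in> M" shows "g p (D p x N) (N p) = 0"
proof -
  have "deriv_within M (\<lambda>r. g r (N r) (N r)) p x = deriv_within M (\<lambda>_. 1) p x"
    by (rule deriv_within_cong[OF _ p]) (rule g_N_N)
  then show ?thesis using metric_compat[OF p sN sN] g_sym[OF p, of "N p"] by (simp add: adm p)
qed

text \<open>Orthogonal projection to the tangent spaces of the leaves.\<close>

definition tp where "tp p v = v - g p v (N p) *\<^sub>R N p"

lemma tang_tp: "p \<in> M \<Longrightarrow> tang p (tp p v)"
  by (simp add: tp_def gb g_N_N)

lemma tp_id: "tang p v \<Longrightarrow> tp p v = v"
  by (simp add: tp_def)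

text \<open>The last term removes the normal component, so that the form vanishes on
  \<open>N\<close> and \<open>div1_zero\<close> applies.\<close>

definition eta where
  "eta p w = g p (D p (N p) N) w + q p (N p) w - q p (N p) (N p) * g p (N p) w"

lemma linear_eta: "p \<in> M \<Longrightarrow> linear (eta p)"
  by (rule linearI) (simp_all add: eta_def gb qb algebra_simps)

lemma smooth_eta: "smooth_on M (\<lambda>p. eta p w)"
  unfolding eta_def
  by (intro smooth_on_add smooth_on_diff smooth_on_mult adm smooth_g smooth_D sN smooth_on_const smooth_on_form[OF adm q_form])

lemma eta_N: "p \<in> M \<Longrightarrow> eta p (N p) = 0"
  by (simp add: eta_def g_D_N_N g_N_N)

lemma per_eta: "per eta"
  unfolding per_def
proof (intro ballI ext)
  fix p k w assume pk: "p \<in> M" "k \<in> \<Lambda>"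
  show "eta (p + (k, 0)) w = eta p w"
    unfolding eta_def perD[OF per_E pk] fun_cong[OF perD[OF per_nab[OF sN per_E] pk]] per_g[OF pk] per_q[OF pk] ..
qed

text \<open>The value of <nabla_u N, w> for arbitrary \<open>u\<close> and \<open>w\<close>: its
  tangential block is \<open>- q\<close> by \<open>leaf\<close>, and \<open>eta\<close> accounts for
  \<open>u\<close> in direction \<open>N\<close>.\<close>

definition Sf where
  "Sf p u w = - q p u w + q p u (N p) * g p (N p) w + g p u (N p) * eta p w"

lemma g_D_N: assumes p: "p \<in> M" shows "g p (D p u N) w = Sf p u w"
proof -
  let ?a = "g p u (N p)" and ?b = "g p w (N p)"
  note l = linear_D[OF p sN]
  have "D p u N = D p (tp p u) N + ?a *\<^sub>R D p (N p) N"
    unfolding linear_scale[OF l, symmetric] linear_add[OF l, symmetric] by (simp add: tp_def)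
  then have "g p (D p u N) w = g p (D p (tp p u) N) w + ?a * g p (D p (N p) N) w"
    by (simp add: gb[OF p])
  also have "g p (D p (tp p u) N) w = g p (D p (tp p u) N) (tp p w)"
    by (simp add: tp_def[of p w] gb[OF p] g_D_N_N[OF p])
  also have "\<dots> = - q p (tp p u) (tp p w)" by (rule leaf'[OF p tang_tp[OF p] tang_tp[OF p]])
  also have "\<dots> + ?a * g p (D p (N p) N) w = Sf p u w"
    by (simp add: tp_def Sf_def eta_def qb[OF p] g_sym[OF p, of "N p" w] algebra_simps)
  finally show ?thesis .
qed

text \<open>The formula for <nabla_y N, w> is differentiated along \<open>x\<close> with constant
  extensions. Terms containing \<open>Gam p x y\<close> are symmetric and disappear on
  antisymmetrizing.\<close>

lemma Rm_N:
  assumes p: "p \<in> M"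
  shows "Rm p x y (N p) w = - C p x y w
    + (nq p x y (N p) + q p y (D p x N) - nq p y x (N p) - q p x (D p y N)) * g p (N p) w
    + q p y (N p) * Sf p x w - q p x (N p) * Sf p y w + (Sf p x y - Sf p y x) * eta p w
    + g p y (N p) * cd1 eta p x w - g p x (N p) * cd1 eta p y w"
proof -
  note c = smooth_on_const[OF adm]
  have DG: "D p u (\<lambda>_. v) = Gam p u v" for u v by (simp add: nab_def adm p)
  have sq: "smooth_on M (\<lambda>r. q r y w)" "smooth_on M (\<lambda>r. q r y (N r))" "smooth_on M (\<lambda>r. g r (N r) w)" "smooth_on M (\<lambda>r. g r y (N r))" for y w
    by (intro smooth_on_form[OF adm q_form] smooth_g c sN)+
  have d: "deriv_within M (\<lambda>r. g r (D r y N) w) p x - g p (D p y N) (Gam p x w) = 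
     - nq p x y w - q p (Gam p x y) w
     + (nq p x y (N p) + q p (Gam p x y) (N p) + q p y (D p x N)) * g p (N p) w + q p y (N p) * Sf p x w 
     + (g p (Gam p x y) (N p) + Sf p x y) * eta p w
     + g p y (N p) * cd1 eta p x w" for x y
  proof -
    have "deriv_within M (\<lambda>r. g r (D r y N) w) p x = deriv_within M (\<lambda>r. Sf r y w) p x"
      by (rule deriv_within_cong[OF _ p]) (rule g_D_N)
    also have "\<dots> = - deriv_within M (\<lambda>r. q r y w) p x
      + (deriv_within M (\<lambda>r. q r y (N r)) p x * g p (N p) w + q p y (N p) * deriv_within M (\<lambda>r. g r (N r) w) p x)
      + (deriv_within M (\<lambda>r. g r y (N r)) p x * eta p w + g p y (N p) * deriv_within M (\<lambda>r. eta r w) p x)"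
      unfolding Sf_def
      by (simp only: deriv_within_add[OF adm p smooth_on_add[OF adm smooth_on_minus[OF adm sq(1)] smooth_on_mult[OF adm sq(2,3)]] smooth_on_mult[OF adm sq(4) smooth_eta]]
        deriv_within_add[OF adm p smooth_on_minus[OF adm sq(1)] smooth_on_mult[OF adm sq(2,3)]]
        deriv_within_minus[OF adm p sq(1)] deriv_within_mult[OF adm p sq(2,3)] deriv_within_mult[OF adm p sq(4) smooth_eta])
    also have "deriv_within M (\<lambda>r. q r y w) p x = nq p x y w + q p (Gam p x y) w + q p y (Gam p x w)"
      by (simp add: nabq_def)
    also have "deriv_within M (\<lambda>r. q r y (N r)) p x = nq p x y (N p) + q p (Gam p x y) (N p) + q p y (D p x N)"
      using deriv_tensor[OF p q_form c[of y] sN, of x] unfolding DG by simp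
    also have "deriv_within M (\<lambda>r. g r (N r) w) p x = Sf p x w + g p (N p) (Gam p x w)"
      using metric_compat[OF p sN c[of w], of x] unfolding DG g_D_N[OF p] .
    also have "deriv_within M (\<lambda>r. g r y (N r)) p x = g p (Gam p x y) (N p) + Sf p x y"
      using metric_compat[OF p c[of y] sN, of x] unfolding DG g_sym[OF p, of y] g_D_N[OF p] .
    also have "deriv_within M (\<lambda>r. eta r w) p x = cd1 eta p x w + eta p (Gam p x w)"
      by (simp add: cd1_def)
    finally show ?thesis unfolding g_D_N[OF p] by (simp add: Sf_def algebra_simps)
  qed
  have lb: "lie_bracket M (\<lambda>_. x) (\<lambda>_. y) p = 0" by (simp add: lie_bracket_def adm p)
  have z: "D p 0 N = 0" using linear_0[OF linear_D[OF p sN]] .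
  have "Rm p x y (N p) w = (deriv_within M (\<lambda>r. g r (D r y N) w) p x - g p (D p y N) (Gam p x w))
     - (deriv_within M (\<lambda>r. g r (D r x N) w) p y - g p (D p x N) (Gam p y w))"
    using Rm_via_metric[OF p c[of x] c[of y] sN c[of w]] unfolding DG lb z by (simp add: gb[OF p])
  then show ?thesis unfolding d Gam_sym[OF p, of y x] C_def by (simp add: algebra_simps)
qed

text \<open>Codazzi equation for the shape operator \<open>- q\<close>: the products of
  \<open>q\<close> that it produces are exactly those added to the curvature in \<open>hR\<close>.
  The sign of \<open>C\<close> comes out as plus.\<close>

lemma hR_codazzi:
  assumes p: "p \<in> M" and t: "tang p x" "tang p y" "tang p z"
  shows "hR p x y z (N p) = C p x y z"
proof -
  have N: "g p (N p) z = 0" using t g_sym[OF p] by simp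
  have "Rm p x y (N p) z = - C p x y z + q p y (N p) * (- q p x z) - q p x (N p) * (- q p y z)"
    unfolding Rm_N[OF p] using t N g_sym[OF p, of "N p"] q_sym[OF p, of x y] by (simp add: Sf_def)
  then show ?thesis using Rm_antisym2[OF p, of x y z "N p"] q_sym[OF p] by (simp add: hR_def)
qed

text \<open>Riccati equation of the shape operator in direction \<open>N\<close>; its products of
  \<open>q\<close> are again absorbed by \<open>hR\<close>.\<close>

lemma hR_normal:
  assumes p: "p \<in> M" and t: "tang p v" "tang p w"
  shows "hR p (N p) v w (N p) = C p (N p) v w - eta p v * eta p w + cd1 eta p v w"
proof -
  have N: "g p (N p) v = 0" "g p (N p) w = 0" using t g_sym[OF p] by auto
  have "Rm p (N p) v (N p) w = - C p (N p) v w + q p v (N p) * (- q p (N p) w + eta p w)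
     + q p (N p) (N p) * q p v w + (- q p (N p) v + eta p v) * eta p w - cd1 eta p v w"
    unfolding Rm_N[OF p] using t N by (simp add: Sf_def g_N_N[OF p] eta_N[OF p])
  then show ?thesis
    using Rm_antisym2[OF p, of "N p" v w "N p"] q_sym[OF p, of v "N p"] by (simp add: hR_def algebra_simps)
qed

lemma div1_cd1:
  assumes "p \<in> M" "\<And>w. smooth_on M (\<lambda>p. \<alpha> p w)" "\<And>p. p \<in> M \<Longrightarrow> linear (\<alpha> p)"
  shows "div1 \<alpha> p = (\<Sum>i<m. cd1 \<alpha> p (E i p) (E i p))"
  unfolding div1_def by (intro sum.cong refl) (simp add: deriv_form1[OF assms smooth_E])

lemma eta_zero: assumes p: "p \<in> M" shows "eta p w = 0"
proof -
  \<comment> \<open>Tracing \<open>hR_normal\<close> and comparing with \<open>mu_J\<close> leaves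
    only the terms in \<open>eta\<close>.\<close>
  have dv: "div1 eta p = (\<Sum>i<m. (eta p (E i p))\<^sup>2)" if p: "p \<in> M" for p
  proof -
    have "(\<Sum>i<m. hR p (N p) (E i p) (E i p) (N p) - C p (N p) (E i p) (E i p)) = 0"
      using mu_J[OF p] by (simp add: hR_def C_def)
    also have "(\<Sum>i<m. hR p (N p) (E i p) (E i p) (N p) - C p (N p) (E i p) (E i p)) =
        (\<Sum>i<m. cd1 eta p (E i p) (E i p) - (eta p (E i p))\<^sup>2)"
      by (intro sum.cong refl) (simp add: hR_normal[OF p] tang_E[OF p] power2_eq_square)
    finally show ?thesis using div1_cd1[OF p smooth_eta linear_eta] by (simp add: sum_subtractf)
  qed
  have "div1 eta p = 0"
  proof (rule div1_zero[OF smooth_eta linear_eta eta_N per_eta _ p])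
    show "0 \<le> div1 eta p" if "p \<in> M" for p unfolding dv[OF that] by (rule sum_nonneg) simp
  qed
  then have "eta p (E i p) = 0" if "i < m" for i
    using that unfolding dv[OF p] by (simp add: sum_nonneg_eq_0_iff)
  moreover have "eta p w = eta p ((\<Sum>a<m. g p w (E a p) *\<^sub>R E a p) + g p w (N p) *\<^sub>R N p)"
    by (rule arg_cong[OF E_expand[OF p]])
  ultimately show ?thesis
    using linear_eta[OF p] eta_N[OF p] by (simp add: linear_add linear_sum linear_scale)
qed

lemma Sf_eq: "p \<in> M \<Longrightarrow> Sf p u w = - q p u w + q p u (N p) * g p (N p) w"
  by (simp add: Sf_def eta_zero)

lemma hR_normal': "p \<in> M \<Longrightarrow> tang p v \<Longrightarrow> tang p w \<Longrightarrow> hR p (N p) v w (N p) = C p (N p) v w"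
proof -
  assume a: "p \<in> M" "tang p v" "tang p w"
  have "deriv_within M (\<lambda>r. eta r w) p v = deriv_within M (\<lambda>_. 0) p v"
    by (rule deriv_within_cong[OF _ a(1)]) (rule eta_zero)
  then have "cd1 eta p v w = 0" by (simp add: cd1_def eta_zero a adm)
  then show ?thesis using hR_normal[OF a] by (simp add: eta_zero a)
qed

text \<open>The symmetry of the right-hand side in \<open>x\<close> and \<open>y\<close> is the
  point: it removes these terms in \<open>C_N\<close>.\<close>

lemma q_D_N: assumes p: "p \<in> M" shows "q p y (D p x N) = - (\<Sum>a<m. q p x (E a p) * q p y (E a p))"
proof -
  have "D p x N = (\<Sum>a<m. g p (D p x N) (E a p) *\<^sub>R E a p)"
    by (rule E_expand_tan[OF p g_D_N_N[OF p]])
  also have "\<dots> = (\<Sum>a<m. (- q p x (E a p)) *\<^sub>R E a p)"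
    by (intro sum.cong refl) (simp add: g_D_N[OF p] Sf_eq[OF p] g_N_E[OF p])
  finally have "q p y (D p x N) = q p y (\<Sum>a<m. (- q p x (E a p)) *\<^sub>R E a p)" by simp
  then show ?thesis by (simp only: qb[OF p] real_scaleR_def) (simp add: sum_negf)
qed

definition beta where "beta p w = q p w (N p)"

lemma smooth_beta: "smooth_on M V \<Longrightarrow> smooth_on M (\<lambda>p. beta p (V p))"
  unfolding beta_def by (rule smooth_on_form[OF adm q_form _ sN])

lemma deriv_beta:
  assumes p: "p \<in> M" and V: "smooth_on M V"
  shows "deriv_within M (\<lambda>r. beta r (V r)) p x = nq p x (V p) (N p) + beta p (D p x V) + q p (V p) (D p x N)"
  unfolding beta_def by (rule deriv_tensor[OF p q_form V sN])

text \<open>On commuting fields the right-hand side is the exterior derivative of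
  \<open>beta\<close>; the terms with derivatives of the fields and of \<open>N\<close> are
  symmetric and cancel.\<close>

lemma C_N: assumes p: "p \<in> M"
  shows "C p (X u p) (X v p) (N p) = deriv_within M (\<lambda>r. beta r (X v r)) p (X u p) - deriv_within M (\<lambda>r. beta r (X u r)) p (X v p)"
  unfolding deriv_beta[OF p smooth_X] C_def D_X_commute[OF p, of v u] q_D_N[OF p] by (simp add: mult.commute)

text \<open>\<open>X u\<close> commutes with the time field, so both terms of the product rule can
  be expressed by derivatives of \<open>N\<close>. The two values of \<open>q\<close> on
  \<open>X u\<close> and the time field cancel, and \<open>beta\<close> times the lapse is
  left.\<close>

lemma deriv_lapse:
  assumes p: "p \<in> M" and u: "snd u = 0"
  shows "deriv_within M lapse p (X u p) = lapse p * beta p (X u p)"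
proof -
  let ?t = "(0, 1) :: 'b \<times> real"
  have "deriv_within M lapse p (X u p) = g p (D p (X u p) (X ?t)) (N p) + g p (X ?t p) (D p (X u p) N)"
    unfolding lapse_def[abs_def] by (rule metric_compat[OF p smooth_X sN])
  also have "g p (D p (X u p) (X ?t)) (N p) = g p (D p (X ?t p) (X u)) (N p)" by (simp only: D_X_commute[OF p, of u])
  also have "\<dots> = - g p (X u p) (D p (X ?t p) N)"
  proof -
    have "deriv_within M (\<lambda>r. g r (X u r) (N r)) p (X ?t p) = deriv_within M (\<lambda>_. 0) p (X ?t p)"
      by (rule deriv_within_cong[OF _ p]) (rule tang_X[OF _ u])
    then show ?thesis using metric_compat[OF p smooth_X sN, of u "X ?t p"] by (simp add: adm p)
  qed
  also have "\<dots> = q p (X ?t p) (X u p)"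
    unfolding g_sym[OF p, of "X u p"] g_D_N[OF p] Sf_eq[OF p] using tang_X[OF p u] g_sym[OF p, of "N p"] by simp
  also have "g p (X ?t p) (D p (X u p) N) = - q p (X u p) (X ?t p) + beta p (X u p) * lapse p"
    unfolding g_sym[OF p, of "X ?t p"] g_D_N[OF p] Sf_eq[OF p] beta_def lapse_def using g_sym[OF p, of "N p"] by simp
  finally show ?thesis using q_sym[OF p, of "X u p"] by simp
qed

lemma deriv_lapse_tan: "p \<in> M \<Longrightarrow> tang p v \<Longrightarrow> deriv_within M lapse p v = lapse p * beta p v"
  by (metis deriv_lapse tang_cases)

definition lnf where "lnf p = ln (lapse p)"

lemma smooth_lnf: "smooth_on M lnf"
  unfolding lnf_def[abs_def] by (rule smooth_on_ln[OF adm lapse_pos smooth_lapse])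

lemma beta_lnf: "p \<in> M \<Longrightarrow> snd u = 0 \<Longrightarrow> beta p (X u p) = deriv_within M lnf p (X u p)"
  unfolding lnf_def[abs_def] using lapse_pos[of p] by (simp add: deriv_within_ln[OF adm _ smooth_lapse] deriv_lapse)

lemma linear_C:
  assumes p: "p \<in> M"
  shows "linear (\<lambda>x. C p x y z)" "linear (\<lambda>y. C p x y z)" "linear (\<lambda>z. C p x y z)"
  unfolding C_def
  using linear_compose_sub[OF linear_nabq(1)[OF p q_form] linear_nabq(2)[OF p q_form]]
    linear_compose_sub[OF linear_nabq(2)[OF p q_form] linear_nabq(1)[OF p q_form]]
    linear_compose_sub[OF linear_nabq(3)[OF p q_form] linear_nabq(3)[OF p q_form]] by auto

text \<open>Along the leaves \<open>beta\<close> is the differential of the logarithm of the lapse,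
  hence closed.\<close>

theorem C_tan_N:
  assumes p: "p \<in> M" and t: "tang p x" "tang p y" shows "C p x y (N p) = 0"
proof -
  obtain u v where uv: "snd u = 0" "x = X u p" "snd v = 0" "y = X v p" using t tang_cases[OF p] by metis
  have e: "deriv_within M (\<lambda>r. beta r (X v r)) p w = deriv_within M (\<lambda>r. deriv_within M lnf r (X v r)) p w" if "snd v = 0" for v w
    by (rule deriv_within_cong[OF _ p]) (rule beta_lnf[OF _ that])
  show ?thesis unfolding uv(2,4) C_N[OF p] e[OF uv(1)] e[OF uv(3)] using X_commute[OF p smooth_lnf, of u v] by simp
qed

abbreviation Xt where "Xt \<equiv> X (0, 1)"

text \<open>The amount by which \<open>beta\<close> fails to be \<open>d lnf\<close> on the time
  field: in leaf coordinates \<open>beta = d lnf - phi dt\<close>.\<close>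

definition phi where "phi p = deriv_within M lnf p (Xt p) - beta p (Xt p)"

lemma smooth_phi: "smooth_on M phi"
  unfolding phi_def[abs_def] by (intro smooth_on_diff adm smooth_on_deriv_within_field smooth_lnf smooth_X smooth_beta)

text \<open>Mixed component of the exterior derivative of \<open>beta\<close>. The tangential part
  of the time field contributes nothing by \<open>C_tan_N\<close>, which leaves the lapse times the
  value at \<open>N\<close>.\<close>

lemma deriv_phi:
  assumes p: "p \<in> M" and t: "tang p x"
  shows "deriv_within M phi p x = lapse p * C p (N p) x (N p)"
proof -
  obtain u where u: "snd u = 0" "x = X u p" using t tang_cases[OF p] by metis
  have "deriv_within M phi p (X u p) = deriv_within M (\<lambda>r. deriv_within M lnf r (Xt r)) p (X u p) - deriv_within M (\<lambda>r. beta r (Xt r)) p (X u p)"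
    unfolding phi_def[abs_def] by (rule deriv_within_diff[OF adm p smooth_on_deriv_within_field[OF adm smooth_lnf smooth_X] smooth_beta[OF smooth_X]])
  also have "deriv_within M (\<lambda>r. deriv_within M lnf r (Xt r)) p (X u p) = deriv_within M (\<lambda>r. deriv_within M lnf r (X u r)) p (Xt p)"
    by (rule X_commute[OF p smooth_lnf])
  also have "\<dots> = deriv_within M (\<lambda>r. beta r (X u r)) p (Xt p)"
    by (rule deriv_within_cong[OF _ p]) (simp add: beta_lnf u(1))
  also have "\<dots> - deriv_within M (\<lambda>r. beta r (Xt r)) p (X u p) = C p (Xt p) (X u p) (N p)"
    by (rule C_N[OF p, symmetric])
  also have "C p (Xt p) (X u p) (N p) = C p (tp p (Xt p)) (X u p) (N p) + lapse p * C p (N p) (X u p) (N p)"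
  proof -
    have "Xt p = tp p (Xt p) + lapse p *\<^sub>R N p" by (simp add: tp_def lapse_def)
    from arg_cong[OF this, of "\<lambda>x. C p x (X u p) (N p)"] show ?thesis
      by (simp only: linear_add[OF linear_C(1)[OF p]] linear_scale[OF linear_C(1)[OF p]] real_scaleR_def)
  qed
  also have "C p (tp p (Xt p)) (X u p) (N p) = 0" by (rule C_tan_N[OF p tang_tp[OF p] tang_X[OF p u(1)]])
  finally show ?thesis by (simp add: u(2))
qed

end

section \<open>The induced connection on fields tangent to the leaves and its curvature\<close>

context rigid_foliation
begin

definition tau where "tau p x y z = lapse p * C p x y z"

lemma tau_antisym: "tau p x y z = - tau p y x z"
  by (simp add: tau_def C_def algebra_simps)

lemma form3_tau: "form3 tau"
  unfolding form3_def
proof (intro conjI allI ballI)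
  show "smooth_on M (\<lambda>p. tau p x y z)" for x y z
    unfolding tau_def C_def by (intro smooth_on_mult smooth_on_diff smooth_lapse smooth_nabq q_form adm)
  have s: "linear f \<Longrightarrow> linear (\<lambda>x. c * f x)" for f :: "'b \<times> real \<Rightarrow> real" and c
    by (rule linearI) (simp_all add: linear_add linear_scale algebra_simps)
  show "linear (\<lambda>x. tau p x y z)" "linear (\<lambda>y. tau p x y z)" "linear (\<lambda>z. tau p x y z)" if "p \<in> M" for p x y z
    unfolding tau_def by (intro s linear_C that)+
qed

lemmas smooth_tau = smooth_form3[OF form3_tau]
lemmas linear_tau = form3D(2-4)[OF form3_tau]

text \<open>For tangential \<open>V\<close> the subtracted term is the normal component of
  \<open>D p w V\<close>, also in transverse directions \<open>w\<close>, because \<open>eta\<close>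
  is 0. So \<open>Bp\<close> is the connection induced on the tangent bundle of the leaves.\<close>

definition Bp where "Bp p w V = D p w V - q p w (V p) *\<^sub>R N p"

abbreviation BX where "BX u V \<equiv> \<lambda>p. Bp p (X u p) V"

definition tf where "tf V \<longleftrightarrow> smooth_on M V \<and> (\<forall>p\<in>M. tang p (V p))"

lemma tfD: "tf V \<Longrightarrow> smooth_on M V" "tf V \<Longrightarrow> p \<in> M \<Longrightarrow> tang p (V p)"
  by (simp_all add: tf_def)

lemma tf_E: "i < m \<Longrightarrow> tf (E i)"
  by (simp add: tf_def smooth_E tang_E)

lemma g_D_tf_N:
  assumes p: "p \<in> M" and V: "tf V" shows "g p (D p w V) (N p) = q p w (V p)"
proof -
  have "deriv_within M (\<lambda>r. g r (V r) (N r)) p w = deriv_within M (\<lambda>_. 0) p w"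
    by (rule deriv_within_cong[OF _ p]) (rule tfD(2)[OF V])
  then have "g p (D p w V) (N p) + g p (V p) (D p w N) = 0"
    using metric_compat[OF p tfD(1)[OF V] sN] by (simp add: adm p)
  moreover have "g p (V p) (D p w N) = - q p w (V p)"
    unfolding g_sym[OF p, of "V p"] g_D_N[OF p] Sf_eq[OF p] using tfD(2)[OF V p] g_sym[OF p, of "N p"] by simp
  ultimately show ?thesis by simp
qed

lemma Bp_tang: "p \<in> M \<Longrightarrow> tf V \<Longrightarrow> tang p (Bp p w V)"
  by (simp add: Bp_def gb g_D_tf_N g_N_N)

lemma Bp_tp: "p \<in> M \<Longrightarrow> tf V \<Longrightarrow> Bp p w V = tp p (D p w V)"
  by (simp add: Bp_def tp_def g_D_tf_N)

lemma smooth_BX: "smooth_on M V \<Longrightarrow> smooth_on M (BX u V)"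
  unfolding Bp_def by (intro smooth_on_diff smooth_on_scaleR adm smooth_D smooth_X smooth_on_form[OF adm q_form] sN)

lemma tf_BX: "tf V \<Longrightarrow> tf (BX u V)"
  using Bp_tang[of _ V] smooth_BX[of V u] by (simp add: tf_def)

lemma Bp_diff:
  assumes p: "p \<in> M" and "smooth_on M V" "smooth_on M W"
  shows "Bp p w (\<lambda>r. V r - W r) = Bp p w V - Bp p w W"
  by (simp add: Bp_def D_diff[OF assms] qb[OF p] scaleR_diff_left)

lemma Bp_cong: "p \<in> M \<Longrightarrow> (\<And>r. r \<in> M \<Longrightarrow> V r = W r) \<Longrightarrow> Bp p w V = Bp p w W"
  using D_cong[of p V W w] by (simp add: Bp_def)

lemma metric_B:
  assumes p: "p \<in> M" and V: "tf V" and W: "tf W"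
  shows "deriv_within M (\<lambda>r. g r (V r) (W r)) p w = g p (Bp p w V) (W p) + g p (V p) (Bp p w W)"
proof -
  have "g p (N p) (W p) = 0" "g p (V p) (N p) = 0" using tfD(2)[OF W p] tfD(2)[OF V p] g_sym[OF p] by auto
  then show ?thesis using metric_compat[OF p tfD(1)[OF V] tfD(1)[OF W]] by (simp add: Bp_def gb[OF p])
qed

lemma B_B:
  assumes p: "p \<in> M" and V: "tf V" and w: "tang p w"
  shows "g p (BX u (BX v V) p) w = g p (D p (X u p) (\<lambda>r. D r (X v r) V)) w + q p (X v p) (V p) * q p (X u p) w"
proof -
  note sV = tfD(1)[OF V]
  have sq: "smooth_on M (\<lambda>r. q r (X v r) (V r))" by (rule smooth_on_form[OF adm q_form smooth_X sV])
  have w': "g p (N p) w = 0" using w g_sym[OF p] by simp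
  have "D p (X u p) (BX v V) = D p (X u p) (\<lambda>r. D r (X v r) V)
      - (deriv_within M (\<lambda>r. q r (X v r) (V r)) p (X u p) *\<^sub>R N p + q p (X v p) (V p) *\<^sub>R D p (X u p) N)"
    unfolding Bp_def D_diff[OF p smooth_D[OF smooth_X sV] smooth_on_scaleR[OF adm sq sN]] D_scaleR[OF p sq sN] ..
  then show ?thesis
    unfolding Bp_def[of p "X u p"] by (simp add: gb[OF p] w' g_D_N[OF p] Sf_eq[OF p])
qed

text \<open>Differentiating the subtracted normal part brings in the shape operator, which supplies
  the products of \<open>q\<close> in \<open>hR\<close>. So \<open>hR\<close> is the curvature of
  \<open>Bp\<close>; the fields \<open>X u\<close> and \<open>X v\<close> commute, so there is no
  bracket term.\<close>

lemma B_commutator: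
  assumes p: "p \<in> M" and V: "tf V" and w: "tang p w"
  shows "g p (BX u (BX v V) p - BX v (BX u V) p) w = hR p (X u p) (X v p) (V p) w"
proof -
  have "D p 0 V = 0" by (rule linear_0[OF linear_D[OF p tfD(1)[OF V]]])
  then have "D p (X u p) (\<lambda>r. D r (X v r) V) - D p (X v p) (\<lambda>r. D r (X u r) V) = curv M g p (X u p) (X v p) (V p)"
    using curvature_identity[OF p smooth_X smooth_X tfD(1)[OF V], of u v] unfolding X_bracket[OF p] by simp
  then have "g p (D p (X u p) (\<lambda>r. D r (X v r) V)) w - g p (D p (X v p) (\<lambda>r. D r (X u r) V)) w = Rm p (X u p) (X v p) (V p) w"
    unfolding Rm_curv[OF p] by (simp flip: gb(3)[OF p])
  then show ?thesis
    unfolding gb(3)[OF p] B_B[OF p V w] hR_def by (simp add: algebra_simps)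
qed

lemma tang_ext:
  assumes p: "p \<in> M" and "tang p x" "tang p y" "\<And>w. tang p w \<Longrightarrow> g p x w = g p y w"
  shows "x = y"
proof (rule inner_product_ext[OF g_ip[OF p]])
  fix w
  have "g p x w = g p x (tp p w)" "g p y w = g p y (tp p w)"
    using assms(2,3) by (simp_all add: tp_def gb[OF p])
  then show "g p x w = g p y w" using assms(4)[OF tang_tp[OF p]] by simp
qed

lemma B_commute:
  assumes p: "p \<in> M" and V: "tf V" and uv: "snd u = 0" "snd v = 0"
  shows "BX u (BX v V) p = BX v (BX u V) p"
proof (rule tang_ext[OF p])
  show "tang p (BX u (BX v V) p)" "tang p (BX v (BX u V) p)" by (intro Bp_tang p tf_BX V)+
  show "g p (BX u (BX v V) p) w = g p (BX v (BX u V) p) w" if w: "tang p w" for w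
    using B_commutator[OF p V w, of u v] gauss'[OF p tang_X[OF p uv(1)] tang_X[OF p uv(2)] tfD(2)[OF V p] w]
    by (simp add: gb[OF p])
qed

text \<open>Pair symmetry of the curvature; the products of \<open>q\<close> share it since
  \<open>q\<close> is symmetric.\<close>

lemma hR_swap: assumes p: "p \<in> M" shows "hR p n x v w = - hR p v w x n"
  using Rm_pair[OF p, of n x v w] Rm_antisym2[OF p, of v w n x] q_sym[OF p, of n w] q_sym[OF p, of n v]
    q_sym[OF p, of x v] q_sym[OF p, of x w]
  by (simp add: hR_def)

text \<open>The time field is its tangential part plus the lapse times \<open>N\<close>. The first
  contributes leaf curvature, which is 0; for the second, pair symmetry turns the mixed curvature
  into a Codazzi term. This is the origin of the factor in \<open>tau\<close>.\<close>

lemma B_t_commutator: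
  assumes p: "p \<in> M" and V: "tf V" and w: "tang p w" and u: "snd u = 0"
  shows "g p (BX (0, 1) (BX u V) p - BX u (BX (0, 1) V) p) w = - tau p (V p) w (X u p)"
proof -
  have l: "hR p (x + c *\<^sub>R y) a b d = hR p x a b d + c * hR p y a b d" for x y a b c d
    by (simp add: hR_def linear_add[OF linear_Rm(1)[OF p]] linear_scale[OF linear_Rm(1)[OF p]] qb[OF p] algebra_simps)
  have "Xt p = tp p (Xt p) + lapse p *\<^sub>R N p" by (simp add: tp_def lapse_def)
  then have "hR p (Xt p) (X u p) (V p) w = hR p (tp p (Xt p)) (X u p) (V p) w + lapse p * hR p (N p) (X u p) (V p) w"
    using l[of "tp p (Xt p)" "lapse p" "N p" "X u p" "V p" w] by (simp only:)
  also have "hR p (tp p (Xt p)) (X u p) (V p) w = 0"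
    by (rule gauss'[OF p tang_tp[OF p] tang_X[OF p u] tfD(2)[OF V p] w])
  also have "hR p (N p) (X u p) (V p) w = - C p (V p) w (X u p)"
    unfolding hR_swap[OF p, of "N p"] hR_codazzi[OF p tfD(2)[OF V p] w tang_X[OF p u]] ..
  finally show ?thesis unfolding B_commutator[OF p V w] by (simp add: tau_def)
qed

text \<open>The commutator of the derivatives in the time direction and along \<open>X b\<close>,
  that is, the mixed curvature of \<open>Bp\<close>.\<close>

definition K where "K b V p = BX (0, 1) (BX b V) p - BX b (BX (0, 1) V) p"

lemma tf_K: assumes V: "tf V" shows "tf (K b V)"
proof -
  note s = tfD[OF tf_BX[OF tf_BX[OF V]]]
  have "smooth_on M (\<lambda>p. BX (0, 1) (BX b V) p - BX b (BX (0, 1) V) p)"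
    by (rule smooth_on_diff[OF adm s(1) s(1)])
  then show ?thesis unfolding tf_def K_def[abs_def] by (simp add: gb s(2))
qed

text \<open>With B for \<open>Bp\<close>, the right-hand side is -<[B_a, [B_t, B_b]] V, W>:
  \<open>tau\<close> represents the inner commutator up to sign, and metric compatibility lets B_a
  act on it.\<close>

lemma tau_derivative:
  assumes p: "p \<in> M" and V: "tf V" and W: "tf W" and a: "snd a = 0" and b: "snd b = 0"
  shows "deriv_within M (\<lambda>r. tau r (V r) (W r) (X b r)) p (X a p) - tau p (BX a V p) (W p) (X b p) - tau p (V p) (BX a W p) (X b p)
    = - g p (BX a (BX (0, 1) (BX b V)) p - BX a (BX b (BX (0, 1) V)) p - BX (0, 1) (BX b (BX a V)) p + BX b (BX (0, 1) (BX a V)) p) (W p)"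
proof -
  have k: "g r (K b V r) w = - tau r (V r) w (X b r)" if "r \<in> M" "tf V" "tang r w" for r w V
    unfolding K_def by (rule B_t_commutator[OF that(1,2,3) b])
  have sm: "smooth_on M (\<lambda>r. g r (K b V r) (W r))" by (rule smooth_g[OF tfD(1)[OF tf_K[OF V]] tfD(1)[OF W]])
  have "deriv_within M (\<lambda>r. tau r (V r) (W r) (X b r)) p (X a p) = deriv_within M (\<lambda>r. - g r (K b V r) (W r)) p (X a p)"
    by (rule deriv_within_cong[OF _ p]) (simp add: k V tfD(2)[OF W])
  also have "\<dots> = - (g p (BX a (K b V) p) (W p) + g p (K b V p) (BX a W p))"
    unfolding deriv_within_minus[OF adm p sm] metric_B[OF p tf_K[OF V] W] ..
  also have "g p (K b V p) (BX a W p) = - tau p (V p) (BX a W p) (X b p)"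
    by (rule k[OF p V Bp_tang[OF p W]])
  finally have e1: "deriv_within M (\<lambda>r. tau r (V r) (W r) (X b r)) p (X a p) =
    - (g p (BX a (K b V) p) (W p) + - tau p (V p) (BX a W p) (X b p))" .
  have e2: "BX a (K b V) p = BX a (BX (0, 1) (BX b V)) p - BX a (BX b (BX (0, 1) V)) p"
    unfolding K_def[abs_def] by (rule Bp_diff[OF p tfD(1)[OF tf_BX[OF tf_BX[OF V]]] tfD(1)[OF tf_BX[OF tf_BX[OF V]]]])
  have e3: "tau p (BX a V p) (W p) (X b p) = - g p (K b (BX a V) p) (W p)"
    using k[OF p tf_BX[OF V, of a] tfD(2)[OF W p]] by simp
  show ?thesis unfolding e1 e2 e3 unfolding K_def[of b "BX a V" p] by (simp add: gb[OF p])
qed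

text \<open>Jacobi identity for B_a, B_b, B_t: since B_a and B_b commute, the double commutator is
  symmetric in \<open>a\<close> and \<open>b\<close>.\<close>

lemma tau_derivative_sym:
  assumes p: "p \<in> M" and V: "tf V" and W: "tf W" and a: "snd a = 0" and b: "snd b = 0"
  shows "deriv_within M (\<lambda>r. tau r (V r) (W r) (X b r)) p (X a p) - tau p (BX a V p) (W p) (X b p) - tau p (V p) (BX a W p) (X b p)
    = deriv_within M (\<lambda>r. tau r (V r) (W r) (X a r)) p (X b p) - tau p (BX b V p) (W p) (X a p) - tau p (V p) (BX b W p) (X a p)"
proof -
  have 1: "BX a (BX b (BX (0, 1) V)) p = BX b (BX a (BX (0, 1) V)) p"
    by (rule B_commute[OF p tf_BX[OF V] a b])
  \<comment> \<open>Here the commutation relation is itself differentiated, so it is used on all of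
    \<open>M\<close> and not only at \<open>p\<close>.\<close>
  have 2: "BX (0, 1) (BX b (BX a V)) p = BX (0, 1) (BX a (BX b V)) p"
    by (rule Bp_cong[OF p]) (rule B_commute[OF _ V b a])
  show ?thesis unfolding tau_derivative[OF p V W a b] tau_derivative[OF p V W b a] 1 2 by (simp add: gb[OF p])
qed

text \<open>The \<open>q\<close>-terms turn the ambient covariant derivative into the one of the connection \<open>Bp\<close>.\<close>

definition tt where
  "tt p w x y z = cd3 tau p w x y z + q p w x * tau p (N p) y z + q p w y * tau p x (N p) z + q p w z * tau p x y (N p)"

lemma deriv_tau:
  assumes p: "p \<in> M" and U: "smooth_on M U" and V: "smooth_on M V" and W: "smooth_on M W"
  shows "deriv_within M (\<lambda>r. tau r (U r) (V r) (W r)) p w = tt p w (U p) (V p) (W p)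
    + tau p (Bp p w U) (V p) (W p) + tau p (U p) (Bp p w V) (W p) + tau p (U p) (V p) (Bp p w W)"
proof -
  have "D p w V = Bp p w V + q p w (V p) *\<^sub>R N p" for V by (simp add: Bp_def)
  note e = this[of U] this[of V] this[of W]
  show ?thesis
    unfolding deriv_form3[OF p form3_tau U V W] e tt_def
    by (simp add: linear_add[OF linear_tau(1)[OF p]] linear_add[OF linear_tau(2)[OF p]] linear_add[OF linear_tau(3)[OF p]]
      linear_scale[OF linear_tau(1)[OF p]] linear_scale[OF linear_tau(2)[OF p]] linear_scale[OF linear_tau(3)[OF p]])
qed

lemma tt_sym:
  assumes p: "p \<in> M" and V: "tf V" and W: "tf W" and x: "tang p x" and z: "tang p z"
  shows "tt p x (V p) (W p) z = tt p z (V p) (W p) x"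
proof -
  obtain a where a: "snd a = 0" "x = X a p" using tang_cases[OF p x] by metis
  obtain b where b: "snd b = 0" "z = X b p" using tang_cases[OF p z] by metis
  \<comment> \<open>\<open>Bp\<close> is torsion free on these fields, so the terms that
    differentiate the third argument of \<open>tau\<close> agree.\<close>
  have "BX a (X b) p = BX b (X a) p"
    by (simp add: Bp_def D_X_commute[OF p, of a b] q_sym[OF p, of "X a p"])
  then show ?thesis
    using tau_derivative_sym[OF p V W a(1) b(1)]
    unfolding deriv_tau[OF p tfD(1)[OF V] tfD(1)[OF W] smooth_X] a(2) b(2) by simp
qed

lemma tt_antisym: assumes p: "p \<in> M" shows "tt p w x y z = - tt p w y x z"
proof -
  have "deriv_within M (\<lambda>r. tau r x y z) p w = deriv_within M (\<lambda>r. - tau r y x z) p w"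
    by (rule deriv_within_cong[OF _ p]) (rule tau_antisym)
  also have "\<dots> = - deriv_within M (\<lambda>r. tau r y x z) p w"
    by (rule deriv_within_minus[OF adm p form3D(1)[OF form3_tau]])
  finally show ?thesis
    using tau_antisym[of p "Gam p w x" y z] tau_antisym[of p x "Gam p w y" z] tau_antisym[of p x y "Gam p w z"]
      tau_antisym[of p "N p" y z] tau_antisym[of p x "N p" z] tau_antisym[of p x y "N p"]
    unfolding tt_def cd3_def by (simp add: algebra_simps)
qed

text \<open>\<open>Bp\<close> preserves the metric, so derivatives of the frame cancel in every
  trace over it.\<close>

lemma contraction_parallel:
  assumes p: "p \<in> M" and b: "bilinear (b :: 'b \<times> real \<Rightarrow> 'b \<times> real \<Rightarrow> real)"
  shows "(\<Sum>k<m. b (Bp p w (E k)) (E k p) + b (E k p) (Bp p w (E k))) = 0"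
proof -
  define a where "a = (\<lambda>k s. g p (Bp p w (E k)) (E s p))"
  have anti: "a k s = - a s k" if "k < m" "s < m" for k s
  proof -
    have "deriv_within M (\<lambda>r. g r (E k r) (E s r)) p w = deriv_within M (\<lambda>_. if k = s then 1 else 0) p w"
      by (rule deriv_within_cong[OF _ p]) (simp add: g_E that less_imp_le)
    then show ?thesis
      using metric_B[OF p tf_E[OF that(1)] tf_E[OF that(2)], of w] g_sym[OF p, of "E k p"] by (simp add: adm p a_def)
  qed
  have ex: "Bp p w (E k) = (\<Sum>s<m. a k s *\<^sub>R E s p)" if "k < m" for k
    unfolding a_def by (rule E_expand_tan[OF p Bp_tang[OF p tf_E[OF that]]])
  show ?thesis by (rule contraction_antisym[OF b anti ex])
qed

section \<open>Vanishing of the trace of \<open>tau\<close>\<close>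

definition theta where "theta p y = (\<Sum>j<m. tau p (E j p) y (E j p))"

text \<open>\<open>J_tan\<close> expresses the tangential trace of \<open>C\<close> by its value on
  \<open>N\<close>, \<open>y\<close>, \<open>N\<close>, which times the lapse is the derivative of
  \<open>phi\<close>.\<close>

lemma theta_phi:
  assumes p: "p \<in> M" and y: "tang p y" shows "theta p y = - deriv_within M phi p y"
proof -
  have "(\<Sum>j<m. C p (E j p) y (E j p)) + C p (N p) y (N p) = 0" unfolding C_def by (rule J_tan[OF p y])
  then show ?thesis unfolding theta_def tau_def deriv_phi[OF p y] by (simp flip: sum_distrib_left add: add_eq_0_iff2)
qed

lemma linear_theta: "p \<in> M \<Longrightarrow> linear (theta p)"
  unfolding theta_def[abs_def] by (rule linear_compose_sum) (simp add: linear_tau)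

lemma sE: "i < m \<Longrightarrow> smooth_on M (E i)"
  by (simp add: smooth_E)

lemma smooth_theta: "smooth_on M W \<Longrightarrow> smooth_on M (\<lambda>p. theta p (W p))"
  unfolding theta_def by (intro smooth_on_sum adm finite_lessThan smooth_tau sE) auto

lemma deriv_theta:
  assumes p: "p \<in> M" and W: "smooth_on M W"
  shows "deriv_within M (\<lambda>r. theta r (W r)) p w = (\<Sum>j<m. tt p w (E j p) (W p) (E j p)) + theta p (Bp p w W)"
proof -
  have b: "bilinear (\<lambda>x z. tau p x (W p) z)" unfolding bilinear_def by (simp add: linear_tau[OF p])
  have "deriv_within M (\<lambda>r. theta r (W r)) p w = (\<Sum>j<m. deriv_within M (\<lambda>r. tau r (E j r) (W r) (E j r)) p w)"
    unfolding theta_def by (rule deriv_within_sum[OF adm p finite_lessThan]) (simp add: smooth_tau sE W)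
  also have "\<dots> = (\<Sum>j<m. (tt p w (E j p) (W p) (E j p) + tau p (E j p) (Bp p w W) (E j p))
      + (tau p (Bp p w (E j)) (W p) (E j p) + tau p (E j p) (W p) (Bp p w (E j))))"
    by (intro sum.cong refl) (simp add: deriv_tau[OF p sE W sE])
  finally show ?thesis
    using contraction_parallel[OF p b, of w] by (simp add: sum.distrib theta_def)
qed

text \<open>The exchange symmetry of \<open>tt\<close> followed by its antisymmetry interchanges
  \<open>i\<close> and \<open>j\<close> at the cost of a sign, so the sum equals its own
  negative.\<close>

lemma div_theta: assumes p: "p \<in> M" shows "(\<Sum>i<m. \<Sum>j<m. tt p (E i p) (E j p) (E i p) (E j p)) = 0" (is "?S = 0")
proof -
  have "?S = (\<Sum>i<m. \<Sum>j<m. - tt p (E j p) (E i p) (E j p) (E i p))"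
  proof (intro sum.cong refl)
    fix i j assume "i \<in> {..<m}" "j \<in> {..<m}"
    then have ij: "i < m" "j < m" by auto
    have "tt p (E i p) (E j p) (E i p) (E j p) = tt p (E j p) (E j p) (E i p) (E i p)"
      by (rule tt_sym[OF p tf_E[OF ij(2)] tf_E[OF ij(1)] tang_E[OF p ij(1)] tang_E[OF p ij(2)]])
    also have "\<dots> = - tt p (E j p) (E i p) (E j p) (E i p)" by (rule tt_antisym[OF p])
    finally show "tt p (E i p) (E j p) (E i p) (E j p) = - tt p (E j p) (E i p) (E j p) (E i p)" .
  qed
  also have "\<dots> = - ?S" by (subst sum.swap) (simp add: sum_negf)
  finally show ?thesis by simp
qed

lemma smooth_tp: "smooth_on M V \<Longrightarrow> smooth_on M (\<lambda>p. tp p (V p))"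
  unfolding tp_def by (intro smooth_on_diff smooth_on_scaleR adm smooth_g sN)

lemma linear_tp: "p \<in> M \<Longrightarrow> linear (tp p)"
  by (rule linearI) (simp_all add: tp_def gb algebra_simps)

lemma tp_N: "p \<in> M \<Longrightarrow> tp p (N p) = 0"
  by (simp add: tp_def g_N_N)

lemma per_lapse: "per lapse"
  unfolding lapse_def[abs_def] by (rule per_form[where B = g, OF per_g' per_X per_E])

lemma per_lnf: "per lnf"
  using per_lapse by (simp add: per_def lnf_def)

lemma per_tp: "per tp"
  unfolding per_def
proof (intro ballI ext)
  fix p k v assume pk: "p \<in> M" "k \<in> \<Lambda>"
  show "tp (p + (k, 0)) v = tp p v" unfolding tp_def perD[OF per_E pk] per_g[OF pk] ..
qed

lemma per_phi: "per phi"
  unfolding per_def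
proof (intro ballI)
  fix p k assume pk: "p \<in> M" "k \<in> \<Lambda>"
  show "phi (p + (k, 0)) = phi p"
    unfolding phi_def beta_def perD[OF per_E pk] per_q[OF pk] perD[OF per_X pk]
      fun_cong[OF perD[OF per_deriv[OF smooth_lnf per_lnf] pk]] ..
qed

lemma per_tau: "per tau"
  unfolding per_def
proof (intro ballI ext)
  fix p k x y z assume pk: "p \<in> M" "k \<in> \<Lambda>"
  have "per (\<lambda>r. q r y z)" for y z using per_q by (simp add: per_def)
  note d = fun_cong[OF perD[OF per_deriv[OF form_fieldD(1)[OF q_form] this] pk]]
  show "tau (p + (k, 0)) x y z = tau p x y z"
    unfolding tau_def C_def nabq_def perD[OF per_lapse pk] per_q[OF pk] perD[OF per_Gam pk] d ..
qed

lemma per_theta: "per theta"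
  unfolding per_def
proof (intro ballI ext)
  fix p k y assume pk: "p \<in> M" "k \<in> \<Lambda>"
  show "theta (p + (k, 0)) y = theta p y" unfolding theta_def perD[OF per_E pk] perD[OF per_tau pk] ..
qed

lemma theta_zero: assumes p: "p \<in> M" and y: "tang p y" shows "theta p y = 0"
proof -
  \<comment> \<open>On the leaves this is \<open>phi\<close> times its differential. As
    \<open>theta\<close> is divergence free, its divergence is the squared length of the
    differential; the projection makes the form vanish on \<open>N\<close>.\<close>
  define al where "al = (\<lambda>p y. - phi p * theta p (tp p y))"
  have dv: "div1 al p = (\<Sum>i<m. (deriv_within M phi p (E i p))\<^sup>2)" if p: "p \<in> M" for p
  proof -
    have "div1 al p = (\<Sum>i<m. (deriv_within M phi p (E i p))\<^sup>2 - phi p * (\<Sum>j<m. tt p (E i p) (E j p) (E i p) (E j p)))"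
      unfolding div1_def
    proof (intro sum.cong refl)
      fix i assume "i \<in> {..<m}"
      then have i: "i < m" by simp
      have "deriv_within M (\<lambda>r. al r (E i r)) p (E i p) = deriv_within M (\<lambda>r. - phi r * theta r (E i r)) p (E i p)"
        by (rule deriv_within_cong[OF _ p]) (simp add: al_def tp_id tang_E i)
      also have "\<dots> = - deriv_within M phi p (E i p) * theta p (E i p) - phi p * deriv_within M (\<lambda>r. theta r (E i r)) p (E i p)"
        unfolding deriv_within_mult[OF adm p smooth_on_minus[OF adm smooth_phi] smooth_theta[OF sE[OF i]]]
          deriv_within_minus[OF adm p smooth_phi] by simp
      also have "\<dots> = (deriv_within M phi p (E i p))\<^sup>2 - phi p * ((\<Sum>j<m. tt p (E i p) (E j p) (E i p) (E j p)) + theta p (Bp p (E i p) (E i)))"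
        unfolding deriv_theta[OF p sE[OF i]] theta_phi[OF p tang_E[OF p i]] by (simp add: power2_eq_square)
      finally show "deriv_within M (\<lambda>r. al r (E i r)) p (E i p) - al p (D p (E i p) (E i)) =
          (deriv_within M phi p (E i p))\<^sup>2 - phi p * (\<Sum>j<m. tt p (E i p) (E j p) (E i p) (E j p))"
        unfolding al_def Bp_tp[OF p tf_E[OF i]] by (simp add: algebra_simps)
    qed
    also have "\<dots> = (\<Sum>i<m. (deriv_within M phi p (E i p))\<^sup>2) - phi p * (\<Sum>i<m. \<Sum>j<m. tt p (E i p) (E j p) (E i p) (E j p))"
      by (simp add: sum_subtractf sum_distrib_left)
    finally show ?thesis unfolding div_theta[OF p] by simp
  qed
  have "div1 al p = 0"
  proof (rule div1_zero[OF _ _ _ _ _ p])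
    show "smooth_on M (\<lambda>p. al p w)" for w
      unfolding al_def by (intro smooth_on_mult smooth_on_minus adm smooth_phi smooth_theta smooth_tp smooth_on_const)
    show "linear (al p)" if "p \<in> M" for p
      unfolding al_def
      by (rule linearI) (simp_all add: linear_add[OF linear_tp[OF that]] linear_scale[OF linear_tp[OF that]]
          linear_add[OF linear_theta[OF that]] linear_scale[OF linear_theta[OF that]] algebra_simps)
    show "al p (N p) = 0" if "p \<in> M" for p
      unfolding al_def tp_N[OF that] using linear_0[OF linear_theta[OF that]] by simp
    show "per al"
      unfolding per_def
    proof (intro ballI ext)
      fix p k w assume pk: "p \<in> M" "k \<in> \<Lambda>"
      show "al (p + (k, 0)) w = al p w" unfolding al_def perD[OF per_phi pk] perD[OF per_theta pk] perD[OF per_tp pk] ..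
    qed
    show "0 \<le> div1 al p" if "p \<in> M" for p unfolding dv[OF that] by (rule sum_nonneg) simp
  qed
  then have z: "deriv_within M phi p (E i p) = 0" if "i < m" for i
    using that unfolding dv[OF p] by (simp add: sum_nonneg_eq_0_iff)
  have "deriv_within M phi p y = deriv_within M phi p (\<Sum>a<m. g p y (E a p) *\<^sub>R E a p)"
    by (rule arg_cong[OF E_expand_tan[OF p y]])
  also have "\<dots> = (\<Sum>a<m. g p y (E a p) *\<^sub>R deriv_within M phi p (E a p))"
    by (rule linear_combo[OF deriv_within_linear[OF smooth_phi p]])
  also have "\<dots> = 0" by (simp add: z)
  finally show ?thesis unfolding theta_phi[OF p y] by simp
qed

text \<open>The exchange symmetry turns the divergence in the first slot into a derivative of the
  trace \<open>theta\<close>, which is 0 on all leaves.\<close>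

lemma div_tau_zero:
  assumes p: "p \<in> M" and k: "k < m" and l: "l < m"
  shows "(\<Sum>i<m. tt p (E i p) (E i p) (E k p) (E l p)) = 0"
proof -
  have "(\<Sum>i<m. tt p (E i p) (E i p) (E k p) (E l p)) = (\<Sum>i<m. tt p (E l p) (E i p) (E k p) (E i p))"
    by (intro sum.cong refl tt_sym[OF p tf_E tf_E tang_E[OF p] tang_E[OF p]]) (use k l in auto)
  also have "\<dots> = deriv_within M (\<lambda>r. theta r (E k r)) p (E l p) - theta p (Bp p (E l p) (E k))"
    unfolding deriv_theta[OF p sE[OF k]] by simp
  also have "theta p (Bp p (E l p) (E k)) = 0" by (rule theta_zero[OF p Bp_tang[OF p tf_E[OF k]]])
  also have "deriv_within M (\<lambda>r. theta r (E k r)) p (E l p) = deriv_within M (\<lambda>_. 0) p (E l p)"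
    by (rule deriv_within_cong[OF _ p]) (rule theta_zero[OF _ tang_E[OF _ k]])
  finally show ?thesis by (simp add: adm p)
qed

section \<open>Vanishing of \<open>tau\<close> itself\<close>

definition pp where "pp p x y = lapse p * q p x y"

text \<open>The covariant derivative of \<open>pp\<close> with respect to \<open>Bp\<close>.\<close>

definition pt where
  "pt p w x y = deriv_within M lapse p w * q p x y + lapse p * (nq p w x y + q p w x * q p (N p) y + q p w y * q p x (N p))"

lemma smooth_pp: "smooth_on M V \<Longrightarrow> smooth_on M W \<Longrightarrow> smooth_on M (\<lambda>p. pp p (V p) (W p))"
  unfolding pp_def by (intro smooth_on_mult adm smooth_lapse smooth_on_form[OF adm q_form])

lemma deriv_pp:
  assumes p: "p \<in> M" and V: "smooth_on M V" and W: "smooth_on M W"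
  shows "deriv_within M (\<lambda>r. pp r (V r) (W r)) p w = pt p w (V p) (W p) + pp p (Bp p w V) (W p) + pp p (V p) (Bp p w W)"
proof -
  have "D p w V = Bp p w V + q p w (V p) *\<^sub>R N p" for V by (simp add: Bp_def)
  note e = this[of V] this[of W]
  show ?thesis
    unfolding pp_def deriv_within_mult[OF adm p smooth_lapse smooth_on_form[OF adm q_form V W]] deriv_tensor[OF p q_form V W] e pt_def
    by (simp add: qb[OF p] algebra_simps)
qed

text \<open>Along the leaves the derivative of the lapse is \<open>lapse\<close> times
  \<open>beta\<close>. These terms cancel the products of \<open>q\<close> that distinguish
  \<open>Bp\<close> from \<open>D\<close>, which is the reason for the weight in
  \<open>pp\<close>.\<close>

lemma pt_antisym:
  assumes p: "p \<in> M" and t: "tang p w" "tang p x"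
  shows "pt p w x z - pt p x w z = tau p w x z"
  unfolding pt_def deriv_lapse_tan[OF p t(1)] deriv_lapse_tan[OF p t(2)] beta_def tau_def C_def
  using q_sym[OF p, of x w] by (simp add: algebra_simps)

definition zeta where
  "zeta p y = (\<Sum>k<m. \<Sum>l<m. tau p (tp p y) (E k p) (E l p) * pp p (E k p) (E l p))"

text \<open>Frame derivatives cancel by \<open>contraction_parallel\<close> and the divergence of
  \<open>tau\<close> is 0, so only the contraction of \<open>tau\<close> with \<open>pt\<close>
  remains.\<close>

lemma div_zeta:
  assumes p: "p \<in> M"
  shows "div1 zeta p = (\<Sum>i<m. \<Sum>k<m. \<Sum>l<m. (tau p (E i p) (E k p) (E l p))\<^sup>2) / 2"
proof -
  let ?t = "\<lambda>i k l. tau p (E i p) (E k p) (E l p)"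
  have summand: "deriv_within M (\<lambda>r. zeta r (E i r)) p (E i p) - zeta p (D p (E i p) (E i))
    = (\<Sum>k<m. \<Sum>l<m. tt p (E i p) (E i p) (E k p) (E l p) * pp p (E k p) (E l p)) + (\<Sum>k<m. \<Sum>l<m. ?t i k l * pt p (E i p) (E k p) (E l p))"
    if i: "i < m" for i
  proof -
    let ?w = "E i p"
    let ?B = "\<lambda>k. Bp p ?w (E k)"
    have b1: "bilinear (\<lambda>x y. tau p (E i p) x (E l p) * pp p y (E l p))" for l
      unfolding bilinear_def
      by (intro conjI allI linearI) (simp_all add: pp_def qb[OF p] linear_add[OF linear_tau(2)[OF p]] linear_scale[OF linear_tau(2)[OF p]] algebra_simps)
    have b2: "bilinear (\<lambda>x y. tau p (E i p) (E k p) x * pp p (E k p) y)" for k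
      unfolding bilinear_def
      by (intro conjI allI linearI) (simp_all add: pp_def qb[OF p] linear_add[OF linear_tau(3)[OF p]] linear_scale[OF linear_tau(3)[OF p]] algebra_simps)
    have c1: "(\<Sum>k<m. \<Sum>l<m. tau p (E i p) (?B k) (E l p) * pp p (E k p) (E l p) + ?t i k l * pp p (?B k) (E l p)) = 0"
      by (subst sum.swap) (simp add: contraction_parallel[OF p b1, where w = "E i p"])
    have c2: "(\<Sum>k<m. \<Sum>l<m. tau p (E i p) (E k p) (?B l) * pp p (E k p) (E l p) + ?t i k l * pp p (E k p) (?B l)) = 0"
      by (simp add: contraction_parallel[OF p b2, where w = "E i p"])
    have "deriv_within M (\<lambda>r. zeta r (E i r)) p ?w =
        deriv_within M (\<lambda>r. \<Sum>k<m. \<Sum>l<m. tau r (E i r) (E k r) (E l r) * pp r (E k r) (E l r)) p ?w"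
      by (rule deriv_within_cong[OF _ p]) (simp add: zeta_def tp_id tang_E i)
    also have "\<dots> = (\<Sum>k<m. \<Sum>l<m. deriv_within M (\<lambda>r. tau r (E i r) (E k r) (E l r) * pp r (E k r) (E l r)) p ?w)"
      using i by (subst deriv_within_sum[OF adm p finite_lessThan smooth_on_sum[OF adm finite_lessThan]])
        (auto intro!: sum.cong deriv_within_sum[OF adm p finite_lessThan] smooth_on_mult adm smooth_tau smooth_pp sE)
    also have "\<dots> = (\<Sum>k<m. \<Sum>l<m. tt p ?w (E i p) (E k p) (E l p) * pp p (E k p) (E l p)
        + ?t i k l * pt p ?w (E k p) (E l p)
        + tau p (?B i) (E k p) (E l p) * pp p (E k p) (E l p)
        + (tau p (E i p) (?B k) (E l p) * pp p (E k p) (E l p) + ?t i k l * pp p (?B k) (E l p))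
        + (tau p (E i p) (E k p) (?B l) * pp p (E k p) (E l p) + ?t i k l * pp p (E k p) (?B l)))"
    proof (intro sum.cong refl)
      fix k l assume "k \<in> {..<m}" "l \<in> {..<m}"
      then have kl: "k < m" "l < m" by auto
      show "deriv_within M (\<lambda>r. tau r (E i r) (E k r) (E l r) * pp r (E k r) (E l r)) p ?w =
        tt p ?w (E i p) (E k p) (E l p) * pp p (E k p) (E l p)
        + ?t i k l * pt p ?w (E k p) (E l p)
        + tau p (?B i) (E k p) (E l p) * pp p (E k p) (E l p)
        + (tau p (E i p) (?B k) (E l p) * pp p (E k p) (E l p) + ?t i k l * pp p (?B k) (E l p))
        + (tau p (E i p) (E k p) (?B l) * pp p (E k p) (E l p) + ?t i k l * pp p (E k p) (?B l))"
        unfolding deriv_within_mult[OF adm p smooth_tau[OF sE[OF i] sE[OF kl(1)] sE[OF kl(2)]] smooth_pp[OF sE[OF kl(1)] sE[OF kl(2)]]]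
          deriv_tau[OF p sE[OF i] sE[OF kl(1)] sE[OF kl(2)]] deriv_pp[OF p sE[OF kl(1)] sE[OF kl(2)]]
        by (simp add: algebra_simps)
    qed
    also have "\<dots> = (\<Sum>k<m. \<Sum>l<m. tt p ?w (E i p) (E k p) (E l p) * pp p (E k p) (E l p))
        + (\<Sum>k<m. \<Sum>l<m. ?t i k l * pt p ?w (E k p) (E l p))
        + (\<Sum>k<m. \<Sum>l<m. tau p (?B i) (E k p) (E l p) * pp p (E k p) (E l p))"
      using c1 c2 by (simp add: sum.distrib)
    also have "(\<Sum>k<m. \<Sum>l<m. tau p (?B i) (E k p) (E l p) * pp p (E k p) (E l p)) = zeta p (D p ?w (E i))"
      unfolding zeta_def Bp_tp[OF p tf_E[OF i]] ..
    finally show ?thesis by simp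
  qed
  let ?S = "\<Sum>i<m. \<Sum>k<m. \<Sum>l<m. ?t i k l * pt p (E i p) (E k p) (E l p)"
  have "div1 zeta p = (\<Sum>i<m. \<Sum>k<m. \<Sum>l<m. tt p (E i p) (E i p) (E k p) (E l p) * pp p (E k p) (E l p)) + ?S"
    unfolding div1_def by (simp add: summand sum.distrib)
  also have "(\<Sum>i<m. \<Sum>k<m. \<Sum>l<m. tt p (E i p) (E i p) (E k p) (E l p) * pp p (E k p) (E l p)) =
      (\<Sum>k<m. \<Sum>i<m. \<Sum>l<m. tt p (E i p) (E i p) (E k p) (E l p) * pp p (E k p) (E l p))"
    by (rule sum.swap)
  also have "\<dots> = (\<Sum>k<m. \<Sum>l<m. \<Sum>i<m. tt p (E i p) (E i p) (E k p) (E l p) * pp p (E k p) (E l p))"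
    by (rule sum.cong[OF refl], rule sum.swap)
  also have "\<dots> = 0"
  proof (rule sum.neutral, rule ballI, rule sum.neutral, rule ballI)
    fix k l assume "k \<in> {..<m}" "l \<in> {..<m}"
    then show "(\<Sum>i<m. tt p (E i p) (E i p) (E k p) (E l p) * pp p (E k p) (E l p)) = 0"
      using div_tau_zero[OF p, of k l] unfolding sum_distrib_right[symmetric] by simp
  qed
  finally have d: "div1 zeta p = ?S" by simp
  \<comment> \<open>Antisymmetry of \<open>tau\<close> in its first two slots replaces
    \<open>pt\<close> by half its antisymmetrization, which is \<open>tau\<close> again; hence the
    factor 1/2.\<close>
  have "?S = (\<Sum>i<m. \<Sum>k<m. \<Sum>l<m. ?t k i l * pt p (E k p) (E i p) (E l p))"
    by (rule sum.swap)
  then have "2 * ?S = (\<Sum>i<m. \<Sum>k<m. \<Sum>l<m. ?t i k l * pt p (E i p) (E k p) (E l p) + ?t k i l * pt p (E k p) (E i p) (E l p))"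
    by (simp add: sum.distrib)
  also have "\<dots> = (\<Sum>i<m. \<Sum>k<m. \<Sum>l<m. (?t i k l)\<^sup>2)"
  proof (intro sum.cong refl)
    fix i k l assume "i \<in> {..<m}" "k \<in> {..<m}" "l \<in> {..<m}"
    then have "pt p (E i p) (E k p) (E l p) - pt p (E k p) (E i p) (E l p) = ?t i k l"
      by (intro pt_antisym[OF p] tang_E[OF p]) auto
    then have "?t i k l * (pt p (E i p) (E k p) (E l p) - pt p (E k p) (E i p) (E l p)) = ?t i k l * ?t i k l" by (simp only:)
    then show "?t i k l * pt p (E i p) (E k p) (E l p) + ?t k i l * pt p (E k p) (E i p) (E l p) = (?t i k l)\<^sup>2"
      unfolding tau_antisym[of p "E k p" "E i p"] power2_eq_square right_diff_distrib by linarith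
  qed
  finally show ?thesis unfolding d by simp
qed

lemma tau_E_zero:
  assumes p: "p \<in> M" and ikl: "i < m" "k < m" "l < m"
  shows "tau p (E i p) (E k p) (E l p) = 0"
proof -
  have "div1 zeta p = 0"
  proof (rule div1_zero[OF _ _ _ _ _ p])
    show "smooth_on M (\<lambda>p. zeta p w)" for w
      unfolding zeta_def by (intro smooth_on_sum smooth_on_mult adm finite_lessThan smooth_tau smooth_pp smooth_tp smooth_on_const sE) auto
    show "linear (zeta p)" if p: "p \<in> M" for p
      unfolding zeta_def
      by (rule linearI) (simp_all add: linear_add[OF linear_tp[OF p]] linear_scale[OF linear_tp[OF p]]
          linear_add[OF linear_tau(1)[OF p]] linear_scale[OF linear_tau(1)[OF p]] algebra_simps sum.distrib sum_distrib_left)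
    show "zeta p (N p) = 0" if p: "p \<in> M" for p
      unfolding zeta_def tp_N[OF p] linear_0[OF linear_tau(1)[OF p]] by simp
    show "per zeta"
      unfolding per_def
    proof (intro ballI ext)
      fix p k w assume pk: "p \<in> M" "k \<in> \<Lambda>"
      show "zeta (p + (k, 0)) w = zeta p w"
        unfolding zeta_def pp_def perD[OF per_tau pk] perD[OF per_E pk] perD[OF per_tp pk] perD[OF per_lapse pk] per_q[OF pk] ..
    qed
    show "0 \<le> div1 zeta p" if "p \<in> M" for p
      unfolding div_zeta[OF that] by (intro divide_nonneg_pos sum_nonneg) simp_all
  qed
  then have "(\<Sum>i<m. \<Sum>k<m. \<Sum>l<m. (tau p (E i p) (E k p) (E l p))\<^sup>2) = 0"
    unfolding div_zeta[OF p] by simp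
  then show ?thesis using ikl by (simp add: sum_nonneg_eq_0_iff sum_nonneg)
qed

lemma linear_zero_tang:
  assumes p: "p \<in> M" and x: "tang p x" and f: "linear f" "\<And>i. i < m \<Longrightarrow> f (E i p) = 0"
  shows "f x = (0 :: real)"
proof -
  have "f x = f (\<Sum>a<m. g p x (E a p) *\<^sub>R E a p)" by (rule arg_cong[OF E_expand_tan[OF p x]])
  also have "\<dots> = (\<Sum>a<m. g p x (E a p) *\<^sub>R f (E a p))" by (rule linear_combo[OF f(1)])
  finally show ?thesis by (simp add: f(2))
qed

theorem C_tan_zero:
  assumes p: "p \<in> M" and t: "tang p x" "tang p y" "tang p z" shows "C p x y z = 0"
proof -
  have "C p (E i p) (E k p) (E l p) = 0" if "i < m" "k < m" "l < m" for i k l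
    using tau_E_zero[OF p that] lapse_pos[OF p] by (simp add: tau_def)
  then have "C p (E i p) (E k p) z = 0" if "i < m" "k < m" for i k
    using that by (intro linear_zero_tang[OF p t(3) linear_C(3)[OF p]])
  then have "C p (E i p) y z = 0" if "i < m" for i
    using that by (intro linear_zero_tang[OF p t(2) linear_C(2)[OF p]])
  then show ?thesis by (intro linear_zero_tang[OF p t(1) linear_C(1)[OF p]])
qed

end

section \<open>Gauss equation, unit normal and energy densities in the adapted frame\<close>

context foliation
begin

lemma g_X_horizontal: "p \<in> M \<Longrightarrow> g p (X (u, 0) p) (N p) = 0"
  by (simp add: g_X_N)

text \<open>Koszul's formula identifies the Levi-Civita connection of the induced metric with the
  tangential part of \<open>D\<close>. The normal part is given by \<open>q\<close>, and comparing
  both curvatures through scalar derivatives leaves exactly the products of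
  \<open>q\<close>.\<close>

lemma gauss_equation:
  fixes u v w z :: 'b
  assumes t: "(x, t) \<in> T" and q_sym: "\<And>p u v. p \<in> M \<Longrightarrow> q p u v = q p v u"
    and leaf: "\<And>p (u :: 'b) (v :: 'b). p \<in> M \<Longrightarrow> g p (D p (X (u, 0) p) N) (X (v, 0) p) = - q p (X (u, 0) p) (X (v, 0) p)"
    and flat: "flat_metric_on UNIV (induced_metric g (\<lambda>x. F (x, t)))" and p: "p = F (x, t)"
  shows "Rm p (X (u, 0) p) (X (v, 0) p) (X (w, 0) p) (X (z, 0) p)
      + q p (X (v, 0) p) (X (w, 0) p) * q p (X (u, 0) p) (X (z, 0) p)
      - q p (X (u, 0) p) (X (w, 0) p) * q p (X (v, 0) p) (X (z, 0) p) = 0"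
proof -
  let ?F = "\<lambda>x :: 'b. F (x, t)" and ?Y = "\<lambda>u :: 'b. X (u, 0)"
  define G where "G = induced_metric g ?F"
  have FM: "?F y \<in> M" for y by (rule F_in[OF leaf_map(1)[OF t]])
  have dF: "deriv_within UNIV ?F y a = ?Y a (?F y)" for y a
    using deriv_leaf[OF t smooth_on_ident[OF adm], of y a] deriv_ident[OF adm FM, of "\<lambda>x. x"] by simp
  have G: "G y a b = g (?F y) (?Y a (?F y)) (?Y b (?F y))" for y a b
    unfolding G_def induced_metric_def dF ..
  have linY: "linear (\<lambda>a. ?Y a (?F y))" for y
  proof -
    have "linear (\<lambda>a :: 'b. (a, 0 :: real))" by (auto intro!: linearI)
    from linear_compose[OF this linear_X[OF FM]] show ?thesis by (simp add: o_def)
  qed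
  have posY: "?Y a (?F y) \<noteq> 0" if "a \<noteq> 0" for a y
  proof
    assume "?Y a (?F y) = 0"
    then have "(a, 0) = cof (?F y) 0" using cof_X[OF FM[of y], of "(a, 0)"] by simp
    then show False using linear_0[OF linear_cof[OF FM[of y]]] that by (simp add: zero_prod_def)
  qed
  \<comment> \<open>The leaf becomes a Riemannian manifold on its own coordinate space, with its own
    connection and curvature.\<close>
  interpret L: metric_field UNIV G
  proof
    show "admissible (UNIV :: 'b set)" by (rule admissible_UNIV)
    have b: "bilinear (G y)" for y
      unfolding bilinear_def G
      by (intro conjI allI linearI) (simp_all add: linear_add[OF linY] linear_scale[OF linY] gb[OF FM])
    show "form_field UNIV G"
      unfolding form_field_def using b smooth_leaf[OF t smooth_g[OF smooth_X smooth_X]] unfolding G by simp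
    show "inner_product (G y)" for y
      unfolding inner_product_def
    proof (intro conjI allI impI b)
      show "G y u v = G y v u" for u v unfolding G by (rule g_sym[OF FM])
      show "G y v v > 0" if "v \<noteq> 0" for v unfolding G by (rule inner_productD(3)[OF g_ip[OF FM] posY[OF that]])
    qed
  qed
  have Dk: "deriv_within UNIV (\<lambda>y. G y a b) y c = g (?F y) (D (?F y) (?Y c (?F y)) (?Y a)) (?Y b (?F y)) + g (?F y) (?Y a (?F y)) (D (?F y) (?Y c (?F y)) (?Y b))" for y a b c
    unfolding G deriv_leaf[OF t smooth_g[OF smooth_X smooth_X]] metric_compat[OF FM smooth_X smooth_X] ..
  have kos: "G y (L.Gam y a b) c = g (?F y) (D (?F y) (?Y a (?F y)) (?Y b)) (?Y c (?F y))" for y a b c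
  proof -
    have e: "D (?F y) (?Y b (?F y)) (?Y a) = D (?F y) (?Y a (?F y)) (?Y b)" for a b by (rule D_X_commute[OF FM])
    have s: "g (?F y) (?Y b (?F y)) v = g (?F y) v (?Y b (?F y))" for v by (rule g_sym[OF FM])
    show ?thesis
      unfolding L.g_Gam[OF UNIV_I] L.kos_def Dk e[of b a] e[of c a] e[of c b] s by simp
  qed
  have normal: "g p (D p (?Y a p) (?Y b)) (N p) = q p (?Y a p) (?Y b p)" for a b
  proof -
    have pM: "p \<in> M" using FM p by simp
    have "deriv_within M (\<lambda>r. g r (?Y b r) (N r)) p (?Y a p) = deriv_within M (\<lambda>_. 0) p (?Y a p)"
      by (rule deriv_within_cong[OF _ pM]) (rule g_X_horizontal)
    then have "g p (D p (?Y a p) (?Y b)) (N p) + g p (?Y b p) (D p (?Y a p) N) = 0"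
      using metric_compat[OF pM smooth_X smooth_E[OF order_refl]] by (simp add: adm pM)
    then show ?thesis using leaf[OF pM, of a b] g_sym[OF pM, of "?Y b p"] by simp
  qed
  \<comment> \<open>Both sides have equal inner products with the leaf fields, by Koszul's formula,
    and with \<open>N\<close>; together these span.\<close>
  have split: "D p (?Y a p) (?Y b) = ?Y (L.Gam x a b) p + q p (?Y a p) (?Y b p) *\<^sub>R N p" for a b
  proof (rule inner_product_ext[OF g_ip])
    show pM: "p \<in> M" using FM p by simp
    fix w
    let ?d = "D p (?Y a p) (?Y b) - (?Y (L.Gam x a b) p + q p (?Y a p) (?Y b p) *\<^sub>R N p)"
    have NY: "g p (N p) (?Y c p) = 0" for c using g_X_horizontal[OF pM] g_sym[OF pM] by simp
    have 1: "g p ?d (N p) = 0" using normal[of a b] g_X_horizontal[OF pM] g_E[OF pM, of m m] by (simp add: gb[OF pM])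
    have 2: "g p ?d (?Y c p) = 0" for c
      using kos[of x a b c] NY unfolding G p[symmetric] by (simp add: gb[OF pM])
    have "snd (cof p (w - g p w (N p) *\<^sub>R N p)) = 0"
      using tangent_iff[OF pM, of "w - g p w (N p) *\<^sub>R N p"] g_E[OF pM, of m m] by (simp add: gb[OF pM])
    then have "cof p (w - g p w (N p) *\<^sub>R N p) = (fst (cof p (w - g p w (N p) *\<^sub>R N p)), 0)"
      by (simp add: prod_eq_iff)
    then obtain c where "w - g p w (N p) *\<^sub>R N p = ?Y c p"
      using X_cof[OF pM, of "w - g p w (N p) *\<^sub>R N p"] by metis
    then have "w = ?Y c p + g p w (N p) *\<^sub>R N p" by (simp add: algebra_simps)
    then have "g p ?d w = g p ?d (?Y c p + g p w (N p) *\<^sub>R N p)" by (rule arg_cong)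
    then have "g p ?d w = 0" unfolding gb(2,8)[OF pM] 1 2 by simp
    then show "g p (D p (?Y a p) (?Y b)) w = g p (?Y (L.Gam x a b) p + q p (?Y a p) (?Y b p) *\<^sub>R N p) w"
      by (simp add: gb(3)[OF pM])
  qed
  have pM: "p \<in> M" using FM p by simp
  have NY: "g p (N p) (?Y c p) = 0" "g p (?Y c p) (N p) = 0" "g p (N p) (N p) = 1" for c
    using g_X_horizontal[OF pM] g_sym[OF pM] g_E[OF pM, of m m] by simp_all
  have prod: "g p (D p (?Y a p) (?Y b)) (D p (?Y c p) (?Y d)) =
      G x (L.Gam x a b) (L.Gam x c d) + q p (?Y a p) (?Y b p) * q p (?Y c p) (?Y d p)" for a b c d
    unfolding split G p[symmetric] by (simp add: gb[OF pM] NY)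
  have der: "deriv_within M (\<lambda>r. g r (D r (?Y b r) (?Y c)) (?Y d r)) p (?Y a p) = deriv_within UNIV (\<lambda>y. G y (L.Gam y b c) d) x a" for a b c d
    unfolding kos deriv_leaf[OF t smooth_g[OF smooth_D[OF smooth_X smooth_X] smooth_X]] p[symmetric] ..
  have z: "D p 0 W = 0" if "smooth_on M W" for W by (rule linear_0[OF linear_D[OF pM that]])
  have "Rm p (?Y u p) (?Y v p) (?Y w p) (?Y z p) = L.Rm x u v w z
      - q p (?Y v p) (?Y w p) * q p (?Y u p) (?Y z p) + q p (?Y u p) (?Y w p) * q p (?Y v p) (?Y z p)"
    unfolding Rm_via_metric[OF pM smooth_X smooth_X smooth_X smooth_X] X_bracket[OF pM] z[OF smooth_X]
      der prod L.Rm_const[OF UNIV_I] by (simp add: gb[OF pM])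
  then show ?thesis using flat unfolding flat_metric_on_def G_def[symmetric] by simp
qed

text \<open>Orthogonality to the leaf fields leaves a multiple of \<open>N\<close>; unit length
  makes the factor a sign, and the time field decides which.\<close>

lemma normal_unique:
  assumes p: "p \<in> M" and n1: "g p n n = 1" and orth: "\<And>u. g p n (X (u, 0) p) = 0" and pos: "g p n (X (0, 1) p) > 0"
  shows "n = N p"
proof -
  have "g p n (E i p) = 0" if i: "i < m" for i
  proof -
    have "snd (cof p (E i p)) = 0" using tangent_iff[OF p, of "E i p"] g_E[OF p, of i m] i by simp
    then have "E i p = X (fst (cof p (E i p)), 0) p" using X_cof[OF p, of "E i p"] by (metis prod.collapse)
    then show ?thesis using orth by metis
  qed
  then have n: "n = g p n (N p) *\<^sub>R N p" using E_expand[OF p, of n] by simp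
  let ?c = "g p n (N p)"
  have 1: "g p n v = ?c * g p (N p) v" for v
    using arg_cong[OF n, of "\<lambda>n. g p n v"] by (simp add: gb[OF p])
  have "?c * ?c = 1" using 1[of n] n1 g_sym[OF p, of "N p" n] by simp
  moreover have "?c * lapse p > 0" using 1[of "X (0, 1) p"] pos g_sym[OF p, of "N p"] by (simp add: lapse_def)
  then have "?c > 0" using lapse_pos[OF p] by (simp add: zero_less_mult_iff)
  ultimately have "?c = 1" by (metis abs_of_pos mult.right_neutral abs_mult_self_eq square_eq_1_iff abs_1 abs_minus_cancel)
  then show ?thesis using n by simp
qed

definition Jf where
  "Jf q p v = (\<Sum>a<Suc m. nabq M g q p (E a p) (E a p) v - nabq M g q p v (E a p) (E a p))"

text \<open>The differential of the trace is the trace of the derivative, because derivatives of the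
  frame cancel by \<open>contraction_antisym\<close>.\<close>

lemma current_density_frame:
  assumes q: "form_field M q" and q_sym: "\<And>p u v. p \<in> M \<Longrightarrow> q p u v = q p v u" and p: "p \<in> M"
  shows "current_density M g q p v = Jf q p v"
proof -
  note c = smooth_on_const[OF adm]
  have dim: "DIM('b \<times> real) = Suc m" by (simp add: m_dim)
  have bl: "bilinear (\<lambda>x y. nabq M g q p x y v)"
    using linear_nabq[OF p q] by (simp add: bilinear_def)
  have "divergence2 M g q p v = (\<Sum>b\<in>Basis. nabq M g q p b (dual_vec (g p) b) v)"
    unfolding divergence2_def by (intro sum.cong refl cov_deriv2_eq[OF p q c c])
  also have "\<dots> = (\<Sum>a<Suc m. nabq M g q p (E a p) (E a p) v)"
    by (rule trace_frame[OF g_ip[OF p] orthonormal_E[OF p] bl, unfolded dim])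
  finally have 1: "divergence2 M g q p v = (\<Sum>a<Suc m. nabq M g q p (E a p) (E a p) v)" .
  have sE: "a < Suc m \<Longrightarrow> smooth_on M (E a)" for a by (rule smooth_E) simp
  have anti: "g p (D p v (E a)) (E b p) = - g p (D p v (E b)) (E a p)" if "a < Suc m" "b < Suc m" for a b
  proof -
    have "deriv_within M (\<lambda>r. g r (E a r) (E b r)) p v = deriv_within M (\<lambda>_. if a = b then 1 else 0) p v"
      by (rule deriv_within_cong[OF _ p]) (use that in \<open>simp add: g_E\<close>)
    then show ?thesis using metric_compat[OF p sE[OF that(1)] sE[OF that(2)], of v] g_sym[OF p, of "E a p"]
      by (simp add: adm p)
  qed
  have ex: "D p v (E a) = (\<Sum>b<Suc m. g p (D p v (E a)) (E b p) *\<^sub>R E b p)" for a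
    using E_expand[OF p, of "D p v (E a)"] by simp
  have c0: "(\<Sum>a<Suc m. q p (D p v (E a)) (E a p) + q p (E a p) (D p v (E a))) = 0"
    by (rule contraction_antisym[OF form_fieldD(2)[OF q p], where a = "\<lambda>a b. g p (D p v (E a)) (E b p)", OF anti ex])
  have "deriv_within M (\<lambda>x. metric_trace (g x) (q x)) p v = deriv_within M (\<lambda>x. \<Sum>a<Suc m. q x (E a x) (E a x)) p v"
    unfolding metric_trace_def
    by (rule deriv_within_cong[OF _ p]) (rule trace_frame[OF g_ip orthonormal_E form_fieldD(2)[OF q], unfolded dim])
  also have "\<dots> = (\<Sum>a<Suc m. deriv_within M (\<lambda>x. q x (E a x) (E a x)) p v)"
    by (rule deriv_within_sum[OF adm p finite_lessThan]) (intro smooth_on_form[OF adm q] sE, simp_all)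
  also have "\<dots> = (\<Sum>a<Suc m. nabq M g q p v (E a p) (E a p) + (q p (D p v (E a)) (E a p) + q p (E a p) (D p v (E a))))"
    by (rule sum.cong[OF refl]) (use deriv_tensor[OF p q sE sE] in simp)
  also have "\<dots> = (\<Sum>a<Suc m. nabq M g q p v (E a p) (E a p))"
    by (simp only: sum.distrib[of "\<lambda>a. nabq M g q p v (E a p) (E a p)"] c0 add_0_right)
  finally show ?thesis unfolding current_density_def Jf_def 1 by (simp only: sum_subtractf)
qed

lemma linear_Jf: "p \<in> M \<Longrightarrow> form_field M q \<Longrightarrow> linear (Jf q p)"
  unfolding Jf_def[abs_def]
  by (intro linear_compose_sum ballI linear_compose_sub linear_nabq(1)) (simp_all add: linear_nabq)

text \<open>In the double sums the pairs of tangential indices cancel by the Gauss equation. Each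
  mixed pair occurs twice, which absorbs the factor 1/2 of the energy density.\<close>

lemma energy_density_frame:
  assumes q: "form_field M q" and q_sym: "\<And>p u v. p \<in> M \<Longrightarrow> q p u v = q p v u" and p: "p \<in> M"
    and gauss: "\<And>i j. i < m \<Longrightarrow> j < m \<Longrightarrow> Rm p (E i p) (E j p) (E j p) (E i p)
      + q p (E j p) (E j p) * q p (E i p) (E i p) - q p (E i p) (E j p) * q p (E j p) (E i p) = 0"
  shows "energy_density M g q p = (\<Sum>i<m. Rm p (N p) (E i p) (E i p) (N p) + q p (E i p) (E i p) * q p (N p) (N p)
        - q p (N p) (E i p) * q p (E i p) (N p))"
proof -
  have dim: "DIM('b \<times> real) = Suc m" by (simp add: m_dim)
  have sc: "scalar_curvature M g p = (\<Sum>a<Suc m. \<Sum>b<Suc m. Rm p (E a p) (E b p) (E b p) (E a p))"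
    unfolding scalar_curvature_def
    by (rule trace_frame2[OF g_ip[OF p] orthonormal_E[OF p], of "\<lambda>x y z w. Rm p x y w z", unfolded dim])
      (use linear_Rm[OF p] in \<open>simp_all add: bilinear_def\<close>)
  have tr: "metric_trace (g p) (q p) = (\<Sum>a<Suc m. q p (E a p) (E a p))"
    unfolding metric_trace_def by (rule trace_frame[OF g_ip[OF p] orthonormal_E[OF p] form_fieldD(2)[OF q p], unfolded dim])
  note qb = bilinear_simps[OF form_fieldD(2)[OF q p]]
  have nm: "norm_sq2 (g p) (q p) = (\<Sum>a<Suc m. \<Sum>b<Suc m. q p (E a p) (E b p) * q p (E a p) (E b p))"
    unfolding norm_sq2_def
    by (rule trace_frame2[OF g_ip[OF p] orthonormal_E[OF p], of "\<lambda>x y z w. q p x y * q p z w", unfolded dim])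
      (unfold bilinear_def, (intro conjI allI linearI; simp add: qb algebra_simps)+)
  let ?r = "\<lambda>i. Rm p (N p) (E i p) (E i p) (N p)" and ?q = "\<lambda>i j. q p (E i p) (E j p)"
  have R1: "(\<Sum>i<m. Rm p (E i p) (N p) (N p) (E i p)) = (\<Sum>i<m. ?r i)"
  proof (rule sum.cong[OF refl])
    show "Rm p (E i p) (N p) (N p) (E i p) = ?r i" for i
      using Rm_antisym1[OF p, of "E i p" "N p" "N p" "E i p"] Rm_antisym2[OF p, of "N p" "E i p" "N p" "E i p"] by simp
  qed
  have R2: "Rm p (N p) (N p) (N p) (N p) = 0" using Rm_antisym1[OF p, of "N p" "N p" "N p" "N p"] by simp
  have R3: "(\<Sum>i<m. \<Sum>j<m. Rm p (E i p) (E j p) (E j p) (E i p)) = (\<Sum>i<m. \<Sum>j<m. ?q i j * ?q i j) - (\<Sum>i<m. ?q i i) * (\<Sum>i<m. ?q i i)"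
  proof -
    have "(\<Sum>i<m. \<Sum>j<m. Rm p (E i p) (E j p) (E j p) (E i p)) = (\<Sum>i<m. \<Sum>j<m. ?q i j * ?q i j - ?q i i * ?q j j)"
    proof (intro sum.cong refl)
      fix i j assume "i \<in> {..<m}" "j \<in> {..<m}"
      then show "Rm p (E i p) (E j p) (E j p) (E i p) = ?q i j * ?q i j - ?q i i * ?q j j"
        using gauss[of i j] q_sym[OF p, of "E j p" "E i p"] by (simp add: mult.commute)
    qed
    then show ?thesis by (simp add: sum_subtractf sum_product)
  qed
  have S: "(\<Sum>i<m. ?q i m * ?q i m) = (\<Sum>i<m. ?q m i * ?q m i)" "(\<Sum>i<m. ?q m i * ?q i m) = (\<Sum>i<m. ?q m i * ?q m i)"
    using q_sym[OF p, of _ "N p"] by (auto intro!: sum.cong)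
  have "2 * energy_density M g q p = 2 * (\<Sum>i<m. ?r i) + 2 * ((\<Sum>i<m. ?q i i) * ?q m m) - 2 * (\<Sum>i<m. ?q m i * ?q m i)"
    unfolding energy_density_def sc tr nm
    by (simp only: sum.lessThan_Suc sum.distrib R1 R2 R3 S(1) power2_eq_square) (simp add: field_simps)
  then show ?thesis unfolding sum.distrib sum_subtractf S(2) by (simp add: sum_distrib_right)
qed

lemma norm1_frame:
  assumes p: "p \<in> M" and "linear \<alpha>"
  shows "norm1 (g p) \<alpha> = sqrt (\<Sum>a<Suc m. (\<alpha> (E a p))\<^sup>2)"
proof -
  have dim: "DIM('b \<times> real) = Suc m" by (simp add: m_dim)
  have "sharp (g p) \<alpha> = (\<Sum>a<Suc m. \<alpha> (E a p) *\<^sub>R E a p)"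
    by (rule sharp_frame[OF g_ip[OF p] orthonormal_E[OF p] assms(2), unfolded dim])
  then show ?thesis unfolding norm1_def by (simp only: linear_combo[OF assms(2)] power2_eq_square real_scaleR_def)
qed

text \<open>Here \<open>mu = - \<alpha> (N p)\<close>, so the norm of \<open>\<alpha>\<close> does
  not exceed its normal component and the tangential components must be 0.\<close>

lemma dominant_energy_equality:
  assumes p: "p \<in> M" and lin: "linear \<alpha>" and dec: "mu \<ge> norm1 (g p) \<alpha>" and eq: "mu + \<alpha> (N p) = 0" and w: "g p w (N p) = 0"
  shows "\<alpha> w = 0"
proof -
  have "0 \<le> norm1 (g p) \<alpha>" unfolding norm1_frame[OF p lin] by (intro real_sqrt_ge_zero sum_nonneg) simp
  then have "(norm1 (g p) \<alpha>)\<^sup>2 \<le> (\<alpha> (N p))\<^sup>2"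
    using power_mono[of "norm1 (g p) \<alpha>" "- \<alpha> (N p)" 2] dec eq by simp
  moreover have "(norm1 (g p) \<alpha>)\<^sup>2 = (\<Sum>a<m. (\<alpha> (E a p))\<^sup>2) + (\<alpha> (N p))\<^sup>2"
    unfolding norm1_frame[OF p lin] by (simp add: sum_nonneg)
  moreover have "(\<Sum>a<m. (\<alpha> (E a p))\<^sup>2) \<ge> 0" by (rule sum_nonneg) simp
  ultimately have "(\<Sum>a<m. (\<alpha> (E a p))\<^sup>2) = 0" by linarith
  then have z: "\<alpha> (E a p) = 0" if "a < m" for a using that by (simp add: sum_nonneg_eq_0_iff)
  have "\<alpha> w = \<alpha> (\<Sum>a<m. g p w (E a p) *\<^sub>R E a p)" by (rule arg_cong[OF E_expand_tan[OF p w]])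
  also have "\<dots> = 0" unfolding linear_combo[OF lin] by (simp add: z)
  finally show ?thesis .
qed

end

section \<open>Restriction to relatively open sets\<close>

text \<open>A derivative within a set depends only on the germ of the set at the point.\<close>

lemma deriv_within_openin:
  assumes "openin (top_of_set S) U" "p \<in> U"
  shows "deriv_within U f p v = deriv_within S f p v"
proof -
  obtain W where W: "open W" "U = S \<inter> W" using assms(1) openin_open by blast
  have "at p within S \<inter> W = at p within S"
    by (rule at_within_nhd[of p W]) (use W assms(2) in auto)
  then show ?thesis by (simp add: W(2))
qed

lemma admissible_openin:
  assumes "openin (top_of_set S) U" "admissible S"
  shows "admissible U"
  unfolding admissible_def
proof (intro ballI conjI allI impI)
  obtain W where W: "open W" "U = S \<inter> W" using assms(1) openin_open by blast
  fix p assume "p \<in> U"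
  then have p: "p \<in> S" "p \<in> W" using W by auto
  obtain r where r: "r > 0" "ball p r \<subseteq> W" using W(1) p(2) open_contains_ball by blast
  show "\<exists>d. 0 < \<bar>d\<bar> \<and> \<bar>d\<bar> < e \<and> p + d *\<^sub>R i \<in> U" if i: "i \<in> Basis" and e: "e > 0" for i e
  proof -
    obtain d where d: "0 < \<bar>d\<bar>" "\<bar>d\<bar> < min e r" "p + d *\<^sub>R i \<in> S"
      using assms(2)[unfolded admissible_def, rule_format, OF p(1), THEN conjunct1, rule_format, OF i, of "min e r"] e r(1) by auto
    have "p + d *\<^sub>R i \<in> ball p r" using d i by (simp add: dist_norm)
    then show ?thesis using d r W(2) by (intro exI[of _ d]) auto
  qed
  obtain e where e: "e > 0" "convex (S \<inter> ball p e)"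
    using assms(2)[unfolded admissible_def, rule_format, OF p(1)] by blast
  have "U \<inter> ball p (min e r) = (S \<inter> ball p e) \<inter> ball p (min e r)" using r W by auto
  then have "convex (U \<inter> ball p (min e r))" using convex_Int[OF e(2) convex_ball] by metis
  then show "\<exists>e>0. convex (U \<inter> ball p e)" using e r by (intro exI[of _ "min e r"]) auto
qed

lemma Ck_on_openin:
  assumes U: "openin (top_of_set S) U"
  shows "Ck_on k S f \<Longrightarrow> Ck_on k U f"
proof (induction k arbitrary: f)
  case 0
  then show ?case using continuous_on_subset openin_imp_subset[OF U] by auto
next
  case (Suc k)
  have "f differentiable_on U" using Suc.prems differentiable_on_subset openin_imp_subset[OF U] by auto
  moreover have "Ck_on k U (\<lambda>p. deriv_within U f p v)" for v
  proof (rule Ck_on_cong[THEN iffD2])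
    show "Ck_on k U (\<lambda>p. deriv_within S f p v)" by (rule Suc.IH) (use Suc.prems in simp)
    show "deriv_within U f p v = deriv_within S f p v" if "p \<in> U" for p by (rule deriv_within_openin[OF U that])
  qed
  ultimately show ?case by simp
qed

lemma christoffel_openin:
  "openin (top_of_set S) U \<Longrightarrow> p \<in> U \<Longrightarrow> christoffel U g p u v = christoffel S g p u v"
  by (simp add: christoffel_def deriv_within_openin)

lemma lc_deriv_openin:
  "openin (top_of_set S) U \<Longrightarrow> p \<in> U \<Longrightarrow> lc_deriv U g X Y p = lc_deriv S g X Y p"
  by (simp add: lc_deriv_def deriv_within_openin christoffel_openin)

lemma lc_deriv_openin2:
  assumes U: "openin (top_of_set S) U" and p: "p \<in> U"
  shows "lc_deriv U g X (lc_deriv U g Y Z) p = lc_deriv S g X (lc_deriv S g Y Z) p"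
proof -
  have e: "lc_deriv U g Y Z r = lc_deriv S g Y Z r" if "r \<in> U" for r by (rule lc_deriv_openin[OF U that])
  have "deriv_within U (lc_deriv U g Y Z) p (X p) = deriv_within U (lc_deriv S g Y Z) p (X p)"
    by (rule deriv_within_cong[OF e p])
  then show ?thesis
    unfolding lc_deriv_def[of _ g X] e[OF p] deriv_within_openin[OF U p] christoffel_openin[OF U p] by simp
qed

lemma riemann_openin:
  assumes U: "openin (top_of_set S) U" and p: "p \<in> U"
  shows "riemann U g X Y Z W p = riemann S g X Y Z W p"
proof -
  have lb: "lie_bracket U X Y p = lie_bracket S X Y p"
    by (simp add: lie_bracket_def deriv_within_openin[OF U p])
  have "lc_deriv U g (lie_bracket U X Y) Z p = lc_deriv S g (lie_bracket S X Y) Z p"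
    unfolding lc_deriv_def lb deriv_within_openin[OF U p] christoffel_openin[OF U p] ..
  then show ?thesis unfolding riemann_def lc_deriv_openin2[OF U p] by simp
qed

lemma cov_deriv2_openin:
  "openin (top_of_set S) U \<Longrightarrow> p \<in> U \<Longrightarrow> cov_deriv2 U g q X Y Z p = cov_deriv2 S g q X Y Z p"
  by (simp add: cov_deriv2_def deriv_within_openin lc_deriv_openin)

lemma nabq_openin:
  "openin (top_of_set S) U \<Longrightarrow> p \<in> U \<Longrightarrow> nabq U g q p x y z = nabq S g q p x y z"
  by (simp add: nabq_def deriv_within_openin christoffel_openin)

lemma form_field_openin:
  assumes U: "openin (top_of_set S) U" and B: "form_field S B" shows "form_field U B"
  using B Ck_on_openin[OF U] openin_imp_subset[OF U] unfolding form_field_def smooth_on_def by blast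

context metric_field
begin

lemma metric_field_openin:
  assumes U: "openin (top_of_set S) U" shows "metric_field U g"
  by (unfold_locales) (use admissible_openin[OF U adm] form_field_openin[OF U g_form] g_ip openin_imp_subset[OF U] in auto)

text \<open>The frame is smooth on \<open>U\<close> only and arbitrary elsewhere. Tensoriality is
  therefore applied on \<open>U\<close> as a space of its own, and the result is carried back to
  \<open>S\<close>.\<close>

lemma riemann_local:
  assumes U: "openin (top_of_set S) U" and p: "p \<in> U" and sm: "smooth_on U X" "smooth_on U Y" "smooth_on U Z"
  shows "riemann S g X Y Z W p = Rm p (X p) (Y p) (Z p) (W p)"
proof -
  interpret u: metric_field U g by (rule metric_field_openin[OF U])
  show ?thesis
    using u.riemann_tensorial[OF p sm, of W] unfolding riemann_at_def riemann_openin[OF U p] .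
qed

lemma cov_deriv2_local:
  assumes U: "openin (top_of_set S) U" and p: "p \<in> U" and q: "form_field S q" and sm: "smooth_on U Y" "smooth_on U Z"
  shows "cov_deriv2 S g q X Y Z p = nabq S g q p (X p) (Y p) (Z p)"
proof -
  interpret u: metric_field U g by (rule metric_field_openin[OF U])
  show ?thesis
    using u.cov_deriv2_eq[OF p form_field_openin[OF U q] sm, of X] unfolding cov_deriv2_openin[OF U p] nabq_openin[OF U p] .
qed

end

section \<open>Slabs over the torus\<close>

lemma admissible_torus_slab:
  assumes "a < b" shows "admissible (torus_slab a b :: ((real^'m) \<times> real) set)"
  unfolding admissible_def
proof (intro ballI conjI allI impI)
  fix p :: "(real^'m) \<times> real" assume p: "p \<in> torus_slab a b"
  obtain x t where pt: "p = (x, t)" by fastforce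
  have t: "a \<le> t" "t \<le> b" using p by (auto simp: pt torus_slab_def)
  show "\<exists>d. 0 < \<bar>d\<bar> \<and> \<bar>d\<bar> < e \<and> p + d *\<^sub>R i \<in> torus_slab a b" if i: "i \<in> Basis" and e: "e > 0" for i e
  proof (cases "snd i = 0")
    case True
    then show ?thesis using t e by (intro exI[of _ "e/2"]) (auto simp: torus_slab_def pt plus_prod_def scaleR_prod_def)
  next
    case False
    then have i1: "snd i = 1" using i by (auto simp: Basis_prod_def)
    show ?thesis
    proof (cases "t < b")
      case True
      define d where "d = min (e/2) (b - t)"
      have "0 < d" "d < e" "t + d \<le> b" using True e by (auto simp: d_def)
      then show ?thesis using t i1 by (intro exI[of _ d]) (auto simp: torus_slab_def pt plus_prod_def scaleR_prod_def)
    next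
      case False
      \<comment> \<open>At the upper end of the interval only a downward step stays in the
        slab.\<close>
      define d where "d = min (e/2) (b - a)"
      have "0 < d" "d < e" "d \<le> b - a" using assms e by (auto simp: d_def)
      then show ?thesis using t i1 False by (intro exI[of _ "-d"]) (auto simp: torus_slab_def pt plus_prod_def scaleR_prod_def)
    qed
  qed
  have "convex (torus_slab a b :: ((real^'m) \<times> real) set)"
    unfolding torus_slab_def by (intro convex_Times convex_UNIV convex_real_interval)
  then show "\<exists>e>0. convex (torus_slab a b \<inter> ball p e)" by (intro exI[of _ 1]) (auto intro: convex_Int)
qed

definition lattice :: "(real^'m) set" where
  "lattice = {k. \<forall>i. k $ i \<in> \<int>}"

lemma same_point_shift: "k \<in> lattice \<Longrightarrow> same_point (p + (k, 0)) p" "k \<in> lattice \<Longrightarrow> same_point p (p + (k, 0))"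
  by (auto simp: same_point_def lattice_def)

lemma same_pointD:
  assumes "same_point p p'" obtains k where "k \<in> lattice" "p = p' + (k, 0)"
proof
  show "fst p - fst p' \<in> lattice" using assms by (simp add: same_point_def lattice_def)
  show "p = p' + (fst p - fst p', 0)" using assms by (simp add: same_point_def prod_eq_iff)
qed

lemma torus_slab_shift: "p \<in> torus_slab a b \<Longrightarrow> p + (k, 0) \<in> torus_slab a b"
  by (auto simp: torus_slab_def)

text \<open>A lift moves lattice translates of a point by a continuous, integer-valued, hence constant vector.\<close>

lemma deriv_lift_periodic:
  fixes F :: "(real^'m) \<times> real \<Rightarrow> (real^'m) \<times> real"
  assumes "a < b" and F: "smooth_on (torus_slab a b) F"
    and per: "\<And>y. y \<in> torus_slab a b \<Longrightarrow> same_point (F (y + (k, 0))) (F y)" and y: "y \<in> torus_slab a b"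
  shows "deriv_within (torus_slab a b) F (y + (k, 0)) u = deriv_within (torus_slab a b) F y u"
proof -
  let ?T = "torus_slab a b :: ((real^'m) \<times> real) set" and ?s = "\<lambda>y. y + (k, 0 :: real)"
  note adm = admissible_torus_slab[OF assms(1), where 'm = 'm]
  have s: "smooth_on ?T ?s" by (intro smooth_on_add smooth_on_ident smooth_on_const adm)
  have sT: "?s ` ?T \<subseteq> ?T" using torus_slab_shift by blast
  define h where "h = (\<lambda>y. F (?s y) - F y)"
  have hs: "smooth_on ?T h"
    unfolding h_def by (rule smooth_on_diff[OF adm smooth_on_compose[OF adm sT s F] F])
  have conn: "connected ?T" unfolding torus_slab_def
    by (intro convex_connected convex_Times convex_UNIV convex_real_interval)
  have const: "(\<lambda>y. fst (h y) $ i) constant_on ?T" for i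
  proof (rule continuous_discrete_range_constant[OF conn])
    show "continuous_on ?T (\<lambda>y. fst (h y) $ i)"
      by (intro continuous_intros smooth_on_imp_continuous_on[OF hs])
    have Z: "fst (h y) $ i \<in> \<int>" if "y \<in> ?T" for y using per[OF that] by (simp add: h_def same_point_def)
    show "\<exists>e>0. \<forall>z. z \<in> ?T \<and> fst (h z) $ i \<noteq> fst (h y) $ i \<longrightarrow> e \<le> norm (fst (h z) $ i - fst (h y) $ i)" if "y \<in> ?T" for y
    proof (intro exI[of _ 1] conjI allI impI)
      fix z assume z: "z \<in> ?T \<and> fst (h z) $ i \<noteq> fst (h y) $ i"
      have "fst (h z) $ i - fst (h y) $ i \<in> \<int>" using Z[of z] Z[OF that] z by (intro Ints_diff) auto
      then show "1 \<le> norm (fst (h z) $ i - fst (h y) $ i)" using z Ints_nonzero_abs_ge1 by fastforce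
    qed simp
  qed
  have "h z = h y" if z: "z \<in> ?T" for z
  proof (rule prod_eqI)
    have "fst (h z) $ i = fst (h y) $ i" for i
      using const[of i] z y unfolding constant_on_def by metis
    then show "fst (h z) = fst (h y)" by (simp add: vec_eq_iff)
    have "snd (h z) = 0" if "z \<in> ?T" for z using per[OF that] by (simp add: h_def same_point_def)
    then show "snd (h z) = snd (h y)" using z y by simp
  qed
  then have "F (?s z) = F z + h y" if "z \<in> ?T" for z using that unfolding h_def by (metis add_diff_cancel_left' add.commute diff_add_cancel)
  then have "deriv_within ?T (\<lambda>z. F (?s z)) y u = deriv_within ?T (\<lambda>z. F z + h y) y u"
    by (intro deriv_within_cong[OF _ y])
  also have "\<dots> = deriv_within ?T F y u"
    unfolding deriv_within_add[OF adm y F smooth_on_const[OF adm]] deriv_within_const[OF adm y] by simp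
  also have "deriv_within ?T (\<lambda>z. F (?s z)) y u = deriv_within ?T F (?s y) (deriv_within ?T ?s y u)"
    by (rule deriv_within_compose[OF adm y sT s F])
  also have "deriv_within ?T ?s y u = u"
    unfolding deriv_within_add[OF adm y smooth_on_ident[OF adm] smooth_on_const[OF adm]] deriv_within_const[OF adm y]
    using deriv_within_eqI[OF adm y has_derivative_ident] by simp
  finally show ?thesis .
qed

lemma sym_tensor_fieldD:
  assumes "sym_tensor_field M q"
  shows "form_field M q" "p \<in> M \<Longrightarrow> q p u v = q p v u"
    "p \<in> M \<Longrightarrow> p + (k, 0) \<in> M \<Longrightarrow> k \<in> lattice \<Longrightarrow> q (p + (k, 0)) = q p"
  using assms same_point_shift unfolding sym_tensor_field_def form_field_def by blast+

section \<open>Application to the given foliation and local frame\<close>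

theorem theorem4p1:
  fixes n :: nat
    and M :: "((real^'m::finite) \<times> real) set"
    and g q :: "(real^'m) \<times> real \<Rightarrow> (real^'m) \<times> real \<Rightarrow> (real^'m) \<times> real \<Rightarrow> real"
    and N_plus N_minus :: "real^'m \<Rightarrow> (real^'m) \<times> real"
    and len :: real
    and F \<nu> :: "(real^'m) \<times> real \<Rightarrow> (real^'m) \<times> real"
    and U :: "((real^'m) \<times> real) set"
    and e :: "nat \<Rightarrow> (real^'m) \<times> real \<Rightarrow> (real^'m) \<times> real"
  assumes "3 \<le> n" and "n \<le> 7" and "CARD('m) = n - 1"
    and "M = torus_slab (-1) 1"
    and "initial_data_set M g q"
    and "dominant_energy_condition M g q"
    and "unit_normal_along g (\<lambda>x. (x, 1)) N_plus" and "\<forall>x. snd (N_plus x) > 0"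
    and "\<forall>x. null_expansion M g q (\<lambda>x. (x, 1)) N_plus x \<ge> 0"
    and "unit_normal_along g (\<lambda>x. (x, -1)) N_minus" and "\<forall>x. snd (N_minus x) > 0"
    and "\<forall>x. null_expansion M g q (\<lambda>x. (x, -1)) N_minus x \<le> 0"
    and "flat_torus_foliation M g q len F \<nu>"
    and "openin (top_of_set M) U"
    and "orthonormal_frame_on U g n e" and "\<forall>p\<in>U. e n p = \<nu> p"
  shows "\<forall>p\<in>U. \<forall>i\<in>{1..<n}. \<forall>j\<in>{1..<n}. \<forall>k\<in>{1..<n}. \<forall>l\<in>{1..<n}.
      nabla_q M g q e p i j n - nabla_q M g q e p j i n = 0 \<and>
      Rhat M g q e p n j k n = nabla_q M g q e p n j k - nabla_q M g q e p j n k \<and>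
      Rhat M g q e p i j k l = 0 \<and>
      Rhat M g q e p i j k n = - (nabla_q M g q e p i j k - nabla_q M g q e p j i k)"
proof -
  note M = assms(4) and DEC = assms(6) and U = assms(14) and frame = assms(15)[unfolded orthonormal_frame_on_def]
    and e_nu = assms(16)
  define T where "T = (torus_slab 0 len :: ((real^'m) \<times> real) set)"
  define Fi where "Fi = inv_into T F"
  have gS: "sym_tensor_field M g" and gpos: "\<And>p v. p \<in> M \<Longrightarrow> v \<noteq> 0 \<Longrightarrow> g p v v > 0" and qS: "sym_tensor_field M q"
    using assms(5) unfolding initial_data_set_def by blast+
  note fol = assms(13)[unfolded flat_torus_foliation_def, folded T_def]
  have len: "len > 0" and diffeo: "torus_diffeo T M F" using fol by blast+
  have bij: "bij_betw F T M" and F_sm: "smooth_on T F" and Fi_sm: "smooth_on M Fi"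
    and same: "\<And>p p'. p \<in> T \<Longrightarrow> p' \<in> T \<Longrightarrow> same_point (F p) (F p') \<longleftrightarrow> same_point p p'"
    using diffeo unfolding torus_diffeo_def Fi_def by blast+
  have admM: "admissible M" unfolding M by (rule admissible_torus_slab) simp
  have F_in: "F y \<in> M" if "y \<in> T" for y using bij that by (auto simp: bij_betw_def)
  have Fi_in: "Fi p \<in> T" and F_Fi: "F (Fi p) = p" if "p \<in> M" for p
    using bij that inv_into_into[of p F T] f_inv_into_f[of p F T] by (auto simp: bij_betw_def Fi_def)
  have Fi_F: "Fi (F y) = y" if "y \<in> T" for y using bij that by (simp add: bij_betw_def Fi_def)
  have shift: "p \<in> M \<Longrightarrow> p + (k, 0) \<in> M" "y \<in> T \<Longrightarrow> y + (k, 0) \<in> T" for p y k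
    unfolding M T_def by (rule torus_slab_shift, assumption)+
  have F_same: "same_point (F (y + (k, 0))) (F y)" if "y \<in> T" "k \<in> lattice" for y k
    using same[OF shift(2)[OF that(1)] that(1)] same_point_shift(1)[OF that(2)] by blast
  interpret foliation M g T F Fi lattice "CARD('m)"
  proof
    show "admissible M" by (rule admM)
    show "form_field M g" by (rule sym_tensor_fieldD[OF gS])
    show "inner_product (g p)" if "p \<in> M" for p
      unfolding inner_product_def
      using form_fieldD(2)[OF sym_tensor_fieldD(1)[OF gS] that] sym_tensor_fieldD(2)[OF gS that] gpos[OF that] by blast
    show "CARD('m) = DIM(real^'m)" by simp
    show "admissible T" unfolding T_def by (rule admissible_torus_slab[OF len])
    show "(x, t) \<in> T \<Longrightarrow> (x', t) \<in> T" "(x, t) \<in> M \<Longrightarrow> (x', t) \<in> M" for x x' t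
      unfolding M T_def torus_slab_def by simp_all
    show "Basis \<subseteq> (lattice :: (real^'m) set)"
      by (auto simp: lattice_def Basis_vec_def axis_def)
    show "g (p + (k, 0)) = g p" if "p \<in> M" "k \<in> lattice" for p k
      by (rule sym_tensor_fieldD(3)[OF gS that(1) shift(1)[OF that(1)] that(2)])
    show "\<exists>k'\<in>lattice. F (y + (k, 0)) = F y + (k', 0)" if "y \<in> T" "k \<in> lattice" for y k
      by (rule same_pointD[OF F_same[OF that]]) blast
    show "\<exists>k'\<in>lattice. Fi (p + (k, 0)) = Fi p + (k', 0)" if "p \<in> M" "k \<in> lattice" for p k
    proof -
      \<comment> \<open>The lift respects lattice equivalence in both directions, so equivalence may
        be tested after applying \<open>F\<close>.\<close>
      have "same_point (F (Fi (p + (k, 0)))) (F (Fi p))"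
        unfolding F_Fi[OF that(1)] F_Fi[OF shift(1)[OF that(1)]] by (rule same_point_shift(1)[OF that(2)])
      then have "same_point (Fi (p + (k, 0))) (Fi p)"
        using same[OF Fi_in[OF shift(1)[OF that(1)]] Fi_in[OF that(1)]] by blast
      then show ?thesis by (rule same_pointD) blast
    qed
    show "deriv_within T F (y + (k, 0)) u = deriv_within T F y u" if "y \<in> T" "k \<in> lattice" for y k u
      unfolding T_def
      by (rule deriv_lift_periodic[OF len F_sm[unfolded T_def] F_same[unfolded T_def, OF _ that(2)] that(1)[unfolded T_def]])
  qed (rule F_sm Fi_sm F_in Fi_in F_Fi Fi_F; assumption?)+
  have q_form: "form_field M q" and q_sym: "\<And>p u v. p \<in> M \<Longrightarrow> q p u v = q p v u"
    using sym_tensor_fieldD[OF qS] by blast+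
  have leaf_pt: "\<exists>x t. t \<in> {0..len} \<and> (x, t) \<in> T \<and> p = F (x, t)" if "p \<in> M" for p
    using Fi_in[OF that] F_Fi[OF that] unfolding T_def torus_slab_def
    by (intro exI[of _ "fst (Fi p)"] exI[of _ "snd (Fi p)"]) (auto simp: mem_Times_iff)
  have xtT: "(x, t) \<in> T" if "t \<in> {0..len}" for x t using that unfolding T_def torus_slab_def by simp
  have dF: "deriv_within UNIV (\<lambda>x. F (x, t)) x u = X (u, 0) (F (x, t))" if "t \<in> {0..len}" for x t u
    using deriv_leaf[OF xtT[OF that] smooth_on_ident[OF adm], of x u] deriv_ident[OF adm F_in[OF xtT[OF that]], of "\<lambda>x. x"] by simp
  \<comment> \<open>The given normal is the last Gram-Schmidt vector: both are unit, orthogonal to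
    the leaf and positive on the time field.\<close>
  have nu: "\<nu> p = N p" if p: "p \<in> M" for p
  proof -
    obtain x t where xt: "t \<in> {0..len}" "(x, t) \<in> T" "p = F (x, t)" using leaf_pt[OF p] by blast
    have un: "unit_normal_along g (\<lambda>x. F (x, t)) (\<lambda>x. \<nu> (F (x, t)))"
      and pos: "g (F (x, t)) (\<nu> (F (x, t))) (deriv_within T F (x, t) (0, 1)) > 0"
      using fol xt(1) by blast+
    show ?thesis
    proof (rule normal_unique[OF p])
      show "g p (\<nu> p) (\<nu> p) = 1" using un xt(3) by (simp add: unit_normal_along_def)
      show "g p (\<nu> p) (X (u, 0) p) = 0" for u using un xt(3) by (simp add: unit_normal_along_def dF[OF xt(1)])
      show "g p (\<nu> p) (X (0, 1) p) > 0" using pos xt(3) Fi_F[OF xt(2)] by (simp add: X_def)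
    qed
  qed
  \<comment> \<open>Derivatives of the normal along the parametrized leaf become derivatives within
    \<open>M\<close> along the fields \<open>X (u, 0)\<close>.\<close>
  have leaf: "g p (D p (X (u, 0) p) N) (X (v, 0) p) = - q p (X (u, 0) p) (X (v, 0) p)" if p: "p \<in> M" for p u v
  proof -
    obtain x t where xt: "t \<in> {0..len}" "(x, t) \<in> T" "p = F (x, t)" using leaf_pt[OF p] by blast
    have "null_second_fundamental_form M g q (\<lambda>x. F (x, t)) (\<lambda>x. \<nu> (F (x, t))) x u v = 0"
      using fol xt(1) by blast
    moreover have "(\<lambda>x. \<nu> (F (x, t))) = (\<lambda>x. N (F (x, t)))" using nu[OF F_in[OF xtT[OF xt(1)]]] by simp
    ultimately have "g p (deriv_within M N p (X (u, 0) p) + Gam p (X (u, 0) p) (N p)) (X (v, 0) p) + q p (X (u, 0) p) (X (v, 0) p) = 0"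
      unfolding null_second_fundamental_form_def second_fundamental_form_def dF[OF xt(1)] xt(3)
      by (simp add: deriv_leaf[OF xt(2) smooth_E[OF order_refl]] nu[OF F_in[OF xt(2)]])
    then show ?thesis by (simp add: nab_def)
  qed
  have gauss: "Rm p (X (u, 0) p) (X (v, 0) p) (X (w, 0) p) (X (z, 0) p)
      + q p (X (v, 0) p) (X (w, 0) p) * q p (X (u, 0) p) (X (z, 0) p)
      - q p (X (u, 0) p) (X (w, 0) p) * q p (X (v, 0) p) (X (z, 0) p) = 0" if p: "p \<in> M" for p u v w z
  proof -
    obtain x t where xt: "t \<in> {0..len}" "(x, t) \<in> T" "p = F (x, t)" using leaf_pt[OF p] by blast
    have "flat_metric_on UNIV (induced_metric g (\<lambda>x. F (x, t)))" using fol xt(1) by blast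
    from gauss_equation[OF xt(2) q_sym leaf this xt(3)] show ?thesis by simp
  qed
  have E_X: "\<exists>u. E i p = X (u, 0) p" if p: "p \<in> M" and i: "i < CARD('m)" for p i
  proof -
    have "snd (cof p (E i p)) = 0" using tangent_iff[OF p, of "E i p"] g_E[OF p, of i "CARD('m)"] i by simp
    then have "cof p (E i p) = (fst (cof p (E i p)), 0)" by (simp add: prod_eq_iff)
    then show ?thesis using X_cof[OF p, of "E i p"] by metis
  qed
  have gaussE: "Rm p (E i p) (E j p) (E j p) (E i p) + q p (E j p) (E j p) * q p (E i p) (E i p)
      - q p (E i p) (E j p) * q p (E j p) (E i p) = 0" if p: "p \<in> M" and ij: "i < CARD('m)" "j < CARD('m)" for p i j
  proof -
    obtain a where a: "E i p = X (a, 0) p" using E_X[OF p ij(1)] by blast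
    obtain b where b: "E j p = X (b, 0) p" using E_X[OF p ij(2)] by blast
    show ?thesis unfolding a b by (rule gauss[OF p])
  qed
  have cur: "current_density M g q p v = Jf q p v" if p: "p \<in> M" for p v
    by (rule current_density_frame[OF q_form _ p]) (rule q_sym)
  have ener: "energy_density M g q p = (\<Sum>i<CARD('m). Rm p (N p) (E i p) (E i p) (N p) + q p (E i p) (E i p) * q p (N p) (N p)
        - q p (N p) (E i p) * q p (E i p) (N p))" if p: "p \<in> M" for p
    by (rule energy_density_frame[OF q_form _ p gaussE[OF p]]) (rule q_sym)
  have nsym: "nabq M g q p x y z = nabq M g q p x z y" if p: "p \<in> M" for p x y z
    by (rule nabq_sym[OF p]) (rule q_sym)
  have mu_J: "energy_density M g q p + Jf q p (N p) = 0" if p: "p \<in> M" for p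
  proof -
    obtain x t where xt: "t \<in> {0..len}" "(x, t) \<in> T" "p = F (x, t)" using leaf_pt[OF p] by blast
    have "energy_density M g q p + current_density M g q p (\<nu> p) = 0" using fol xt(1) unfolding xt(3) by blast
    then show ?thesis unfolding nu[OF p] cur[OF p] .
  qed
  have swap: "(\<Sum>a<CARD('m). nabq M g q p (E a p) (E a p) v - nabq M g q p v (E a p) (E a p)) =
      (\<Sum>a<CARD('m). nabq M g q p (E a p) v (E a p) - nabq M g q p v (E a p) (E a p))" if p: "p \<in> M" for p v
    by (rule sum.cong[OF refl], rule arg_cong2[where f = "(-)", OF nsym[OF p] refl])
  interpret rigid_foliation M g T F Fi lattice "CARD('m)" q
  proof
    show "form_field M q" by (rule q_form)
    show "p \<in> M \<Longrightarrow> q p u v = q p v u" for p u v by (rule q_sym)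
    show "q (p + (k, 0)) = q p" if "p \<in> M" "k \<in> lattice" for p k
      by (rule sym_tensor_fieldD(3)[OF qS that(1) shift(1)[OF that(1)] that(2)])
    show "g p (D p (X u p) N) (X v p) = - q p (X u p) (X v p)" if "p \<in> M" "snd u = 0" "snd v = 0" for p u v
      using leaf[OF that(1), of "fst u" "fst v"] that(2,3) by (metis prod.collapse)
    show "Rm p (X u p) (X v p) (X w p) (X z p) + q p (X v p) (X w p) * q p (X u p) (X z p) - q p (X u p) (X w p) * q p (X v p) (X z p) = 0"
      if "p \<in> M" "snd u = 0" "snd v = 0" "snd w = 0" "snd z = 0" for p u v w z
      using gauss[OF that(1), of "fst u" "fst v" "fst w" "fst z"] that(2-5) by (metis prod.collapse)
    show "(\<Sum>i<CARD('m). Rm p (N p) (E i p) (E i p) (N p) + q p (E i p) (E i p) * q p (N p) (N p)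
        - q p (N p) (E i p) * q p (E i p) (N p)
        - (nabq M g q p (N p) (E i p) (E i p) - nabq M g q p (E i p) (N p) (E i p))) = 0" if p: "p \<in> M" for p
    proof -
      have "Jf q p (N p) = (\<Sum>i<CARD('m). nabq M g q p (E i p) (N p) (E i p) - nabq M g q p (N p) (E i p) (E i p))"
        unfolding Jf_def sum.lessThan_Suc swap[OF p, of "N p"] by simp
      then show ?thesis
        using mu_J[OF p] unfolding ener[OF p] sum_subtractf sum.distrib by linarith
    qed
    show "(\<Sum>j<CARD('m). nabq M g q p (E j p) w (E j p) - nabq M g q p w (E j p) (E j p))
        + (nabq M g q p (N p) w (N p) - nabq M g q p w (N p) (N p)) = 0" if p: "p \<in> M" and w: "g p w (N p) = 0" for p w
    proof -
      have "current_density M g q p = Jf q p" by (rule ext) (rule cur[OF p])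
      then have "energy_density M g q p \<ge> norm1 (g p) (Jf q p)"
        using DEC p unfolding dominant_energy_condition_def by metis
      from dominant_energy_equality[OF p linear_Jf[OF p q_form] this mu_J[OF p] w]
      show ?thesis unfolding Jf_def sum.lessThan_Suc swap[OF p, of w] nsym[OF p, of "N p" "N p" w] .
    qed
  qed
  show ?thesis
  proof (intro ballI)
    fix p i j k l assume pU: "p \<in> U" and ijkl: "i \<in> {1..<n}" "j \<in> {1..<n}" "k \<in> {1..<n}" "l \<in> {1..<n}"
    have p: "p \<in> M" using openin_imp_subset[OF U] pU by blast
    have n: "n \<in> {1..n}" using assms(1) by simp
    have le: "a \<in> {1..n}" if "a \<in> {1..<n}" for a using that by simp
    have en: "e n p = N p" using e_nu pU nu[OF p] by simp
    \<comment> \<open>As \<open>e n\<close> is the unit normal on \<open>U\<close>, orthonormality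
      makes the other frame vectors tangent to the leaves.\<close>
    have tE: "g p (e a p) (N p) = 0" if "a \<in> {1..<n}" for a
      using frame pU le[OF that] n that unfolding en[symmetric] by fastforce
    note t = ijkl[THEN tE]
    have se: "smooth_on U (e a)" if "a \<in> {1..n}" for a using frame that by blast
    have nq: "nabla_q M g q e p a b c = nabq M g q p (e a p) (e b p) (e c p)" if "b \<in> {1..n}" "c \<in> {1..n}" for a b c
      unfolding nabla_q_def by (rule cov_deriv2_local[OF U pU q_form se[OF that(1)] se[OF that(2)]])
    have Rh: "Rhat M g q e p a b c d = hR p (e a p) (e b p) (e c p) (e d p)" if "a \<in> {1..n}" "b \<in> {1..n}" "c \<in> {1..n}" for a b c d
      unfolding Rhat_def hR_def riemann_local[OF U pU se[OF that(1)] se[OF that(2)] se[OF that(3)]] ..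
    note r = ijkl[THEN le] n
    \<comment> \<open>The last identity holds as 0 = 0: \<open>hR_codazzi\<close> gives plus
      \<open>C\<close>, the claim has minus \<open>C\<close>, and \<open>C_tan_zero\<close> removes
      both.\<close>
    show "nabla_q M g q e p i j n - nabla_q M g q e p j i n = 0 \<and>
      Rhat M g q e p n j k n = nabla_q M g q e p n j k - nabla_q M g q e p j n k \<and>
      Rhat M g q e p i j k l = 0 \<and>
      Rhat M g q e p i j k n = - (nabla_q M g q e p i j k - nabla_q M g q e p j i k)"
      unfolding nq[OF r(2,5)] nq[OF r(1,5)] nq[OF r(2,3)] nq[OF r(5,3)] nq[OF r(1,3)]
        Rh[OF r(5,2,3)] Rh[OF r(1,2,3)] en C_def[symmetric]
        C_tan_N[OF p t(1,2)] hR_normal'[OF p t(2,3)] gauss'[OF p t] hR_codazzi[OF p t(1,2,3)] C_tan_zero[OF p t(1,2,3)]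
      by simp
  qed
qed

end
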